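(* For infinitely many integer values of $n$, there exists an $n$-vertex independent-parallel SP-graph for which every rectilinear representation has a component with spirality $\Omega(\log n)$.
   Context: An SP-graph is a biconnected graph none of whose triconnected components is triconnected; it is independent-parallel if no two parallel components (P-nodes of its SPQ$^*$-tree) share a pole. SPQ$^*$-tree: leaves are Q$^*$-nodes, each representing a maximal chain of edges whose internal vertices have degree 2 and endpoints have degree $>2$; internal nodes are S-nodes (series) and P-nodes (parallel). For a Q$^*$-node $\rho$, $T_\rho$ is the tree rooted at $\rho$; the chain of $\rho$ is the reference chain. For a node $\nu$ of $T_\rho$, its poles are the end-vertices of the virtual edge linking it to its parent (for a Q$^*$-node, the endpoints of its chain), and its pertinent graph $G_{\nu,\rho}$ is the union of the chains of the leaves in the subtree of $T_\rho$ rooted at $\nu$. A rectilinear representation $H$ of $G$ is a planar orthogonal representation without bends. Given $H$ with the reference chain on the external face, the restriction $H_{\nu,\rho}$ of $H$ to $G_{\nu,\rho}$ is a component of $H$. Spirality of $H_{\nu,\rho}$: order the poles $u,v$ of $\nu$ by an $st$-numbering of $G$ where $s,t$ are the poles of $\rho$. For a pole $w$, let $\mathrm{indeg}_\nu(w)$, $\mathrm{outdeg}_\nu(w)$ be the degree of $w$ inside and outside $H_{\nu,\rho}$. Alias vertices $w',w''$ of $w$: if $\mathrm{indeg}_\nu(w)=1$ then $w'=w''=w$; if $\mathrm{indeg}_\nu(w)=\mathrm{outdeg}_\nu(w)=2$, then $w',w''$ are dummy vertices subdividing the two distinct edges incident to $w$ outside $H_{\nu,\rho}$; if $\mathrm{indeg}_\nu(w)>1$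 and $\mathrm{outdeg}_\nu(w)=1$, then $w'=w''$ is a dummy vertex subdividing the edge incident to $w$ outside $H_{\nu,\rho}$. For alias vertices $u^*$ of $u$ and $v^*$ of $v$ and any simple $u$–$v$ path $P$ in $H_{\nu,\rho}$, the spine $S^{u^*v^*}$ is $(u^*,u)\,P\,(v,v^* )$ and $n(S^{u^*v^*})$ is the number of right turns minus left turns along it from $u^*$ to $v^*$. The spirality $\sigma(H_{\nu,\rho})$ is: $n(S^{u'v'})$ if both poles have one alias vertex; $\frac{n(S^{u'v'})+n(S^{u'v''})}{2}$ if only $v$ has two; $\frac{n(S^{u'v'})+n(S^{u''v'})}{2}$ if only $u$ has two; and if both have two, with $(u,u')$ preceding $(u,u'')$ counterclockwise around $u$ and $(v,v')$ preceding $(v,v'')$ clockwise around $v$, it is $\frac{n(S^{u'v'})+n(S^{u''v''})}{2}$. This value does not depend on the choice of $P$. *)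

theory Defs
  imports Complex_Main
begin

definition simple_graph :: "nat set \<Rightarrow> nat set set \<Rightarrow> bool" where
  "simple_graph V E \<longleftrightarrow> finite V \<and>
     (\<forall>e\<in>E. \<exists>u v. e = {u, v} \<and> u \<noteq> v \<and> u \<in> V \<and> v \<in> V)"

definition nbrs :: "nat set set \<Rightarrow> nat \<Rightarrow> nat set" where
  "nbrs E v = {u. {u, v} \<in> E}"

definition deg :: "nat set set \<Rightarrow> nat \<Rightarrow> nat" where
  "deg E v = card (nbrs E v)"

definition connected_graph :: "nat set \<Rightarrow> nat set set \<Rightarrow> bool" where
  "connected_graph V E \<longleftrightarrow>
     (\<forall>u\<in>V. \<forall>v\<in>V. (\<lambda>x y. {x, y} \<in> E \<and> x \<in> V \<and> y \<in> V)\<^sup>*\<^sup>* u v)"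

definition biconnected :: "nat set \<Rightarrow> nat set set \<Rightarrow> bool" where
  "biconnected V E \<longleftrightarrow> card V \<ge> 3 \<and> connected_graph V E \<and>
     (\<forall>x\<in>V. connected_graph (V - {x}) {e\<in>E. x \<notin> e})"

definition path_edges :: "nat list \<Rightarrow> nat set set" where
  "path_edges p = {{p ! i, p ! Suc i} | i. Suc i < length p}"

definition is_chain :: "nat set \<Rightarrow> nat set set \<Rightarrow> nat list \<Rightarrow> bool" where
  "is_chain V E p \<longleftrightarrow> length p \<ge> 2 \<and> distinct p \<and> set p \<subseteq> V \<and> path_edges p \<subseteq> E \<and>
     (\<forall>i. 0 < i \<and> i < length p - 1 \<longrightarrow> deg E (p ! i) = 2) \<and>
     deg E (hd p) > 2 \<and> deg E (last p) > 2"

text \<open>A node of the SPQ*-tree rooted at a Q*-node: a Q*-node carrying its chain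
  (oriented from its first to its second pole), or an S-/P-node carrying its
  (ordered) poles and its children.\<close>
datatype dtree = QN "nat list" | SN nat nat "dtree list" | PN nat nat "dtree list"

fun poles :: "dtree \<Rightarrow> nat \<times> nat" where
  "poles (QN p) = (hd p, last p)"
| "poles (SN u v ts) = (u, v)"
| "poles (PN u v ts) = (u, v)"

fun eds :: "dtree \<Rightarrow> nat set set" where
  "eds (QN p) = path_edges p"
| "eds (SN u v ts) = \<Union> (set (map eds ts))"
| "eds (PN u v ts) = \<Union> (set (map eds ts))"

fun vts :: "dtree \<Rightarrow> nat set" where
  "vts (QN p) = set p"
| "vts (SN u v ts) = \<Union> (set (map vts ts))"
| "vts (PN u v ts) = \<Union> (set (map vts ts))"

fun nodes :: "dtree \<Rightarrow> dtree set" where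
  "nodes (QN p) = {QN p}"
| "nodes (SN u v ts) = insert (SN u v ts) (\<Union> (set (map nodes ts)))"
| "nodes (PN u v ts) = insert (PN u v ts) (\<Union> (set (map nodes ts)))"

fun is_S :: "dtree \<Rightarrow> bool" where
  "is_S (SN u v ts) = True" | "is_S _ = False"

fun is_P :: "dtree \<Rightarrow> bool" where
  "is_P (PN u v ts) = True" | "is_P _ = False"

definition local_ok :: "nat set \<Rightarrow> nat set set \<Rightarrow> dtree \<Rightarrow> bool" where
  "local_ok V E t = (case t of
      QN p \<Rightarrow> is_chain V E p
    | SN u v ts \<Rightarrow> length ts \<ge> 2 \<and> u \<noteq> v \<and> (\<forall>c\<in>set ts. \<not> is_S c) \<and>
        fst (poles (hd ts)) = u \<and> snd (poles (last ts)) = v \<and>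
        (\<forall>i. Suc i < length ts \<longrightarrow> snd (poles (ts ! i)) = fst (poles (ts ! Suc i))) \<and>
        (\<forall>i j. i < j \<and> j < length ts \<longrightarrow>
           vts (ts ! i) \<inter> vts (ts ! j) = (if j = Suc i then {snd (poles (ts ! i))} else {}))
    | PN u v ts \<Rightarrow> length ts \<ge> 2 \<and> u \<noteq> v \<and> (\<forall>c\<in>set ts. \<not> is_P c \<and> poles c = (u, v)) \<and>
        (\<forall>i j. i < j \<and> j < length ts \<longrightarrow>
           vts (ts ! i) \<inter> vts (ts ! j) = {u, v} \<and> eds (ts ! i) \<inter> eds (ts ! j) = {}))"

text \<open>\<open>rooted_decomp V E \<rho> T\<close>: \<open>\<rho>\<close> is a Q*-node (reference chain) and \<open>T\<close> is the
  subtree of \<open>T\<^sub>\<rho>\<close> hanging below \<open>\<rho>\<close>, whose poles are the poles of \<open>\<rho>\<close>.  The nodes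
  \<open>\<nu> \<noteq> \<rho>\<close> of \<open>T\<^sub>\<rho>\<close> are exactly \<open>nodes T\<close>.\<close>
definition rooted_decomp :: "nat set \<Rightarrow> nat set set \<Rightarrow> nat list \<Rightarrow> dtree \<Rightarrow> bool" where
  "rooted_decomp V E \<rho> T \<longleftrightarrow> is_chain V E \<rho> \<and> (\<forall>t\<in>nodes T. local_ok V E t) \<and>
     poles T = (hd \<rho>, last \<rho>) \<and>
     eds T \<union> path_edges \<rho> = E \<and> eds T \<inter> path_edges \<rho> = {} \<and>
     vts T \<union> set \<rho> = V \<and> vts T \<inter> set \<rho> = {hd \<rho>, last \<rho>}"

definition sp_graph :: "nat set \<Rightarrow> nat set set \<Rightarrow> bool" where
  "sp_graph V E \<longleftrightarrow> simple_graph V E \<and> biconnected V E \<and> (\<exists>\<rho> T. rooted_decomp V E \<rho> T)"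

definition indep_parallel :: "nat set \<Rightarrow> nat set set \<Rightarrow> bool" where
  "indep_parallel V E \<longleftrightarrow> (\<forall>\<rho> T. rooted_decomp V E \<rho> T \<longrightarrow>
     (\<forall>t1\<in>nodes T. \<forall>t2\<in>nodes T. is_P t1 \<and> is_P t2 \<and> t1 \<noteq> t2 \<longrightarrow>
        {fst (poles t1), snd (poles t1)} \<inter> {fst (poles t2), snd (poles t2)} = {}))"

section \<open>Rectilinear representations (Tamassia's characterization, no bends)\<close>

text \<open>\<open>rot v x\<close>: the neighbour of \<open>v\<close> following \<open>x\<close> clockwise around \<open>v\<close>.
  \<open>ang v x\<close>: the angle (in multiples of 90 degrees) at \<open>v\<close> swept clockwise from
  edge \<open>vx\<close> to edge \<open>v (rot v x)\<close>.  Faces are the orbits of darts under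
  \<open>(u,v) \<mapsto> (v, rot v u)\<close> (face kept on the left); \<open>d0\<close> is a dart of the external face.\<close>

definition darts :: "nat set set \<Rightarrow> (nat \<times> nat) set" where
  "darts E = {(u, v). {u, v} \<in> E}"

definition fstep :: "(nat \<Rightarrow> nat \<Rightarrow> nat) \<Rightarrow> nat \<times> nat \<Rightarrow> nat \<times> nat" where
  "fstep rot d = (snd d, rot (snd d) (fst d))"

definition face_of :: "(nat \<Rightarrow> nat \<Rightarrow> nat) \<Rightarrow> nat \<times> nat \<Rightarrow> (nat \<times> nat) set" where
  "face_of rot d = {(fstep rot ^^ k) d | k. True}"

definition faces :: "nat set set \<Rightarrow> (nat \<Rightarrow> nat \<Rightarrow> nat) \<Rightarrow> (nat \<times> nat) set set" where
  "faces E rot = face_of rot ` darts E"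

definition rect_rep :: "nat set \<Rightarrow> nat set set \<Rightarrow> (nat \<Rightarrow> nat \<Rightarrow> nat) \<Rightarrow>
    (nat \<Rightarrow> nat \<Rightarrow> nat) \<Rightarrow> nat \<times> nat \<Rightarrow> bool" where
  "rect_rep V E rot ang d0 \<longleftrightarrow>
     (\<forall>v\<in>V. bij_betw (rot v) (nbrs E v) (nbrs E v) \<and>
        (\<forall>x\<in>nbrs E v. \<forall>y\<in>nbrs E v. \<exists>k. (rot v ^^ k) x = y)) \<and>
     (\<forall>v\<in>V. (\<forall>u\<in>nbrs E v. ang v u \<in> {1..4}) \<and> (\<Sum>u\<in>nbrs E v. ang v u) = 4) \<and>
     d0 \<in> darts E \<and>
     card (faces E rot) + card V = card E + 2 \<and>
     (\<forall>F\<in>faces E rot. (\<Sum>(u, v)\<in>F. 2 - int (ang v u)) = (if F = face_of rot d0 then -4 else 4))"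

definition chain_on_outer_face :: "(nat \<Rightarrow> nat \<Rightarrow> nat) \<Rightarrow> nat \<times> nat \<Rightarrow> nat list \<Rightarrow> bool" where
  "chain_on_outer_face rot d0 \<rho> \<longleftrightarrow>
     (\<forall>e\<in>path_edges \<rho>. \<exists>a b. (a, b) \<in> face_of rot d0 \<and> {a, b} = e)"

text \<open>Clockwise angle at \<open>v\<close> from edge \<open>va\<close> to edge \<open>vb\<close>, and the turn of a walk
  \<open>a \<rightarrow> v \<rightarrow> b\<close>: +1 right turn, -1 left turn, 0 straight.\<close>
definition cwang :: "(nat \<Rightarrow> nat \<Rightarrow> nat) \<Rightarrow> (nat \<Rightarrow> nat \<Rightarrow> nat) \<Rightarrow> nat \<Rightarrow> nat \<Rightarrow> nat \<Rightarrow> nat" where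
  "cwang rot ang v a b =
     (\<Sum>i < (LEAST k. 0 < k \<and> (rot v ^^ k) a = b). ang v ((rot v ^^ i) a))"

definition turn :: "(nat \<Rightarrow> nat \<Rightarrow> nat) \<Rightarrow> (nat \<Rightarrow> nat \<Rightarrow> nat) \<Rightarrow> nat \<Rightarrow> nat \<Rightarrow> nat \<Rightarrow> int" where
  "turn rot ang a v b = int (cwang rot ang v a b) - 2"

text \<open>\<open>n(S)\<close> for the spine \<open>(u*,u) P (v,v*)\<close>; an alias vertex is represented by the
  outside neighbour whose edge it subdivides (\<open>None\<close> when the alias is the pole itself).\<close>
definition spine_val :: "(nat \<Rightarrow> nat \<Rightarrow> nat) \<Rightarrow> (nat \<Rightarrow> nat \<Rightarrow> nat) \<Rightarrow> nat list \<Rightarrow>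
    nat option \<Rightarrow> nat option \<Rightarrow> int" where
  "spine_val rot ang P ao bo =
     (\<Sum>i\<in>{1..<length P - 1}. turn rot ang (P ! (i - 1)) (P ! i) (P ! Suc i)) +
     (case ao of None \<Rightarrow> 0 | Some x \<Rightarrow> turn rot ang x (P ! 0) (P ! 1)) +
     (case bo of None \<Rightarrow> 0 | Some y \<Rightarrow> turn rot ang (P ! (length P - 2)) (last P) y)"

definition in_nbrs :: "nat set set \<Rightarrow> nat \<Rightarrow> nat set" where
  "in_nbrs F w = {x. {w, x} \<in> F}"

definition out_nbrs :: "nat set set \<Rightarrow> nat set set \<Rightarrow> nat \<Rightarrow> nat set" where
  "out_nbrs E F w = nbrs E w - in_nbrs F w"

text \<open>Alias vertices \<open>(u', u'')\<close> of the first pole \<open>u\<close>: \<open>(u,u')\<close> precedes \<open>(u,u'')\<close>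
  counterclockwise, i.e. \<open>rot u u'' = u'\<close>.\<close>
definition alias_first :: "nat set set \<Rightarrow> nat set set \<Rightarrow> (nat \<Rightarrow> nat \<Rightarrow> nat) \<Rightarrow> nat \<Rightarrow>
    nat option \<times> nat option" where
  "alias_first E F rot u =
     (if card (in_nbrs F u) = 1 then (None, None)
      else if card (in_nbrs F u) = 2 \<and> card (out_nbrs E F u) = 2 then
        (let u2 = (SOME x. x \<in> out_nbrs E F u \<and> rot u x \<in> out_nbrs E F u) in (Some (rot u u2), Some u2))
      else (let x = (SOME x. x \<in> out_nbrs E F u) in (Some x, Some x)))"

text \<open>Alias vertices \<open>(v', v'')\<close> of the second pole \<open>v\<close>: \<open>(v,v')\<close> precedes \<open>(v,v'')\<close>
  clockwise, i.e. \<open>rot v v' = v''\<close>.\<close>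
definition alias_second :: "nat set set \<Rightarrow> nat set set \<Rightarrow> (nat \<Rightarrow> nat \<Rightarrow> nat) \<Rightarrow> nat \<Rightarrow>
    nat option \<times> nat option" where
  "alias_second E F rot v =
     (if card (in_nbrs F v) = 1 then (None, None)
      else if card (in_nbrs F v) = 2 \<and> card (out_nbrs E F v) = 2 then
        (let v1 = (SOME x. x \<in> out_nbrs E F v \<and> rot v x \<in> out_nbrs E F v) in (Some v1, Some (rot v v1)))
      else (let x = (SOME x. x \<in> out_nbrs E F v) in (Some x, Some x)))"

definition simple_path_in :: "nat set set \<Rightarrow> nat \<Rightarrow> nat \<Rightarrow> nat list \<Rightarrow> bool" where
  "simple_path_in F u v P \<longleftrightarrow> length P \<ge> 2 \<and> distinct P \<and> hd P = u \<and> last P = v \<and>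
     path_edges P \<subseteq> F"

text \<open>Spirality of the component \<open>H\<^sub>\<nu>\<close> (poles ordered as \<open>poles \<nu>\<close>).  The four cases
  of the definition are uniformly \<open>(n(S\<^sup>u\<^sup>1\<^sup>v\<^sup>1) + n(S\<^sup>u\<^sup>2\<^sup>v\<^sup>2))/2\<close> with coinciding aliases
  when a pole has only one.\<close>
definition spirality :: "nat set set \<Rightarrow> (nat \<Rightarrow> nat \<Rightarrow> nat) \<Rightarrow> (nat \<Rightarrow> nat \<Rightarrow> nat) \<Rightarrow>
    dtree \<Rightarrow> real" where
  "spirality E rot ang \<nu> =
     (let F = eds \<nu>; u = fst (poles \<nu>); v = snd (poles \<nu>);
          P = (SOME P. simple_path_in F u v P);
          (u1, u2) = alias_first E F rot u;
          (v1, v2) = alias_second E F rot v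
      in (real_of_int (spine_val rot ang P u1 v1) + real_of_int (spine_val rot ang P u2 v2)) / 2)"

end

theory Submission
  imports Defs "HOL-Library.Nat_Bijection"
begin

text \<open>The graphs are ladders with subdivided double rungs: the rails \<open>va 0, \<dots>, va M\<close> and
  \<open>vb 0, \<dots>, vb M\<close> are joined at every inner level by two chains, and at each of the two extreme levels
  by one. At an inner level four paths leave each rail vertex, all angles there are right angles, and therefore
  the turns of three parallel paths from \<open>va i\<close> to \<open>vb i\<close> that see no external face between them are
  \<open>w + 2\<close>, \<open>w\<close>, \<open>w - 2\<close>. Moving away from the middle level, the chains are just long enough to turn by \<open>w\<close>,
  so the part of the ladder beyond them has to turn by \<open>w + 2\<close>: the representation spirals, and the outermost
  chain turns by an amount linear in the number of levels, while the number of vertices is quadratic in it.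
  The external face can spoil this on one side of the middle level only.

  The only planarity used is that every cycle has turning number \<open>4\<close> or \<open>- 4\<close>. It follows from Euler's formula:
  modulo 2 the face boundaries span the cycle space, which yields the two sides of a cycle, and
  the same dimension count on each side shows that both have Euler characteristic 1.\<close>

section \<open>Cyclic permutations of a finite set\<close>

text \<open>The components that witness large spirality are always chains. A chain has inner degree
  one at both poles, so its alias vertices are the poles themselves and its spirality is its turning
  number; the spirality of a composite component is never evaluated. The price is that a reference
  chain is not a node below itself: when the external face forces the strongly turning extreme chain
  to be the root, the chain next to it, whose turn differs by at most 6, takes its place. The
  delicate point is the start of the induction, where nothing is known about the external face. Two
  chains with one inner vertex each can satisfy the cycle condition only if they turn by 1 and by -1
  and are neighbours at both poles. This fixes the turns of the two wings up to the choice between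
  two values, and the single external face cannot make both wings hesitate. The bound obtained is of
  order \<open>sqrt n\<close>; the logarithm enters through \<open>ln x \<le> x - 1\<close> at the
  very end. The explicit representation shows that the statement about all representations is not
  vacuous.\<close>

definition hit :: "('a \<Rightarrow> 'a) \<Rightarrow> 'a \<Rightarrow> 'a \<Rightarrow> nat" where
  "hit f x y = (LEAST k. 0 < k \<and> (f ^^ k) x = y)"

text \<open>With \<open>f\<close> the clockwise rotation at a vertex, \<open>hit\<close> is the
  \<open>LEAST\<close> inside \<open>cwang\<close>, and \<open>arc\<close> collects the corners
  swept by that angle. The positive exponent makes the sweep from an edge to itself a full
  turn.\<close>

definition arc :: "('a \<Rightarrow> 'a) \<Rightarrow> 'a \<Rightarrow> 'a \<Rightarrow> 'a set" where
  "arc f x y = (\<lambda>i. (f ^^ i) x) ` {..<hit f x y}"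

locale cyclic_perm =
  fixes N :: "'a set" and f :: "'a \<Rightarrow> 'a"
  assumes fin: "finite N" and bij: "bij_betw f N N"
    and trans: "\<And>x y. x \<in> N \<Longrightarrow> y \<in> N \<Longrightarrow> \<exists>k. (f ^^ k) x = y"
begin

lemma f_in: "x \<in> N \<Longrightarrow> f x \<in> N"
  using bij by (auto simp: bij_betw_def)

lemma pow_in: "x \<in> N \<Longrightarrow> (f ^^ k) x \<in> N"
  by (induction k) (auto simp: f_in)

lemma hit_props:
  assumes "x \<in> N" "y \<in> N"
  shows "0 < hit f x y \<and> (f ^^ hit f x y) x = y"
proof -
  obtain k where "(f ^^ k) (f x) = y" using trans[OF f_in[OF assms(1)] assms(2)] by blast
  then have "0 < Suc k \<and> (f ^^ Suc k) x = y" by (simp add: funpow_swap1)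
  then show ?thesis unfolding hit_def by (rule LeastI)
qed

lemmas hit_pos = hit_props[THEN conjunct1] and hit_pow = hit_props[THEN conjunct2]

lemma hit_minimal: "0 < k \<Longrightarrow> k < hit f x y \<Longrightarrow> (f ^^ k) x \<noteq> y"
  unfolding hit_def using not_less_Least by blast

lemma pow_inj_below_hit:
  assumes "x \<in> N" "y \<in> N"
  shows "inj_on (\<lambda>i. (f ^^ i) x) {..<hit f x y}"
proof -
  have *: False if "i < j" "j < hit f x y" "(f ^^ i) x = (f ^^ j) x" for i j
  proof -
    let ?h = "hit f x y"
    \<comment> \<open>If two iterates below \<open>?h\<close> agreed, then \<open>?h - j\<close>
      further steps would lead from the earlier one to \<open>y\<close> before time
      \<open>?h\<close>.\<close>
    have "(f ^^ (?h - j + i)) x = (f ^^ (?h - j + j)) x"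
      unfolding funpow_add o_def using that(3) by simp
    also have "\<dots> = y" using that hit_pow[OF assms] by simp
    finally have "(f ^^ (?h - j + i)) x = y" .
    moreover have "(f ^^ (?h - j + i)) x \<noteq> y" by (rule hit_minimal) (use that(1,2) in auto)
    ultimately show False by contradiction
  qed
  show ?thesis unfolding inj_on_def by (metis * lessThan_iff linorder_neqE_nat)
qed

lemma orbit_eq:
  assumes "x \<in> N" shows "N = (\<lambda>i. (f ^^ i) x) ` {..<hit f x x}"
proof
  show "N \<subseteq> (\<lambda>i. (f ^^ i) x) ` {..<hit f x x}"
  proof
    fix y assume "y \<in> N"
    then obtain k where "(f ^^ k) x = y" using trans assms by blast
    then have "(f ^^ (k mod hit f x x)) x = y"
      using funpow_mod_eq[where f=f and n="hit f x x" and x=x, OF hit_pow[OF assms assms]] by simp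
    then show "y \<in> (\<lambda>i. (f ^^ i) x) ` {..<hit f x x}"
      using hit_pos[OF assms assms] by (force intro!: image_eqI[where x="k mod hit f x x"])
  qed
qed (use pow_in assms in auto)

lemma hit_self: "x \<in> N \<Longrightarrow> hit f x x = card N"
  by (metis orbit_eq pow_inj_below_hit card_image card_lessThan)

lemma pow_card: "x \<in> N \<Longrightarrow> (f ^^ card N) x = x"
  using hit_pow hit_self by metis

lemma pow_inj: "x \<in> N \<Longrightarrow> inj_on (\<lambda>i. (f ^^ i) x) {..<card N}"
  using pow_inj_below_hit hit_self by metis

lemma pow_surj: "x \<in> N \<Longrightarrow> N = (\<lambda>i. (f ^^ i) x) ` {..<card N}"
  using orbit_eq hit_self by metis

lemma hit_eqI:
  assumes "x \<in> N" "0 < k" "k \<le> card N" "(f ^^ k) x = y" shows "hit f x y = k"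
proof (rule antisym)
  show "hit f x y \<le> k" unfolding hit_def using assms by (intro Least_le) auto
  show "k \<le> hit f x y"
  proof (rule ccontr)
    assume c: "\<not> k \<le> hit f x y"
    have y: "y \<in> N" using assms pow_in by blast
    let ?h = "hit f x y"
    have e: "(f ^^ ?h) x = (f ^^ k) x" using hit_pow[OF assms(1) y] assms by simp
    show False
    proof (cases "k < card N")
      case True
      then show False using pow_inj[OF assms(1)] e c by (auto simp: inj_on_def)
    next
      case False
      then have "k = card N" using assms by simp
      then have "(f ^^ ?h) x = (f ^^ 0) x" using e pow_card[OF assms(1)] by simp
      moreover have "?h < card N" "0 < ?h" using c assms hit_pos[OF assms(1) y] by auto
      ultimately show False using pow_inj[OF assms(1)] unfolding inj_on_def by fastforce
    qed
  qed
qed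

lemma hit_less:
  assumes "x \<in> N" "y \<in> N" "x \<noteq> y" shows "hit f x y < card N"
proof -
  obtain i where i: "i < card N" "y = (f ^^ i) x" using pow_surj[OF assms(1)] assms(2) by blast
  moreover have "0 < i" using i assms(3) by (cases i) auto
  ultimately show ?thesis using hit_eqI[of x i y] assms by simp
qed

lemma hit_swap:
  assumes "x \<in> N" "y \<in> N" "x \<noteq> y" shows "hit f y x = card N - hit f x y"
proof (rule hit_eqI[OF assms(2)])
  have l: "hit f x y < card N" by (rule hit_less[OF assms])
  show "0 < card N - hit f x y" using l by simp
  show "card N - hit f x y \<le> card N" by simp
  have "(f ^^ (card N - hit f x y)) ((f ^^ hit f x y) x) = (f ^^ card N) x"
    using l by (metis funpow_add o_apply le_add_diff_inverse2 less_imp_le)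
  then show "(f ^^ (card N - hit f x y)) y = x"
    using hit_pow[OF assms(1,2)] pow_card[OF assms(1)] by simp
qed

lemma arc_swap:
  assumes "x \<in> N" "y \<in> N" "x \<noteq> y"
  shows "arc f y x = (\<lambda>i. (f ^^ i) x) ` {hit f x y..<card N}"
proof -
  let ?h = "hit f x y"
  have l: "?h < card N" by (rule hit_less[OF assms])
  have "arc f y x = (\<lambda>i. (f ^^ (i + ?h)) x) ` {..<card N - ?h}"
    unfolding arc_def hit_swap[OF assms] funpow_add o_apply hit_pow[OF assms(1,2)] ..
  also have "\<dots> = (\<lambda>i. (f ^^ i) x) ` ((\<lambda>i. i + ?h) ` {..<card N - ?h})"
    by (simp add: image_image)
  also have "(\<lambda>i. i + ?h) ` {..<card N - ?h} = {?h..<card N}"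
    using l by (simp add: lessThan_atLeast0 image_add_atLeastLessThan')
  finally show ?thesis .
qed

text \<open>The two sweeps between \<open>x\<close> and \<open>y\<close> make up one full turn.
  Turns become antisymmetric through this, and the corners at a cycle vertex split into a left and a
  right part.\<close>

lemma arc_partition:
  assumes "x \<in> N" "y \<in> N" "x \<noteq> y"
  shows "arc f x y \<union> arc f y x = N" "arc f x y \<inter> arc f y x = {}"
proof -
  let ?h = "hit f x y"
  have l: "?h < card N" by (rule hit_less[OF assms])
  have u: "{..<?h} \<union> {?h..<card N} = {..<card N}" using l by auto
  show "arc f x y \<union> arc f y x = N"
    unfolding arc_swap[OF assms] unfolding arc_def image_Un[symmetric] u
    using pow_surj[OF assms(1)] by simp
  show "arc f x y \<inter> arc f y x = {}"
    unfolding arc_swap[OF assms] unfolding arc_def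
    using pow_inj[OF assms(1)] l by (fastforce simp: inj_on_def)
qed

lemma sum_below_hit:
  assumes "x \<in> N" "y \<in> N"
  shows "(\<Sum>i<hit f x y. g ((f ^^ i) x)) = sum g (arc f x y)"
  unfolding arc_def by (simp add: sum.reindex[OF pow_inj_below_hit[OF assms]])

end

section \<open>Symmetric differences and even edge sets\<close>

definition sd :: "'a set \<Rightarrow> 'a set \<Rightarrow> 'a set" where
  "sd A B = (A - B) \<union> (B - A)"

lemma sd_cancel: "sd (sd A B) B = A"
  by (auto simp: sd_def)

lemma even_card_sd:
  assumes "finite A" "finite B"
  shows "even (card (sd A B)) \<longleftrightarrow> (even (card A) \<longleftrightarrow> even (card B))"
proof -
  have "card (sd A B) = card (A - B) + card (B - A)"
    unfolding sd_def using assms by (intro card_Un_disjoint) auto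
  moreover have "card A = card (A - B) + card (A \<inter> B)" "card B = card (B - A) + card (A \<inter> B)"
    using card_Int_Diff[OF assms(1), of B] card_Int_Diff[OF assms(2), of A] by (simp_all add: Int_commute)
  ultimately show ?thesis by presburger
qed

lemma nbrs_sd: "nbrs (sd A B) v = sd (nbrs A v) (nbrs B v)"
  by (auto simp: sd_def nbrs_def)

lemma nbrs_mono: "A \<subseteq> B \<Longrightarrow> nbrs A v \<subseteq> nbrs B v"
  by (auto simp: nbrs_def)

lemma simple_graph_edgeD:
  assumes "simple_graph V E" "{u, v} \<in> E" shows "u \<in> V" "v \<in> V" "u \<noteq> v"
proof -
  have "\<exists>a b. {u, v} = {a, b} \<and> a \<noteq> b \<and> a \<in> V \<and> b \<in> V"
    using assms by (simp add: simple_graph_def)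
  then obtain a b where "{u, v} = {a, b}" "a \<noteq> b" "a \<in> V" "b \<in> V" by (elim exE conjE)
  then show "u \<in> V" "v \<in> V" "u \<noteq> v" by (auto simp: doubleton_eq_iff)
qed

lemma simple_graph_finite:
  assumes "simple_graph V E" shows "finite V" "finite E" "finite (nbrs E v)"
proof -
  show f: "finite V" using assms by (simp add: simple_graph_def)
  have "e \<subseteq> V" if "e \<in> E" for e
  proof -
    have "\<exists>u v. e = {u, v} \<and> u \<noteq> v \<and> u \<in> V \<and> v \<in> V"
      using assms that by (simp add: simple_graph_def)
    then show ?thesis by auto
  qed
  then have "E \<subseteq> Pow V" by blast
  then show "finite E" using f finite_subset by blast
  have "nbrs E v \<subseteq> V" using simple_graph_edgeD[OF assms] by (auto simp: nbrs_def)
  then show "finite (nbrs E v)" using f finite_subset by blast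
qed

lemma finite_nbrs_sub: "simple_graph V E \<Longrightarrow> S \<subseteq> E \<Longrightarrow> finite (nbrs S v)"
  by (rule finite_subset[OF nbrs_mono simple_graph_finite(3)])

text \<open>The cycle space over the field with two elements, with \<open>sd\<close> as
  addition.\<close>

definition even_sub :: "nat set \<Rightarrow> nat set set \<Rightarrow> nat set set set" where
  "even_sub V E = {S. S \<subseteq> E \<and> (\<forall>v\<in>V. even (card (nbrs S v)))}"

lemma finite_even_sub: "finite E \<Longrightarrow> finite (even_sub V E)"
  by (rule finite_subset[of _ "Pow E"]) (auto simp: even_sub_def)

text \<open>Toggling the edges of a walk one by one moves the second odd vertex along it. The
  exclusive or covers the case \<open>v = r\<close>, where no vertex is odd.\<close>

lemma path_parity:
  assumes sg: "simple_graph V E"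
    and r: "r \<in> V" and path: "(\<lambda>x y. {x, y} \<in> E \<and> x \<in> V \<and> y \<in> V)\<^sup>*\<^sup>* r v"
  shows "\<exists>J\<subseteq>E. \<forall>x\<in>V. odd (card (nbrs J x)) \<longleftrightarrow> (x = v) \<noteq> (x = r)"
  using path
proof (induction rule: rtranclp_induct)
  case base
  show ?case by (rule exI[of _ "{}"]) (auto simp: nbrs_def)
next
  case (step y z)
  then obtain J where J: "J \<subseteq> E" "\<forall>x\<in>V. odd (card (nbrs J x)) \<longleftrightarrow> (x = y) \<noteq> (x = r)" by blast
  have yz: "{y, z} \<in> E" "y \<noteq> z" using step simple_graph_edgeD[OF sg] by auto
  have n: "nbrs {{y, z}} x = (if x = y then {z} else if x = z then {y} else {})" for x
    using yz by (auto simp: nbrs_def doubleton_eq_iff)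
  have "odd (card (nbrs (sd J {{y, z}}) x)) \<longleftrightarrow> (x = z) \<noteq> (x = r)" if "x \<in> V" for x
  proof -
    have "finite (nbrs J x)" using finite_nbrs_sub[OF sg J(1)] .
    then show ?thesis using J(2) that yz
      by (auto simp: nbrs_sd even_card_sd n)
  qed
  moreover have "sd J {{y, z}} \<subseteq> E" using J yz by (auto simp: sd_def)
  ultimately show ?case by blast
qed

text \<open>These sets are T-joins: one walk from the root is added for each member of
  \<open>T\<close>. The parity at the root stays open because the handshake identity decides
  it.\<close>

lemma parity_prescribed:
  assumes sg: "simple_graph V E" and con: "connected_graph V E" and r: "r \<in> V"
    and "finite T" "T \<subseteq> V - {r}"
  shows "\<exists>J\<subseteq>E. \<forall>x\<in>V - {r}. odd (card (nbrs J x)) \<longleftrightarrow> x \<in> T"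
  using assms(4,5)
proof (induction T rule: finite_induct)
  case empty
  show ?case by (rule exI[of _ "{}"]) (auto simp: nbrs_def)
next
  case (insert v T)
  then obtain J where J: "J \<subseteq> E" "\<forall>x\<in>V - {r}. odd (card (nbrs J x)) \<longleftrightarrow> x \<in> T" by auto
  have "(\<lambda>x y. {x, y} \<in> E \<and> x \<in> V \<and> y \<in> V)\<^sup>*\<^sup>* r v"
    using con r insert.prems unfolding connected_graph_def by auto
  from path_parity[OF sg r this] obtain K
    where K: "K \<subseteq> E" "\<forall>x\<in>V. odd (card (nbrs K x)) \<longleftrightarrow> (x = v) \<noteq> (x = r)" by blast
  have "odd (card (nbrs (sd J K) x)) \<longleftrightarrow> x \<in> insert v T" if "x \<in> V - {r}" for x
  proof -
    have "finite (nbrs J x)" "finite (nbrs K x)"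
      using finite_nbrs_sub[OF sg J(1)] finite_nbrs_sub[OF sg K(1)] .
    then show ?thesis using J(2) K(2) that insert.hyps
      by (auto simp: nbrs_sd even_card_sd)
  qed
  moreover have "sd J K \<subseteq> E" using J K by (auto simp: sd_def)
  ultimately show ?case by blast
qed

text \<open>Translating even sets by sets of prescribed parity off a root vertex is injective; this bounds the
  dimension of the cycle space over the two-element field.\<close>

lemma card_even_sub:
  assumes sg: "simple_graph V E" and con: "connected_graph V E" and ne: "V \<noteq> {}"
  shows "card (even_sub V E) * 2 ^ card V \<le> 2 ^ (card E + 1)"
proof -
  obtain r where r: "r \<in> V" using ne by blast
  note fin = simple_graph_finite[OF sg]
  define J where "J T = (SOME J. J \<subseteq> E \<and> (\<forall>x\<in>V - {r}. odd (card (nbrs J x)) \<longleftrightarrow> x \<in> T))" for T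
  have J: "J T \<subseteq> E" "x \<in> V - {r} \<Longrightarrow> odd (card (nbrs (J T) x)) \<longleftrightarrow> x \<in> T" if "T \<subseteq> V - {r}" for T x
  proof -
    have "finite T" using that fin(1) finite_subset by blast
    from someI_ex[OF parity_prescribed[OF sg con r this that]]
    have "J T \<subseteq> E \<and> (\<forall>x\<in>V - {r}. odd (card (nbrs (J T) x)) \<longleftrightarrow> x \<in> T)"
      unfolding J_def by simp
    then show "J T \<subseteq> E" "x \<in> V - {r} \<Longrightarrow> odd (card (nbrs (J T) x)) \<longleftrightarrow> x \<in> T" by auto
  qed
  let ?h = "\<lambda>(S, T). sd S (J T)"
  have T_of: "x \<in> T \<longleftrightarrow> odd (card (nbrs (sd S (J T)) x))"
    if "S \<in> even_sub V E" "T \<subseteq> V - {r}" "x \<in> V - {r}" for S T x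
  proof -
    have "S \<subseteq> E" using that by (auto simp: even_sub_def)
    then have "finite (nbrs S x)" "finite (nbrs (J T) x)"
      using finite_nbrs_sub[OF sg] J(1)[OF that(2)] by simp_all
    moreover have "even (card (nbrs S x))" using that by (auto simp: even_sub_def)
    ultimately show ?thesis using J(2)[OF that(2,3)] by (simp add: nbrs_sd even_card_sd)
  qed
  have inj: "inj_on ?h (even_sub V E \<times> Pow (V - {r}))"
  proof (rule inj_onI)
    fix a b assume a: "a \<in> even_sub V E \<times> Pow (V - {r})" and b: "b \<in> even_sub V E \<times> Pow (V - {r})"
      and e: "?h a = ?h b"
    obtain S T S' T' where ab: "a = (S, T)" "b = (S', T')" by (cases a, cases b) auto
    have e': "sd S (J T) = sd S' (J T')" using e ab by simp
    have "T = T'"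
    proof -
      have "x \<in> T \<longleftrightarrow> x \<in> T'" if "x \<in> V - {r}" for x
        using T_of[of S T x] T_of[of S' T' x] a b ab that e' by auto
      then show ?thesis using a b ab by auto
    qed
    then have "S = S'" using e' by (metis sd_cancel)
    then show "a = b" using ab \<open>T = T'\<close> by simp
  qed
  have "?h ` (even_sub V E \<times> Pow (V - {r})) \<subseteq> Pow E"
  proof (clarsimp)
    fix S T x assume "S \<in> even_sub V E" "T \<subseteq> V - {r}" "x \<in> sd S (J T)"
    then show "x \<in> E" using J(1)[of T] by (auto simp: even_sub_def sd_def)
  qed
  then have "card (even_sub V E \<times> Pow (V - {r})) \<le> card (Pow E)"
    using inj fin(2) by (intro card_inj_on_le) auto
  \<comment> \<open>The root is excluded from \<open>T\<close>, which halves the number of parity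
    patterns and accounts for the \<open>+ 1\<close> in the exponent of the claim.\<close>
  then have le: "card (even_sub V E) * 2 ^ (card V - 1) \<le> 2 ^ card E"
    using fin r by (simp add: card_cartesian_product card_Pow)
  have "card V = Suc (card V - 1)" using r fin(1) by (metis Suc_pred' card_gt_0_iff empty_iff)
  then have "(2::nat) ^ card V = 2 * 2 ^ (card V - 1)" by (metis power_Suc)
  then show ?thesis using le by simp
qed

section \<open>Faces of a rotation system\<close>

locale rotation_system =
  fixes V :: "nat set" and E :: "nat set set" and rot :: "nat \<Rightarrow> nat \<Rightarrow> nat"
  assumes sg: "simple_graph V E"
    and rot_bij: "v \<in> V \<Longrightarrow> bij_betw (rot v) (nbrs E v) (nbrs E v)"
    and rot_trans: "v \<in> V \<Longrightarrow> x \<in> nbrs E v \<Longrightarrow> y \<in> nbrs E v \<Longrightarrow> \<exists>k. (rot v ^^ k) x = y"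
begin

lemmas edgeD = simple_graph_edgeD[OF sg]
lemmas finV = simple_graph_finite(1)[OF sg] and finE = simple_graph_finite(2)[OF sg]
  and fin_nbrs = simple_graph_finite(3)[OF sg]

abbreviation fc :: "nat \<times> nat \<Rightarrow> (nat \<times> nat) set" where
  "fc \<equiv> face_of rot"

lemma nbrs_iff: "u \<in> nbrs E v \<longleftrightarrow> {u, v} \<in> E"
  by (simp add: nbrs_def)

lemma nbrs_sym: "u \<in> nbrs E v \<longleftrightarrow> v \<in> nbrs E u"
  by (simp add: nbrs_def insert_commute)

lemma darts_iff: "(u, v) \<in> darts E \<longleftrightarrow> {u, v} \<in> E"
  by (simp add: darts_def)

lemma nbrs_empty: "v \<notin> V \<Longrightarrow> nbrs E v = {}"
  using edgeD by (auto simp: nbrs_def)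

lemma cyclic: "v \<in> V \<Longrightarrow> cyclic_perm (nbrs E v) (rot v)"
  by (simp add: cyclic_perm_def fin_nbrs rot_bij rot_trans)

lemma rot_in: "u \<in> nbrs E v \<Longrightarrow> rot v u \<in> nbrs E v"
  using cyclic_perm.f_in[OF cyclic] nbrs_empty by blast

lemma fin_darts: "finite (darts E)"
proof (rule finite_subset)
  show "darts E \<subseteq> V \<times> V" using edgeD by (auto simp: darts_def)
qed (simp add: finV)

lemma fstep_in: "d \<in> darts E \<Longrightarrow> fstep rot d \<in> darts E"
  using rot_in[of "fst d" "snd d"] by (cases d) (simp add: fstep_def darts_iff nbrs_iff insert_commute)

lemma fstep_inj: "inj_on (fstep rot) (darts E)"
proof (rule inj_onI)
  fix d e assume de: "d \<in> darts E" "e \<in> darts E" "fstep rot d = fstep rot e"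
  obtain u v where d: "d = (u, v)" by (cases d)
  obtain w where e: "e = (w, v)" using de(3) d by (cases e) (simp add: fstep_def)
  have "rot v u = rot v w" "u \<in> nbrs E v" "w \<in> nbrs E v"
    using de d e by (auto simp: fstep_def darts_iff nbrs_iff)
  moreover have "v \<in> V" using de d edgeD by (auto simp: darts_iff)
  ultimately show "d = e" using rot_bij[of v] d e by (auto simp: bij_betw_def inj_on_def)
qed

lemma pow_fstep_in: "d \<in> darts E \<Longrightarrow> (fstep rot ^^ k) d \<in> darts E"
  by (induction k) (auto simp: fstep_in)

lemma pow_fstep_inj:
  "d \<in> darts E \<Longrightarrow> e \<in> darts E \<Longrightarrow> (fstep rot ^^ k) d = (fstep rot ^^ k) e \<Longrightarrow> d = e"
proof (induction k)
  case (Suc k)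
  then show ?case using fstep_inj pow_fstep_in by (auto simp: inj_on_def)
qed simp

text \<open>Finiteness gives two equal iterates, and injectivity of \<open>fstep\<close> on darts
  pulls the coincidence back to the start. Hence orbits are closed and faces partition the
  darts.\<close>

lemma fstep_return:
  assumes "d \<in> darts E" shows "\<exists>n>0. (fstep rot ^^ n) d = d"
proof -
  have "\<not> inj (\<lambda>k. (fstep rot ^^ k) d)"
  proof
    assume "inj (\<lambda>k. (fstep rot ^^ k) d)"
    then have "infinite (range (\<lambda>k. (fstep rot ^^ k) d))" using finite_imageD by blast
    moreover have "range (\<lambda>k. (fstep rot ^^ k) d) \<subseteq> darts E" using pow_fstep_in[OF assms] by blast
    ultimately show False using fin_darts finite_subset by blast
  qed
  then obtain i j where "i \<noteq> j" "(fstep rot ^^ i) d = (fstep rot ^^ j) d" by (auto simp: inj_def)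
  then obtain i n where n: "0 < n" "(fstep rot ^^ i) d = (fstep rot ^^ (i + n)) d"
    by (metis add_diff_inverse_nat less_imp_le_nat linorder_neqE_nat not_le zero_less_diff)
  have "(fstep rot ^^ i) d = (fstep rot ^^ i) ((fstep rot ^^ n) d)"
    using n(2) by (simp add: funpow_add)
  then have "d = (fstep rot ^^ n) d" by (rule pow_fstep_inj[OF assms pow_fstep_in[OF assms]])
  then show ?thesis using n(1) by metis
qed

lemma face_self: "d \<in> fc d"
  unfolding face_of_def by (rule CollectI, rule exI[of _ 0]) simp

lemma face_closed: "e \<in> fc d \<Longrightarrow> fstep rot e \<in> fc d"
proof -
  assume "e \<in> fc d"
  then obtain k where "e = (fstep rot ^^ k) d" by (auto simp: face_of_def)
  then have "fstep rot e = (fstep rot ^^ Suc k) d" by simp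
  then show ?thesis unfolding face_of_def by blast
qed

lemma face_sub: "e \<in> fc d \<Longrightarrow> fc e \<subseteq> fc d"
proof
  fix f assume e: "e \<in> fc d" and "f \<in> fc e"
  then obtain k where "f = (fstep rot ^^ k) e" by (auto simp: face_of_def)
  then show "f \<in> fc d" using e by (induction k arbitrary: f) (auto intro: face_closed)
qed

lemma face_step:
  assumes "d \<in> darts E" shows "fc (fstep rot d) = fc d"
proof
  show "fc (fstep rot d) \<subseteq> fc d" by (intro face_sub face_closed face_self)
  obtain n where n: "0 < n" "(fstep rot ^^ n) d = d" using fstep_return[OF assms] by blast
  then obtain k where "n = Suc k" by (cases n) auto
  then have "d = (fstep rot ^^ k) (fstep rot d)" using n by (simp add: funpow_swap1)
  then have "\<exists>k. d = (fstep rot ^^ k) (fstep rot d)" ..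
  then have "d \<in> fc (fstep rot d)" by (simp add: face_of_def)
  then show "fc d \<subseteq> fc (fstep rot d)" by (rule face_sub)
qed

lemma face_eq:
  assumes "d \<in> darts E" "e \<in> fc d" shows "fc e = fc d" "e \<in> darts E"
proof -
  obtain k where "e = (fstep rot ^^ k) d" using assms by (auto simp: face_of_def)
  then have "fc e = fc d \<and> e \<in> darts E" using assms(1)
    by (induction k arbitrary: e) (auto simp: face_step fstep_in)
  then show "fc e = fc d" "e \<in> darts E" by auto
qed

text \<open>The corner at \<open>v\<close> between \<open>u\<close> and \<open>rot v u\<close> lies
  in one face. Corners are therefore indexed by incoming darts \<open>(u, v)\<close>, in agreement
  with the arguments of \<open>ang\<close>.\<close>

lemma face_corner: "u \<in> nbrs E v \<Longrightarrow> fc (v, rot v u) = fc (u, v)"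
  using face_step[of "(u, v)"] by (simp add: fstep_def darts_iff nbrs_iff)

lemma finite_faces: "finite (faces E rot)"
  unfolding faces_def using fin_darts by simp

lemma sum_over_faces:
  fixes g :: "nat \<times> nat \<Rightarrow> int"
  assumes "X \<subseteq> faces E rot"
  shows "(\<Sum>F\<in>X. \<Sum>d\<in>F. g d) = (\<Sum>d\<in>{d \<in> darts E. fc d \<in> X}. g d)"
proof -
  have "(\<Sum>d\<in>{d \<in> darts E. fc d \<in> X}. g d)
      = (\<Sum>F\<in>X. \<Sum>d\<in>{x \<in> {d \<in> darts E. fc d \<in> X}. fc x = F}. g d)"
    using fin_darts finite_subset[OF assms finite_faces] by (intro sum.group[symmetric]) auto
  also have "\<dots> = (\<Sum>F\<in>X. \<Sum>d\<in>F. g d)"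
  proof (rule sum.cong[OF refl], rule sum.cong)
    fix F assume F: "F \<in> X"
    then obtain e where e: "e \<in> darts E" "F = fc e" using assms by (auto simp: faces_def)
    show "{x \<in> {d \<in> darts E. fc d \<in> X}. fc x = F} = F"
    proof (intro set_eqI iffI)
      fix x assume "x \<in> {x \<in> {d \<in> darts E. fc d \<in> X}. fc x = F}"
      then show "x \<in> F" using face_self[of x] by simp
    next
      fix x assume "x \<in> F"
      then have "fc x = F" "x \<in> darts E" using face_eq[OF e(1), of x] e(2) by simp_all
      then show "x \<in> {x \<in> {d \<in> darts E. fc d \<in> X}. fc x = F}" using F by simp
    qed
  qed simp
  finally show ?thesis ..
qed

text \<open>The boundary map modulo 2 from sets of faces to sets of edges: an edge counts if exactly
  one of its two sides lies in \<open>X\<close>.\<close>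

definition bd :: "(nat \<times> nat) set set \<Rightarrow> nat set set" where
  "bd X = {e \<in> E. \<exists>u v. e = {u, v} \<and> fc (u, v) \<in> X \<and> fc (v, u) \<notin> X}"

lemma bd_iff: "{u, v} \<in> bd X \<longleftrightarrow> {u, v} \<in> E \<and> (fc (u, v) \<in> X) \<noteq> (fc (v, u) \<in> X)"
  unfolding bd_def by (auto simp: doubleton_eq_iff)

lemma edgeE:
  assumes "e \<in> E" obtains u v where "e = {u, v}" "u \<noteq> v" "u \<in> V" "v \<in> V"
proof -
  have "\<exists>u v. e = {u, v} \<and> u \<noteq> v \<and> u \<in> V \<and> v \<in> V" using sg assms by (simp add: simple_graph_def)
  then show ?thesis using that by (elim exE conjE)
qed

lemma bd_complement:
  assumes "X \<subseteq> faces E rot" shows "bd (faces E rot - X) = bd X"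
proof -
  have f: "fc (u, v) \<in> faces E rot" if "{u, v} \<in> E" for u v
    using that by (auto simp: faces_def darts_iff)
  have "e \<in> bd (faces E rot - X) \<longleftrightarrow> e \<in> bd X" if eE: "e \<in> E" for e
  proof -
    obtain u v where uv: "e = {u, v}" using edgeE[OF eE] .
    then have "fc (u, v) \<in> faces E rot" "fc (v, u) \<in> faces E rot"
      using eE f[of u v] f[of v u] by (auto simp: insert_commute)
    then show ?thesis using eE unfolding uv bd_iff by auto
  qed
  moreover have "bd Y \<subseteq> E" for Y by (auto simp: bd_def)
  ultimately show ?thesis by blast
qed

text \<open>Going round \<open>v\<close>, the edge to \<open>rot v w\<close> separates the corner of
  \<open>w\<close> from that of \<open>rot v w\<close>, and a cyclic sequence changes between two
  values an even number of times. Formally, \<open>rot v\<close> maps \<open>B\<close> onto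
  \<open>A\<close>, so both have the same size.\<close>

lemma bd_even: "bd X \<in> even_sub V E"
proof -
  have "even (card (nbrs (bd X) v))" if v: "v \<in> V" for v
  proof -
    interpret c: cyclic_perm "nbrs E v" "rot v" by (rule cyclic[OF v])
    let ?N = "nbrs E v"
    define A where "A = {w \<in> ?N. fc (w, v) \<in> X}"
    define B where "B = {w \<in> ?N. fc (rot v w, v) \<in> X}"
    have inj: "inj_on (rot v) ?N" and im: "rot v ` ?N = ?N" using rot_bij[OF v] by (auto simp: bij_betw_def)
    have "rot v ` B = A"
      unfolding A_def B_def using im by auto
    moreover have "inj_on (rot v) B" using inj by (rule inj_on_subset) (auto simp: B_def)
    ultimately have "card A = card B" using card_image by metis
    moreover have "finite A" "finite B" using fin_nbrs by (auto simp: A_def B_def)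
    ultimately have ev: "even (card (sd A B))" by (simp add: even_card_sd)
    have "nbrs (bd X) v = rot v ` sd A B"
    proof -
      have *: "rot v w \<in> nbrs (bd X) v \<longleftrightarrow> w \<in> sd A B" if "w \<in> ?N" for w
        using that rot_in[OF that] face_corner[OF that]
        by (auto simp: nbrs_def bd_iff sd_def A_def B_def)
      have "nbrs (bd X) v \<subseteq> ?N" by (auto simp: nbrs_def bd_def)
      moreover have "sd A B \<subseteq> ?N" by (auto simp: sd_def A_def B_def)
      ultimately show ?thesis using *
      proof (intro set_eqI iffI)
        fix x assume x: "x \<in> nbrs (bd X) v"
        then have "x \<in> rot v ` ?N" using \<open>nbrs (bd X) v \<subseteq> ?N\<close> im by auto
        then obtain w where "w \<in> ?N" "x = rot v w" by auto
        then show "x \<in> rot v ` sd A B" using x * by simp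
      qed auto
    qed
    moreover have "inj_on (rot v) (sd A B)" using inj by (rule inj_on_subset) (auto simp: sd_def A_def B_def)
    ultimately show ?thesis using ev by (simp add: card_image)
  qed
  then show ?thesis by (auto simp: even_sub_def bd_def)
qed

text \<open>Consecutive corners at \<open>v\<close> are separated by one edge only, and none of
  these edges is a boundary edge.\<close>

lemma corners_uniform:
  assumes v: "v \<in> V" and off: "nbrs (bd X) v = {}" and "w \<in> nbrs E v" "w' \<in> nbrs E v"
  shows "fc (w, v) \<in> X \<longleftrightarrow> fc (w', v) \<in> X"
proof -
  have side: "fc (u, v) \<in> X \<longleftrightarrow> fc (v, u) \<in> X" if "u \<in> nbrs E v" for u
    using off that bd_iff[of u v X] by (auto simp: nbrs_def)
  have "fc ((rot v ^^ k) w, v) \<in> X \<longleftrightarrow> fc (w, v) \<in> X \<and> True" for k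
  proof (induction k)
    case (Suc k)
    have "(rot v ^^ k) w \<in> nbrs E v"
      by (rule cyclic_perm.pow_in[OF cyclic[OF v] assms(3)])
    then show ?case using Suc side[OF rot_in] face_corner by simp
  qed simp
  then show ?thesis using rot_trans[OF v assms(3,4)] by metis
qed

end

section \<open>Boundaries of face sets in a connected planar map\<close>

locale planar_rotation_system = rotation_system +
  assumes con: "connected_graph V E"
    and ne: "E \<noteq> {}"
    and euler: "card (faces E rot) + card V = card E + 2"
begin

lemma V_ne: "V \<noteq> {}"
  using ne edgeE by blast

text \<open>The predicate \<open>h\<close> records whether \<open>X\<close> and \<open>Y\<close>
  agree on the face of a dart. Equal boundaries make it invariant across every edge and round every
  vertex, so by connectivity the two sets agree on all faces or on none.\<close>

lemma bd_fibre:
  assumes X: "X \<subseteq> faces E rot" and Y: "Y \<subseteq> faces E rot" and eq: "bd X = bd Y"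
  shows "X = Y \<or> X = faces E rot - Y"
proof -
  define h where "h d \<longleftrightarrow> (fc d \<in> X \<longleftrightarrow> fc d \<in> Y)" for d
  have sym: "h (u, v) \<longleftrightarrow> h (v, u)" if "{u, v} \<in> E" for u v
    using eq that bd_iff[of u v X] bd_iff[of u v Y] by (auto simp: h_def)
  have at: "h (w, v) \<longleftrightarrow> h (w', v)" if "w \<in> nbrs E v" "w' \<in> nbrs E v" for v w w'
  proof -
    have v: "v \<in> V" using that nbrs_empty by blast
    have "h ((rot v ^^ k) w, v) \<longleftrightarrow> h (w, v) \<and> True" for k
    proof (induction k)
      case (Suc k)
      have "(rot v ^^ k) w \<in> nbrs E v"
        by (rule cyclic_perm.pow_in[OF cyclic[OF v] that(1)])
      then show ?case using Suc sym[of "rot v ((rot v ^^ k) w)" v] rot_in face_corner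
        by (simp add: h_def nbrs_iff)
    qed simp
    then show ?thesis using rot_trans[OF v that] by metis
  qed
  have walk: "\<forall>w\<in>nbrs E v. \<forall>w'\<in>nbrs E v'. h (w, v) \<longleftrightarrow> h (w', v')"
    if "(\<lambda>x y. {x, y} \<in> E \<and> x \<in> V \<and> y \<in> V)\<^sup>*\<^sup>* v v'" for v v'
    using that
  proof (induction rule: rtranclp_induct)
    case base
    show ?case using at by blast
  next
    case (step y z)
    then have "z \<in> nbrs E y" "y \<in> nbrs E z" "{y, z} \<in> E" by (auto simp: nbrs_def insert_commute)
    then show ?case using step.IH at sym[of y z] by blast
  qed
  have const: "h d \<longleftrightarrow> h e" if "d \<in> darts E" "e \<in> darts E" for d e
  proof -
    obtain u v u' v' where de: "d = (u, v)" "e = (u', v')" by (cases d, cases e) auto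
    then have "{u, v} \<in> E" "{u', v'} \<in> E" using that by (auto simp: darts_iff)
    moreover have "(\<lambda>x y. {x, y} \<in> E \<and> x \<in> V \<and> y \<in> V)\<^sup>*\<^sup>* v v'"
      using con calculation edgeD unfolding connected_graph_def by blast
    ultimately show ?thesis using walk de nbrs_iff by blast
  qed
  show ?thesis
  proof (cases "\<forall>d\<in>darts E. h d")
    case True
    then show ?thesis using X Y by (auto simp: h_def faces_def subset_iff image_iff)
  next
    case False
    then have "\<forall>d\<in>darts E. \<not> h d" using const by blast
    then show ?thesis using X Y by (auto simp: h_def faces_def subset_iff image_iff)
  qed
qed

text \<open>A discrete Jordan curve theorem: by Euler's formula there are as many boundaries of face sets
  as even edge sets.\<close>

theorem jordan:
  assumes "S \<in> even_sub V E"
  obtains X where "X \<subseteq> faces E rot" "bd X = S"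
proof -
  let ?F = "faces E rot" and ?P = "Pow (faces E rot)"
  have "?P = (\<Union>S\<in>bd ` ?P. {X \<in> ?P. bd X = S})" by auto
  then have "card ?P \<le> (\<Sum>S\<in>bd ` ?P. card {X \<in> ?P. bd X = S})"
    using card_UN_le[of "bd ` ?P" "\<lambda>S. {X \<in> ?P. bd X = S}"] finite_faces by simp
  also have "\<dots> \<le> (\<Sum>S\<in>bd ` ?P. 2)"
  proof (rule sum_mono)
    fix S assume "S \<in> bd ` ?P"
    then obtain X where X: "X \<subseteq> ?F" "bd X = S" by auto
    have "{X \<in> ?P. bd X = S} \<subseteq> {X, ?F - X}" using bd_fibre[OF _ X(1)] X(2) by auto
    then have "card {X \<in> ?P. bd X = S} \<le> card {X, ?F - X}" by (intro card_mono) auto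
    also have "\<dots> \<le> 2" by (simp add: card_insert_if)
    finally show "card {X \<in> ?P. bd X = S} \<le> 2" .
  qed
  \<comment> \<open>Fibres of size at most two leave at least \<open>2 ^ (card ?F - 1)\<close>
    boundaries. Euler's formula turns this number into the upper bound of
    \<open>card_even_sub\<close> on all even sets, so no even set is missed.\<close>
  finally have "2 ^ card ?F \<le> 2 * card (bd ` ?P)" by (simp add: card_Pow finite_faces)
  then have "2 ^ card ?F * 2 ^ card V \<le> 2 * (card (bd ` ?P) * 2 ^ card V)"
    unfolding mult.assoc[symmetric] by (rule mult_le_mono1)
  moreover have "(2::nat) ^ card ?F * 2 ^ card V = 2 * 2 ^ (card E + 1)"
    unfolding power_add[symmetric] euler by simp
  ultimately have "card (even_sub V E) * 2 ^ card V \<le> card (bd ` ?P) * 2 ^ card V"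
    using card_even_sub[OF sg con V_ne] by linarith
  then have le: "card (even_sub V E) \<le> card (bd ` ?P)" by simp
  have "finite (even_sub V E)"
    by (rule finite_even_sub[OF finE])
  then have "bd ` ?P = even_sub V E"
    using bd_even le by (intro card_seteq) auto
  then have "S \<in> bd ` ?P" using assms by simp
  then show ?thesis using that by blast
qed

end

section \<open>The turning number of a cycle\<close>

text \<open>A successor and a predecessor function keep index arithmetic out of the geometric
  argument; \<open>cycle_list_turn\<close> translates from lists. The condition
  \<open>nx v \<noteq> pr v\<close> excludes an edge that is run to and fro.\<close>

locale cycle_in_map = planar_rotation_system +
  fixes Z :: "nat set" and nx pr :: "nat \<Rightarrow> nat"
  assumes Z_ne: "Z \<noteq> {}"
    and nx_in: "v \<in> Z \<Longrightarrow> nx v \<in> Z" and pr_in: "v \<in> Z \<Longrightarrow> pr v \<in> Z"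
    and nx_pr: "v \<in> Z \<Longrightarrow> nx (pr v) = v" and pr_nx: "v \<in> Z \<Longrightarrow> pr (nx v) = v"
    and nx_edge: "v \<in> Z \<Longrightarrow> {v, nx v} \<in> E"
    and nx_neq_pr: "v \<in> Z \<Longrightarrow> nx v \<noteq> pr v"
    and nx_trans: "u \<in> Z \<Longrightarrow> v \<in> Z \<Longrightarrow> \<exists>j. (nx ^^ j) u = v"
begin

definition C :: "nat set set" where
  "C = (\<lambda>v. {v, nx v}) ` Z"

lemma Z_sub: "Z \<subseteq> V"
  using nx_edge edgeD by blast

lemma finZ: "finite Z"
  using Z_sub finV finite_subset by blast

lemma C_sub: "C \<subseteq> E"
  using nx_edge by (auto simp: C_def)

lemma C_iff: "{u, v} \<in> C \<longleftrightarrow> (u \<in> Z \<and> v = nx u) \<or> (v \<in> Z \<and> u = nx v)"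
  by (auto simp: C_def doubleton_eq_iff)

lemma nbrs_C: "v \<in> Z \<Longrightarrow> nbrs C v = {pr v, nx v}"
  unfolding nbrs_def C_iff using nx_pr pr_nx pr_in by auto

lemma nbrs_C_off: "v \<notin> Z \<Longrightarrow> nbrs C v = {}"
  unfolding nbrs_def C_iff using nx_in by auto

lemma C_even: "C \<in> even_sub V E"
proof -
  have "even (card (nbrs C v))" for v
    using nbrs_C[of v] nbrs_C_off[of v] nx_neq_pr[of v] by (cases "v \<in> Z") auto
  then show ?thesis using C_sub by (auto simp: even_sub_def)
qed

lemma card_C: "card C = card Z"
proof -
  have "inj_on (\<lambda>v. {v, nx v}) Z"
    by (rule inj_onI) (metis doubleton_eq_iff nx_neq_pr pr_nx)
  then show ?thesis by (simp add: C_def card_image)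
qed

lemma pr_nbr: "v \<in> Z \<Longrightarrow> pr v \<in> nbrs E v" and nx_nbr: "v \<in> Z \<Longrightarrow> nx v \<in> nbrs E v"
  using nx_edge[OF pr_in] nx_pr nx_edge by (auto simp: nbrs_def insert_commute)

text \<open>Quantifying over both ways to name an edge demands a face of \<open>X\<close> on both of
  its sides. For \<open>bd X = C\<close> this leaves the edges strictly on one side of the
  cycle.\<close>

definition IE :: "(nat \<times> nat) set set \<Rightarrow> nat set set" where
  "IE X = {e \<in> E. \<forall>u v. e = {u, v} \<longrightarrow> fc (u, v) \<in> X}"

definition IV :: "(nat \<times> nat) set set \<Rightarrow> nat set" where
  "IV X = {v \<in> V - Z. \<forall>w\<in>nbrs E v. fc (w, v) \<in> X}"

lemma IE_iff: "{u, v} \<in> IE X \<longleftrightarrow> {u, v} \<in> E \<and> fc (u, v) \<in> X \<and> fc (v, u) \<in> X"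
  unfolding IE_def by (auto simp: doubleton_eq_iff)

lemma off_uniform:
  assumes "bd X = C" "v \<in> V - Z" "w \<in> nbrs E v" "w' \<in> nbrs E v"
  shows "fc (w, v) \<in> X \<longleftrightarrow> fc (w', v) \<in> X"
  using assms corners_uniform[of v X w w'] nbrs_C_off by auto

lemma nbr_exists:
  assumes "v \<in> V" shows "nbrs E v \<noteq> {}"
proof (cases "v \<in> Z")
  case True
  then show ?thesis using nx_nbr by blast
next
  case False
  obtain z where z: "z \<in> Z" using Z_ne by blast
  then have "(\<lambda>x y. {x, y} \<in> E \<and> x \<in> V \<and> y \<in> V)\<^sup>*\<^sup>* v z"
    using con assms Z_sub unfolding connected_graph_def by blast
  moreover have "v \<noteq> z" using False z by blast
  ultimately have "\<exists>y. {v, y} \<in> E" by (induction rule: converse_rtranclp_induct) auto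
  then obtain y where "v \<in> nbrs E y" by (auto simp: nbrs_def)
  then have "y \<in> nbrs E v" by (simp only: nbrs_sym[of y v])
  then show ?thesis by (metis empty_iff)
qed

text \<open>The Euler characteristic of either side of the cycle is at most one, since its faces have
  independent boundaries in the cycle space of that side.\<close>

lemma half_euler:
  assumes X: "X \<subseteq> faces E rot" "X \<noteq> faces E rot" and bdX: "bd X = C"
  shows "card X + card (IV X) \<le> card (IE X) + 1"
proof -
  let ?W = "IV X \<union> Z" and ?G = "IE X \<union> C"
  have W_sub: "?W \<subseteq> V" using Z_sub by (auto simp: IV_def)
  have G_sub: "?G \<subseteq> E" using C_sub by (auto simp: IE_def)
  have end_in: "u \<in> ?W" if e: "{u, v} \<in> ?G" for u v
  proof (cases "u \<in> Z")
    case False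
    then have "{u, v} \<notin> C" using C_iff[of u v] nx_in[of v] by auto
    then have e': "fc (v, u) \<in> X" "{u, v} \<in> E" using e IE_iff[of u v] by auto
    then have v: "v \<in> nbrs E u" using nbrs_sym[of v u] nbrs_iff[of u v] by simp
    have u: "u \<in> V - Z" using False edgeD[OF e'(2)] by simp
    then show ?thesis using off_uniform[OF bdX u v] e'(1) by (auto simp: IV_def)
  qed simp
  have sgW: "simple_graph ?W ?G"
    unfolding simple_graph_def
  proof (intro conjI ballI)
    show "finite ?W" using W_sub finV finite_subset by blast
    fix e assume e: "e \<in> ?G"
    then have "e \<in> E" using G_sub by blast
    then obtain u v where uv: "e = {u, v}" "u \<noteq> v" by (rule edgeE)
    then have "u \<in> ?W" "v \<in> ?W" using end_in[of u v] end_in[of v u] e by (auto simp: insert_commute)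
    then show "\<exists>u v. e = {u, v} \<and> u \<noteq> v \<and> u \<in> ?W \<and> v \<in> ?W" using uv by blast
  qed
  let ?r = "\<lambda>x y. {x, y} \<in> ?G \<and> x \<in> ?W \<and> y \<in> ?W"
  have around: "?r\<^sup>*\<^sup>* z ((nx ^^ j) z)" "(nx ^^ j) z \<in> Z" if z: "z \<in> Z" for z j
  proof (induction j)
    case (Suc j)
    {
      case 1
      have "?r ((nx ^^ j) z) (nx ((nx ^^ j) z))" using Suc(2) nx_in by (auto simp: C_def)
      moreover have "(nx ^^ Suc j) z = nx ((nx ^^ j) z)" by simp
      ultimately show ?case using rtranclp.rtrancl_into_rtrancl[of ?r, OF Suc(1)] by presburger
    next
      case 2
      then show ?case using Suc nx_in by simp
    }
  qed (use z in auto)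
  have to_Z: "\<exists>z\<in>Z. ?r\<^sup>*\<^sup>* w z" if w: "w \<in> ?W" for w
  proof -
    obtain z0 where z0: "z0 \<in> Z" using Z_ne by blast
    have "(\<lambda>x y. {x, y} \<in> E \<and> x \<in> V \<and> y \<in> V)\<^sup>*\<^sup>* w z0"
      using con w W_sub z0 Z_sub unfolding connected_graph_def by blast
    then show ?thesis using w
    proof (induction rule: converse_rtranclp_induct)
      case base
      then show ?case using z0 by blast
    next
      case (step w y)
      show ?case
      proof (cases "w \<in> Z")
        case False
        then have wX: "w \<in> IV X" using step.prems by simp
        have "y \<in> nbrs E w" using step.hyps by (simp add: nbrs_def insert_commute)
        then have "fc (y, w) \<in> X" using wX by (simp add: IV_def)
        moreover have "{w, y} \<notin> bd X" unfolding bdX using False C_iff[of w y] nx_in[of y] by auto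
        ultimately have "{w, y} \<in> IE X" using step.hyps bd_iff[of w y X] by (auto simp: IE_iff)
        then have "{w, y} \<in> ?G" "y \<in> ?W" using end_in[of y w] by (auto simp: insert_commute)
        moreover from this obtain z where "z \<in> Z" "?r\<^sup>*\<^sup>* y z" using step.IH by blast
        ultimately show ?thesis
          using converse_rtranclp_into_rtranclp[of ?r w y z] step.prems by blast
      qed blast
    qed
  qed
  have sym: "?r\<^sup>*\<^sup>* y x" if "?r\<^sup>*\<^sup>* x y" for x y
  proof -
    have "symp ?r\<^sup>*\<^sup>*" by (intro symp_rtranclp sympI) (simp add: insert_commute)
    then show ?thesis using that by (rule sympD)
  qed
  have conW: "connected_graph ?W ?G"
    unfolding connected_graph_def
  proof (intro ballI)
    fix u v assume "u \<in> ?W" "v \<in> ?W"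
    then obtain z z' where z: "z \<in> Z" "?r\<^sup>*\<^sup>* u z" "z' \<in> Z" "?r\<^sup>*\<^sup>* v z'"
      using to_Z[of u] to_Z[of v] by blast
    obtain j where "(nx ^^ j) z = z'" using nx_trans[OF z(1,3)] ..
    then have "?r\<^sup>*\<^sup>* z z'" using around(1)[OF z(1), of j] by simp
    then have "?r\<^sup>*\<^sup>* u z'" by (rule rtranclp_trans[OF z(2)])
    then show "?r\<^sup>*\<^sup>* u v" by (rule rtranclp_trans[OF _ sym[OF z(4)]])
  qed
  have inj: "inj_on bd (Pow X)"
  proof (rule inj_onI)
    fix Y Y' assume Y: "Y \<in> Pow X" "Y' \<in> Pow X" "bd Y = bd Y'"
    then have "Y = Y' \<or> Y = faces E rot - Y'" using X by (intro bd_fibre) auto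
    \<comment> \<open>Two subsets of \<open>X\<close> cannot be complementary, since
      \<open>X\<close> does not contain all faces. So at most one of the two preimages of a boundary
      survives inside \<open>X\<close>.\<close>
    moreover have "Y \<noteq> faces E rot - Y'" using Y X by blast
    ultimately show "Y = Y'" by blast
  qed
  have "bd ` Pow X \<subseteq> even_sub ?W ?G"
  proof
    fix S assume "S \<in> bd ` Pow X"
    then obtain Y where Y: "Y \<subseteq> X" "S = bd Y" by auto
    have "e \<in> ?G" if e: "e \<in> bd Y" for e
    proof -
      have "e \<in> E" using e by (simp add: bd_def)
      then obtain u v where uv: "e = {u, v}" by (rule edgeE)
      then have "fc (u, v) \<in> X \<or> fc (v, u) \<in> X" "{u, v} \<in> E" using e bd_iff Y(1) by auto
      then have "{u, v} \<in> IE X \<or> {u, v} \<in> bd X" by (auto simp: bd_iff IE_iff)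
      then show ?thesis using uv bdX by auto
    qed
    then show "S \<in> even_sub ?W ?G"
      using bd_even[of Y] W_sub Y(2) by (auto simp: even_sub_def)
  qed
  moreover have "finite (even_sub ?W ?G)"
    by (rule finite_even_sub[OF finite_subset[OF G_sub finE]])
  ultimately have "card (Pow X) \<le> card (even_sub ?W ?G)" using inj card_inj_on_le by blast
  then have "2 ^ card X * 2 ^ card ?W \<le> card (even_sub ?W ?G) * 2 ^ card ?W"
    using finite_subset[OF X(1) finite_faces] by (simp add: card_Pow)
  also have "\<dots> \<le> 2 ^ (card ?G + 1)" using card_even_sub[OF sgW conW] Z_ne by simp
  finally have "(2::nat) ^ (card X + card ?W) \<le> 2 ^ (card ?G + 1)" by (simp only: power_add)
  then have "card X + card ?W \<le> card ?G + 1" by (simp only: power_increasing_iff)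
  moreover have "card ?W = card (IV X) + card Z"
    using finV finZ by (intro card_Un_disjoint) (auto simp: IV_def)
  moreover have "card ?G \<le> card (IE X) + card C" by (rule card_Un_le)
  ultimately show ?thesis using card_C by linarith
qed

text \<open>The inequalities for \<open>X\<close> and for its complement add up to Euler's formula
  of the whole map, which is an equality; hence neither is strict. The cycle itself cancels, having
  as many vertices as edges.\<close>

lemma half_euler_eq:
  assumes X: "X \<subseteq> faces E rot" and bdX: "bd X = C"
  shows "card X + card (IV X) = card (IE X) + 1"
proof -
  let ?Y = "faces E rot - X"
  have bdY: "bd ?Y = C" using bd_complement[OF X] bdX by simp
  have C_ne: "C \<noteq> {}" using Z_ne by (simp add: C_def)
  have bd0: "bd {} = {}" by (auto simp: bd_def)
  have "X \<noteq> {}" using C_ne bdX bd0 by auto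
  moreover have "?Y \<noteq> {}" by (metis C_ne bdY bd0)
  ultimately have ne: "X \<noteq> faces E rot" "?Y \<noteq> faces E rot" using X by auto
  have VXsub: "IV X \<union> IV ?Y \<subseteq> V - Z" by (auto simp: IV_def)
  have fcs: "fc (u, v) \<in> faces E rot" if "{u, v} \<in> E" for u v
    using that by (auto simp: faces_def darts_iff)
  have V_split: "IV X \<union> IV ?Y = V - Z"
  proof
    show "V - Z \<subseteq> IV X \<union> IV ?Y"
    proof
      fix v assume v: "v \<in> V - Z"
      then obtain w where w: "w \<in> nbrs E v" using nbr_exists by blast
      show "v \<in> IV X \<union> IV ?Y"
      proof (cases "fc (w, v) \<in> X")
        case True
        then show ?thesis using off_uniform[OF bdX v w] v by (auto simp: IV_def)
      next
        case False
        then have "fc (w, v) \<in> ?Y" using w fcs by (simp add: nbrs_iff)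
        then show ?thesis using off_uniform[OF bdY v w] v by (auto simp: IV_def)
      qed
    qed
  qed (rule VXsub)
  have V_disj: "IV X \<inter> IV ?Y = {}"
    using nbr_exists by (auto simp: IV_def)
  have E_split: "IE X \<union> IE ?Y \<union> C = E"
  proof
    show "E \<subseteq> IE X \<union> IE ?Y \<union> C"
    proof
      fix e assume e: "e \<in> E"
      then obtain u v where uv: "e = {u, v}" by (rule edgeE)
      then have "fc (u, v) \<in> faces E rot" "fc (v, u) \<in> faces E rot"
        using e fcs[of u v] fcs[of v u] by (auto simp: insert_commute)
      then show "e \<in> IE X \<union> IE ?Y \<union> C"
        using e unfolding uv bdX[symmetric] Un_iff bd_iff IE_iff by auto
    qed
  qed (use C_sub in \<open>auto simp: IE_def\<close>)
  have E_disj: "IE X \<inter> IE ?Y = {}" "(IE X \<union> IE ?Y) \<inter> C = {}"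
  proof -
    have *: "\<not> ({u, v} \<in> IE X \<and> {u, v} \<in> IE ?Y)" "\<not> ({u, v} \<in> IE X \<and> {u, v} \<in> C)"
      "\<not> ({u, v} \<in> IE ?Y \<and> {u, v} \<in> C)" for u v
      unfolding bdX[symmetric] bd_iff IE_iff by auto
    have sub: "IE Y \<subseteq> E" for Y by (auto simp: IE_def)
    have "e \<notin> IE X \<inter> IE ?Y \<and> e \<notin> (IE X \<union> IE ?Y) \<inter> C" if "e \<in> E" for e
      using edgeE[OF that] * by (metis IntD1 IntD2 UnE)
    then show "IE X \<inter> IE ?Y = {}" "(IE X \<union> IE ?Y) \<inter> C = {}" using sub C_sub by blast+
  qed
  have fE: "finite (IE Y)" for Y using finE by (auto simp: IE_def)
  have fV: "finite (IV Y)" for Y using finV by (auto simp: IV_def)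
  have cE: "card E = card (IE X) + card (IE ?Y) + card Z"
    using card_Un_disjoint[OF _ _ E_disj(2)] card_Un_disjoint[OF _ _ E_disj(1)] fE finZ E_split card_C
    by (simp add: C_def)
  have "card (V - Z) = card V - card Z" "card Z \<le> card V"
    using Z_sub finV finZ by (auto simp: card_Diff_subset card_mono)
  then have cV: "card V = card (IV X) + card (IV ?Y) + card Z"
    using card_Un_disjoint[OF fV fV V_disj] V_split by simp
  have cF: "card (faces E rot) = card X + card ?Y"
    using card_Un_disjoint[of X ?Y] X finite_faces finite_subset[OF X finite_faces] by (simp add: Un_absorb1)
  show ?thesis
    using half_euler[OF X ne(1) bdX] half_euler[OF _ ne(2) bdY] euler cE cV cF by simp
qed

text \<open>Membership in \<open>X\<close> changes only across edges of the cycle. At a cycle vertex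
  these lead to \<open>pr v\<close> and \<open>nx v\<close> and split the corners into two arcs;
  walking along the cycle transports the choice made at \<open>v0\<close> to all its
  vertices.\<close>

lemma left_side:
  assumes X: "X \<subseteq> faces E rot" and bdX: "bd X = C" and v0: "v0 \<in> Z" "fc (v0, nx v0) \<in> X"
    and v: "v \<in> Z"
  shows "{w \<in> nbrs E v. fc (w, v) \<in> X} = arc (rot v) (pr v) (nx v)"
    and "fc (v, nx v) \<in> X" and "fc (nx v, v) \<notin> X"
proof -
  have bdi: "{u, v} \<in> C \<longleftrightarrow> {u, v} \<in> E \<and> (fc (u, v) \<in> X) \<noteq> (fc (v, u) \<in> X)" for u v
    using bdX bd_iff by blast
  have side: "fc (w, v) \<in> X \<longleftrightarrow> fc (v, w) \<in> X"
    if "v \<in> Z" "w \<in> nbrs E v" "w \<noteq> pr v" "w \<noteq> nx v" for v w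
    using that bdi[of w v] nbrs_C[OF that(1)] by (auto simp: nbrs_def)
  have along: "fc ((rot v ^^ t) x, v) \<in> X \<longleftrightarrow> fc (x, v) \<in> X"
    if v: "v \<in> Z" and xy: "{x, y} = {pr v, nx v}" and t: "t < hit (rot v) x y" for v x y t
  proof -
    interpret c: cyclic_perm "nbrs E v" "rot v" using cyclic v Z_sub by blast
    have x: "x \<in> nbrs E v" and y: "y \<in> nbrs E v" and "x \<noteq> y"
      using xy pr_nbr[OF v] nx_nbr[OF v] nx_neq_pr[OF v] by (auto simp: doubleton_eq_iff)
    show ?thesis using t
    proof (induction t)
      case (Suc t)
      let ?w = "(rot v ^^ t) x"
      have w: "?w \<in> nbrs E v" using c.pow_in[OF x] .
      have "rot v ?w \<noteq> y" using c.hit_minimal[of "Suc t" x y] Suc.prems by simp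
      moreover have "rot v ?w \<noteq> x"
      proof
        assume "rot v ?w = x"
        then have "(\<lambda>i. (rot v ^^ i) x) (Suc t) = (\<lambda>i. (rot v ^^ i) x) 0" by simp
        then show False using inj_onD[OF c.pow_inj_below_hit[OF x y], of "Suc t" 0] Suc.prems by simp
      qed
      ultimately have "rot v ?w \<noteq> pr v" "rot v ?w \<noteq> nx v" using xy by (auto simp: doubleton_eq_iff)
      then show ?case using side[OF v rot_in[OF w]] face_corner[OF w] Suc by simp
    qed simp
  qed
  have arrive: "fc (v, y) = fc ((rot v ^^ (hit (rot v) x y - 1)) x, v)"
    "hit (rot v) x y - 1 < hit (rot v) x y"
    if v: "v \<in> Z" and xy: "{x, y} = {pr v, nx v}" for v x y
  proof -
    interpret c: cyclic_perm "nbrs E v" "rot v" using cyclic v Z_sub by blast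
    have x: "x \<in> nbrs E v" and y: "y \<in> nbrs E v"
      using xy pr_nbr[OF v] nx_nbr[OF v] by (auto simp: doubleton_eq_iff)
    let ?h = "hit (rot v) x y"
    show l: "?h - 1 < ?h" using c.hit_pos[OF x y] by simp
    then have "rot v ((rot v ^^ (?h - 1)) x) = y"
      using c.hit_pow[OF x y] by (metis Suc_diff_1 c.hit_pos[OF x y] funpow.simps(2) o_apply)
    then show "fc (v, y) = fc ((rot v ^^ (?h - 1)) x, v)" using face_corner[OF c.pow_in[OF x]] by metis
  qed
  have step: "fc (v, nx v) \<in> X" if "v \<in> Z" "fc (pr v, v) \<in> X" for v
    using arrive[OF that(1), of "pr v" "nx v"] along[OF that(1), of "pr v" "nx v"] that(2) by simp
  have fwd: "fc (v, nx v) \<in> X" if v: "v \<in> Z" for v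
  proof -
    obtain j where "(nx ^^ j) v0 = v" using nx_trans[OF v0(1) v] by blast
    moreover have "(nx ^^ j) v0 \<in> Z \<and> fc ((nx ^^ j) v0, nx ((nx ^^ j) v0)) \<in> X" for j
    proof (induction j)
      case (Suc j)
      then show ?case using step[of "nx ((nx ^^ j) v0)"] nx_in pr_nx by simp
    qed (use v0 in simp)
    ultimately show ?thesis by metis
  qed
  have bwd: "fc (nx v, v) \<notin> X" if "v \<in> Z" for v
    using bdi[of v "nx v"] fwd[OF that] that by (auto simp: C_iff)
  show "fc (v, nx v) \<in> X" "fc (nx v, v) \<notin> X" using fwd bwd v by auto
  interpret c: cyclic_perm "nbrs E v" "rot v" using cyclic v Z_sub by blast
  have p: "pr v \<in> nbrs E v" and n: "nx v \<in> nbrs E v" and pn: "pr v \<noteq> nx v"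
    using pr_nbr nx_nbr nx_neq_pr v by metis+
  have pin: "fc (pr v, v) \<in> X" using fwd[OF pr_in[OF v]] nx_pr[OF v] by simp
  have 1: "fc (w, v) \<in> X" if "w \<in> arc (rot v) (pr v) (nx v)" for w
    using that along[OF v, of "pr v" "nx v"] pin by (auto simp: arc_def)
  have 2: "fc (w, v) \<notin> X" if "w \<in> arc (rot v) (nx v) (pr v)" for w
    using that along[OF v, of "nx v" "pr v"] bwd[OF v] by (auto simp: arc_def insert_commute)
  show "{w \<in> nbrs E v. fc (w, v) \<in> X} = arc (rot v) (pr v) (nx v)"
    using 1 2 c.arc_partition[OF p n pn] by blast
qed

lemma card_darts_on:
  assumes "S \<subseteq> E" shows "card (darts S) = 2 * card S"
proof -
  have fS: "finite S" using assms finE finite_subset by blast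
  have "darts S = (\<Union>e\<in>S. {(u, v). {u, v} = e})" by (auto simp: darts_def)
  also have "card \<dots> = (\<Sum>e\<in>S. card {(u, v). {u, v} = e})"
  proof (intro card_UN_disjoint ballI impI)
    fix e assume "e \<in> S"
    then have "e \<in> E" using assms by blast
    then obtain a b where "e = {a, b}" by (rule edgeE)
    then have "{(u, v). {u, v} = e} = {(a, b), (b, a)}" by (auto simp: doubleton_eq_iff)
    then show "finite {(u, v). {u, v} = e}" by simp
  qed (auto simp: fS)
  also have "\<dots> = (\<Sum>e\<in>S. 2)"
  proof (rule sum.cong[OF refl])
    fix e assume "e \<in> S"
    then have "e \<in> E" using assms by blast
    then obtain a b where "e = {a, b}" "a \<noteq> b" by (rule edgeE)
    then have "{(u, v). {u, v} = e} = {(a, b), (b, a)}" by (auto simp: doubleton_eq_iff)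
    then show "card {(u, v). {u, v} = e} = 2" using \<open>a \<noteq> b\<close> by simp
  qed
  finally show ?thesis by simp
qed

text \<open>A discrete Gauss-Bonnet argument. The face conditions on the left side \<open>X\<close>
  add up to 4 per face, less 8 if the external face \<open>fo\<close> is among them. Regrouped, the
  same sum is 2 per dart minus all angles, that is, minus 4 per inner vertex and minus the left
  angles along the cycle. As the side has Euler characteristic 1, the turning number is -4, or 4 if
  \<open>fo\<close> lies in \<open>X\<close>.\<close>

theorem cycle_turn:
  assumes ang: "\<And>v. v \<in> V \<Longrightarrow> (\<Sum>u\<in>nbrs E v. ang v u) = 4"
    and fsum: "\<And>F. F \<in> faces E rot \<Longrightarrow>
      (\<Sum>(u, v)\<in>F. 2 - int (ang v u)) = (if F = fo then - 4 else 4)"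
  shows "\<bar>\<Sum>v\<in>Z. turn rot ang (pr v) v (nx v)\<bar> = 4"
proof -
  obtain v0 where v0: "v0 \<in> Z" using Z_ne by blast
  obtain X0 where X0: "X0 \<subseteq> faces E rot" "bd X0 = C" using jordan[OF C_even] .
  \<comment> \<open>A set of faces and its complement have the same boundary, so the side to the
    left of the cycle may be chosen.\<close>
  have "\<exists>X. X \<subseteq> faces E rot \<and> bd X = C \<and> fc (v0, nx v0) \<in> X"
  proof (cases "fc (v0, nx v0) \<in> X0")
    case False
    have "fc (v0, nx v0) \<in> faces E rot" using nx_edge[OF v0] by (auto simp: faces_def darts_iff)
    then show ?thesis
      using False bd_complement[OF X0(1)] X0(2) by (intro exI[of _ "faces E rot - X0"]) auto
  qed (use X0 in blast)
  then obtain X where X: "X \<subseteq> faces E rot" "bd X = C" "fc (v0, nx v0) \<in> X" by blast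
  note left = left_side[OF X(1,2) v0 X(3)]
  define N where "N v = {w \<in> nbrs E v. fc (w, v) \<in> X}" for v
  define D where "D = {d \<in> darts E. fc d \<in> X}"
  let ?g = "\<lambda>d. 2 - int (ang (snd d) (fst d))"
  have finX: "finite X" using finite_subset[OF X(1) finite_faces] .
  have D_Sigma: "D = prod.swap ` Sigma V N"
    using edgeD by (auto simp: D_def N_def darts_iff nbrs_iff darts_def)
  have finN: "finite (N v)" for v using fin_nbrs by (simp add: N_def)
  have cwang: "(\<Sum>u\<in>N v. int (ang v u)) = int (cwang rot ang v (pr v) (nx v))" if v: "v \<in> Z" for v
  proof -
    interpret c: cyclic_perm "nbrs E v" "rot v" using cyclic v Z_sub by blast
    show ?thesis unfolding N_def left(1)[OF v] cwang_def
      using c.sum_below_hit[OF pr_nbr[OF v] nx_nbr[OF v], of "ang v"] by (simp add: hit_def)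
  qed
  have "(\<Sum>d\<in>D. int (ang (snd d) (fst d))) = (\<Sum>v\<in>V. \<Sum>u\<in>N v. int (ang v u))"
    unfolding D_Sigma by (subst sum.reindex) (auto simp: sum.Sigma[OF finV] finN case_prod_unfold inj_on_def)
  also have "\<dots> = (\<Sum>v\<in>IV X. \<Sum>u\<in>N v. int (ang v u)) + (\<Sum>v\<in>Z. \<Sum>u\<in>N v. int (ang v u))"
  proof -
    have "(\<Sum>v\<in>IV X \<union> Z. \<Sum>u\<in>N v. int (ang v u)) = (\<Sum>v\<in>V. \<Sum>u\<in>N v. int (ang v u))"
    proof (rule sum.mono_neutral_left[OF finV])
      show "IV X \<union> Z \<subseteq> V" using Z_sub by (auto simp: IV_def)
      show "\<forall>v\<in>V - (IV X \<union> Z). (\<Sum>u\<in>N v. int (ang v u)) = 0"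
      proof
        fix v assume v: "v \<in> V - (IV X \<union> Z)"
        then have vZ: "v \<in> V - Z" by blast
        obtain w where w: "w \<in> nbrs E v" "fc (w, v) \<notin> X" using v by (auto simp: IV_def)
        have "fc (w', v) \<notin> X" if "w' \<in> nbrs E v" for w'
          using off_uniform[OF X(2) vZ w(1) that] w(2) by simp
        then have "N v = {}" by (simp add: N_def)
        then show "(\<Sum>u\<in>N v. int (ang v u)) = 0" by simp
      qed
    qed
    moreover have "IV X \<inter> Z = {}" "finite (IV X)" using finV by (auto simp: IV_def)
    ultimately show ?thesis using finZ by (simp add: sum.union_disjoint)
  qed
  also have "(\<Sum>v\<in>IV X. \<Sum>u\<in>N v. int (ang v u)) = 4 * int (card (IV X))"
  proof -
    have "(\<Sum>u\<in>N v. int (ang v u)) = 4" if "v \<in> IV X" for v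
    proof -
      have "N v = nbrs E v" using that by (auto simp: N_def IV_def)
      then show ?thesis using ang[of v] that by (simp add: IV_def flip: of_nat_sum)
    qed
    then show ?thesis by simp
  qed
  finally have angs: "(\<Sum>d\<in>D. int (ang (snd d) (fst d)))
      = 4 * int (card (IV X)) + (\<Sum>v\<in>Z. int (cwang rot ang v (pr v) (nx v)))"
    using cwang by simp
  \<comment> \<open>An edge inside has both darts in \<open>D\<close>, an edge of the cycle only the
    forward one.\<close>
  have cardD: "card D = 2 * card (IE X) + card Z"
  proof -
    have "D = darts (IE X) \<union> (\<lambda>v. (v, nx v)) ` Z"
    proof (intro set_eqI iffI)
      fix d assume d: "d \<in> D"
      obtain u v where uv: "d = (u, v)" by (cases d)
      show "d \<in> darts (IE X) \<union> (\<lambda>v. (v, nx v)) ` Z"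
      proof (cases "fc (v, u) \<in> X")
        case True
        then show ?thesis using d uv by (auto simp: D_def darts_def IE_iff)
      next
        case False
        then have "{u, v} \<in> C" using d uv X(2) bd_iff[of u v X] by (auto simp: D_def darts_def)
        then show ?thesis using C_iff False left(2,3) d uv by (auto simp: D_def)
      qed
    next
      fix d assume "d \<in> darts (IE X) \<union> (\<lambda>v. (v, nx v)) ` Z"
      then show "d \<in> D"
      proof
        assume "d \<in> darts (IE X)"
        then show ?thesis by (cases d) (simp add: D_def darts_def IE_iff)
      next
        assume "d \<in> (\<lambda>v. (v, nx v)) ` Z"
        then show ?thesis using left(2) nx_edge by (auto simp: D_def darts_def)
      qed
    qed
    moreover have "darts (IE X) \<inter> (\<lambda>v. (v, nx v)) ` Z = {}"
      using left(3) by (auto simp: darts_def IE_iff)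
    moreover have "IE X \<subseteq> E" by (auto simp: IE_def)
    moreover have "finite (darts (IE X))"
      by (rule finite_subset[OF _ fin_darts]) (auto simp: darts_def IE_def)
    moreover have "card ((\<lambda>v. (v, nx v)) ` Z) = card Z" by (simp add: card_image inj_on_def)
    ultimately show ?thesis using finZ by (simp add: card_Un_disjoint card_darts_on)
  qed
  have "(\<Sum>F\<in>X. \<Sum>d\<in>F. ?g d) = (\<Sum>d\<in>D. ?g d)"
    unfolding D_def by (rule sum_over_faces[OF X(1)])
  moreover have "(\<Sum>F\<in>X. \<Sum>d\<in>F. ?g d) = (\<Sum>F\<in>X. if F = fo then - 4 else 4)"
    using fsum[OF subsetD[OF X(1)]] by (intro sum.cong) (simp_all add: case_prod_unfold)
  moreover have "(\<Sum>F\<in>X. if F = fo then - 4 else 4) = 4 * int (card X) - (if fo \<in> X then 8 else 0)"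
  proof -
    have "(\<Sum>F\<in>X. if F = fo then - 4 else (4::int)) = (\<Sum>F\<in>X. 4 - (if F = fo then 8 else 0))"
      by (intro sum.cong) auto
    then show ?thesis using finX by (simp add: sum_subtractf)
  qed
  moreover have "(\<Sum>d\<in>D. ?g d) = 2 * int (card D) - (\<Sum>d\<in>D. int (ang (snd d) (fst d)))"
    by (simp add: sum_subtractf)
  moreover have "(\<Sum>v\<in>Z. turn rot ang (pr v) v (nx v))
      = (\<Sum>v\<in>Z. int (cwang rot ang v (pr v) (nx v))) - 2 * int (card Z)"
    by (simp add: turn_def sum_subtractf)
  moreover have "int (card X) + int (card (IV X)) = int (card (IE X)) + 1"
    using half_euler_eq[OF X(1,2)] by linarith
  ultimately have "(\<Sum>v\<in>Z. turn rot ang (pr v) v (nx v)) = - 4 + (if fo \<in> X then 8 else 0)"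
    using angs cardD by (simp add: algebra_simps)
  then show ?thesis by simp
qed

end

section \<open>Turns along paths of a rectilinear representation\<close>

fun pt :: "(nat \<Rightarrow> nat \<Rightarrow> nat) \<Rightarrow> (nat \<Rightarrow> nat \<Rightarrow> nat) \<Rightarrow> nat list \<Rightarrow> int" where
  "pt rot ang (x # y # z # r) = turn rot ang x y z + pt rot ang (y # z # r)"
| "pt rot ang _ = 0"

text \<open>A turn involves three consecutive vertices, so no turn is lost or counted twice when the
  two pieces overlap in exactly one edge.\<close>

lemma pt_append:
  "pt rot ang (xs @ a # b # ys) = pt rot ang (xs @ [a, b]) + pt rot ang (a # b # ys)"
proof (induction xs)
  case (Cons x xs)
  then show ?case by (cases xs; cases "tl xs") auto
qed simp

lemma pt_sum:
  "pt rot ang w = (\<Sum>j<length w - 2. turn rot ang (w ! j) (w ! Suc j) (w ! Suc (Suc j)))"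
proof (induction rot ang w rule: pt.induct)
  case (1 rot ang x y z r)
  then show ?case by (simp add: sum.lessThan_Suc_shift del: sum.lessThan_Suc)
qed auto

lemma spine_val_eq_pt: "spine_val rot ang P None None = pt rot ang P"
proof -
  have "(\<Sum>i\<in>{1..<length P - 1}. turn rot ang (P ! (i - 1)) (P ! i) (P ! Suc i))
      = (\<Sum>j<length P - 2. turn rot ang (P ! j) (P ! Suc j) (P ! Suc (Suc j)))"
    by (rule sum.reindex_bij_witness[where i = Suc and j = "\<lambda>i. i - 1"]) auto
  then show ?thesis by (simp add: spine_val_def pt_sum)
qed

lemma path_edges_image: "path_edges p = (\<lambda>i. {p ! i, p ! Suc i}) ` {i. Suc i < length p}"
  by (auto simp: path_edges_def)

lemma path_edges_Cons: "path_edges (x # y # r) = insert {x, y} (path_edges (y # r))"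
proof -
  have "{i. Suc i < length (x # y # r)} = insert 0 (Suc ` {i. Suc i < length (y # r)})"
  proof (rule set_eqI)
    fix i
    show "i \<in> {i. Suc i < length (x # y # r)} \<longleftrightarrow> i \<in> insert 0 (Suc ` {i. Suc i < length (y # r)})"
      by (cases i) auto
  qed
  then show ?thesis
    unfolding path_edges_image by (simp only: image_insert image_image nth_Cons_0 nth_Cons_Suc)
qed

lemma path_edges_single [simp]: "path_edges [x] = {}" "path_edges [] = {}"
  by (auto simp: path_edges_def)

lemma path_edges_append:
  "path_edges (xs @ a # ys) = path_edges (xs @ [a]) \<union> path_edges (a # ys)"
proof (induction xs)
  case (Cons x xs)
  then show ?case by (cases xs) (auto simp: path_edges_Cons)
qed simp

lemma path_edges_rev: "path_edges (rev w) = path_edges w"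
proof (induction w)
  case (Cons x w)
  show ?case
  proof (cases w)
    case (Cons y r)
    then show ?thesis
      using Cons.IH path_edges_append[of "rev r" y "[x]"] by (simp add: path_edges_Cons insert_commute)
  qed simp
qed simp

lemma path_edges_nth: "path_edges w \<subseteq> E \<Longrightarrow> Suc i < length w \<Longrightarrow> {w ! i, w ! Suc i} \<in> E"
  by (auto simp: path_edges_def)

locale rectilinear =
  fixes V :: "nat set" and E :: "nat set set" and rot ang :: "nat \<Rightarrow> nat \<Rightarrow> nat" and d0 :: "nat \<times> nat"
  assumes graph: "simple_graph V E" "connected_graph V E" and rep: "rect_rep V E rot ang d0"

sublocale rectilinear \<subseteq> planar_rotation_system V E rot
proof unfold_locales
  show "simple_graph V E" "connected_graph V E" by (rule graph)+
  show "E \<noteq> {}" using rep by (auto simp: rect_rep_def darts_def)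
qed (use rep in \<open>auto simp: rect_rep_def\<close>)

context rectilinear
begin

lemma ang_sum: "v \<in> V \<Longrightarrow> (\<Sum>u\<in>nbrs E v. ang v u) = 4"
  and ang_pos: "v \<in> V \<Longrightarrow> u \<in> nbrs E v \<Longrightarrow> 1 \<le> ang v u"
  using rep by (auto simp: rect_rep_def)

text \<open>Repeating the first two vertices at the end makes \<open>pt\<close> count the turn at
  the last and at the first vertex too.\<close>

lemma cycle_list_turn:
  assumes dist: "distinct c" and len: "3 \<le> length c"
    and edges: "\<And>i. i < length c \<Longrightarrow> {c ! i, c ! (Suc i mod length c)} \<in> E"
  shows "\<bar>pt rot ang (c @ [c ! 0, c ! 1])\<bar> = 4"
proof -
  define n where "n = length c"
  define idx where "idx = inv_into {..<n} ((!) c)"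
  define nx where "nx v = c ! (Suc (idx v) mod n)" for v
  define pr where "pr v = c ! ((idx v + (n - 1)) mod n)" for v
  have n3: "3 \<le> n" using len n_def by simp
  then have n_pos: "0 < n" by linarith
  have shift_down: "(Suc i mod n + (n - 1)) mod n = i" if "i < n" for i
  proof -
    have "(Suc i mod n + (n - 1)) mod n = (Suc i + (n - 1)) mod n" by (rule mod_add_left_eq)
    also have "Suc i + (n - 1) = i + n" using n3 by simp
    finally show ?thesis using that by simp
  qed
  have shift_up: "Suc ((i + (n - 1)) mod n) mod n = i" if "i < n" for i
  proof -
    have "Suc ((i + (n - 1)) mod n) mod n = Suc (i + (n - 1)) mod n" by (rule mod_Suc_eq)
    also have "Suc (i + (n - 1)) = i + n" using n3 by simp
    finally show ?thesis using that by simp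
  qed
  have idx: "idx (c ! i) = i" if "i < n" for i
    unfolding idx_def using that dist by (intro inv_into_f_f) (auto simp: inj_on_nth n_def)
  have nx: "nx (c ! i) = c ! (Suc i mod n)" if "i < n" for i using idx[OF that] by (simp add: nx_def)
  have pr: "pr (c ! i) = c ! ((i + (n - 1)) mod n)" if "i < n" for i using idx[OF that] by (simp add: pr_def)
  have inZ: "c ! (i mod n) \<in> set c" for i
    unfolding n_def using len by (intro nth_mem mod_less_divisor) linarith
  have Z: "\<exists>i<n. v = c ! i" if "v \<in> set c" for v using that by (auto simp: in_set_conv_nth n_def)
  have pow: "(nx ^^ j) (c ! i) = c ! ((i + j) mod n)" if "i < n" for i j
  proof (induction j)
    case (Suc j)
    have "(i + j) mod n < n" using n3 by simp
    then show ?case using Suc nx by (simp add: mod_Suc_eq)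
  qed (use that in simp)
  interpret cycle_in_map V E rot "set c" nx pr
  proof unfold_locales
    show "set c \<noteq> {}" using len by auto
    fix v assume v: "v \<in> set c"
    then obtain i where i: "i < n" "v = c ! i" using Z by blast
    show "nx v \<in> set c" "pr v \<in> set c" using i nx pr inZ by auto
    have m: "Suc i mod n < n" "(i + (n - 1)) mod n < n" using n3 by auto
    show "nx (pr v) = v" "pr (nx v) = v"
      using i nx[OF i(1)] pr[OF i(1)] nx[OF m(2)] pr[OF m(1)] shift_down[OF i(1)] shift_up[OF i(1)] by simp_all
    show "{v, nx v} \<in> E" using edges i nx by (simp add: n_def)
    have "Suc i mod n \<noteq> (i + (n - 1)) mod n"
    proof
      assume a: "Suc i mod n = (i + (n - 1)) mod n"
      have "Suc i mod n = (if Suc i = n then 0 else Suc i)" using i by auto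
      moreover have "(i + (n - 1)) mod n = (if i = 0 then n - 1 else i - 1)"
      proof (cases i)
        case (Suc j)
        then have "i + (n - 1) = j + n" using n3 by simp
        then show ?thesis using Suc i by simp
      qed (use n3 in simp)
      ultimately show False using a n3 i by (auto split: if_splits)
    qed
    then show "nx v \<noteq> pr v" using i nx pr m dist by (simp add: nth_eq_iff_index_eq n_def)
  next
    fix u v assume "u \<in> set c" "v \<in> set c"
    then obtain i k where i: "i < n" "u = c ! i" "k < n" "v = c ! k" using Z by meson
    then have "(nx ^^ (n - i + k)) u = c ! ((i + (n - i + k)) mod n)" using pow by simp
    also have "i + (n - i + k) = k + n" using i by simp
    finally have "(nx ^^ (n - i + k)) u = v" using i by simp
    then show "\<exists>j. (nx ^^ j) u = v" ..
  qed
  have "\<bar>\<Sum>v\<in>set c. turn rot ang (pr v) v (nx v)\<bar> = 4"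
    using rep ang_sum by (intro cycle_turn[where fo = "face_of rot d0"]) (auto simp: rect_rep_def)
  moreover have "(\<Sum>v\<in>set c. turn rot ang (pr v) v (nx v)) = pt rot ang (c @ [c ! 0, c ! 1])"
  proof -
    let ?w = "c @ [c ! 0, c ! 1]"
    have w: "?w ! j = c ! (j mod n)" if jn: "j < n + 2" for j
    proof -
      consider "j < n" | "j = n" | "j = Suc n" using jn by linarith
      moreover have "Suc n mod n = 1" using n3 by (simp add: mod_Suc)
      ultimately show ?thesis using n3 by cases (auto simp: nth_append n_def)
    qed
    let ?t = "\<lambda>i. turn rot ang (c ! ((i + (n - 1)) mod n)) (c ! i) (c ! (Suc i mod n))"
    have bij: "bij_betw ((!) c) {..<n} (set c)" using dist by (intro bij_betw_nth) (auto simp: n_def)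
    have "(\<Sum>v\<in>set c. turn rot ang (pr v) v (nx v)) = (\<Sum>i<n. turn rot ang (pr (c ! i)) (c ! i) (nx (c ! i)))"
      by (rule sum.reindex_bij_betw[OF bij, symmetric])
    also have "\<dots> = (\<Sum>i<n. ?t i)"
      by (intro sum.cong) (auto simp: nx pr)
    \<comment> \<open>The first turn counted by \<open>pt\<close> is that at index 1, so the cyclic
      sum is shifted by one.\<close>
    also have "\<dots> = (\<Sum>j<n. ?t (Suc j mod n))"
      by (rule sum.reindex_bij_witness[where j = "\<lambda>i. (i + (n - 1)) mod n" and i = "\<lambda>j. Suc j mod n"])
        (use n_pos in \<open>simp_all only: lessThan_iff shift_down shift_up mod_less_divisor\<close>)
    also have "\<dots> = (\<Sum>j<n. turn rot ang (?w ! j) (?w ! Suc j) (?w ! Suc (Suc j)))"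
    proof (rule sum.cong[OF refl])
      fix j assume j: "j \<in> {..<n}"
      then have "(Suc j mod n + (n - 1)) mod n = j" by (simp only: shift_down lessThan_iff)
      then show "?t (Suc j mod n) = turn rot ang (?w ! j) (?w ! Suc j) (?w ! Suc (Suc j))"
        using j w[of j] w[of "Suc j"] w[of "Suc (Suc j)"] by (simp add: mod_Suc_eq)
    qed
    finally show ?thesis by (simp add: pt_sum n_def)
  qed
  ultimately show ?thesis by simp
qed

lemma cwang_swap:
  assumes "a \<in> nbrs E v" "b \<in> nbrs E v" "a \<noteq> b"
  shows "cwang rot ang v a b + cwang rot ang v b a = 4" and "1 \<le> cwang rot ang v a b"
proof -
  have v: "v \<in> V" using assms(1) nbrs_empty by blast
  interpret c: cyclic_perm "nbrs E v" "rot v" using cyclic[OF v] .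
  have ab: "cwang rot ang v a b = sum (ang v) (arc (rot v) a b)"
    "cwang rot ang v b a = sum (ang v) (arc (rot v) b a)"
    using c.sum_below_hit[of a b "ang v"] c.sum_below_hit[of b a "ang v"] assms
    by (simp_all add: cwang_def hit_def)
  have fin: "finite (arc (rot v) x y)" for x y by (simp add: arc_def)
  show "cwang rot ang v a b + cwang rot ang v b a = 4"
    using sum.union_disjoint[OF fin fin c.arc_partition(2)[OF assms], of "ang v"]
      c.arc_partition(1)[OF assms] ang_sum[OF v] ab by simp
  have "a \<in> arc (rot v) a b"
    unfolding arc_def using c.hit_pos[OF assms(1,2)] by (intro image_eqI[where x = 0]) auto
  then have "ang v a \<le> cwang rot ang v a b" unfolding ab by (intro member_le_sum fin) auto
  then show "1 \<le> cwang rot ang v a b" using ang_pos[OF v assms(1)] by simp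
qed

text \<open>The two angles between the edges at \<open>v\<close> are at least 1 and add up to 4;
  subtracting 2 makes them opposite numbers between -1 and 1.\<close>

lemma turn_swap:
  assumes "{a, v} \<in> E" "{v, b} \<in> E" "a \<noteq> b"
  shows "turn rot ang b v a = - turn rot ang a v b" and "\<bar>turn rot ang a v b\<bar> \<le> 1"
proof -
  have n: "a \<in> nbrs E v" "b \<in> nbrs E v" using assms by (auto simp: nbrs_def insert_commute)
  show "turn rot ang b v a = - turn rot ang a v b"
    using cwang_swap(1)[OF n assms(3)] by (simp add: turn_def)
  show "\<bar>turn rot ang a v b\<bar> \<le> 1"
    using cwang_swap[OF n assms(3)] cwang_swap(2)[OF n(2,1)] assms(3) by (simp add: turn_def)
qed

lemma pt_rev:
  assumes "distinct w" "path_edges w \<subseteq> E" shows "pt rot ang (rev w) = - pt rot ang w"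
  using assms
proof (induction w rule: induct_list012)
  case (3 x y zs)
  show ?case
  proof (cases zs)
    case (Cons z r)
    have e: "{x, y} \<in> E" "{y, z} \<in> E" "x \<noteq> z" using "3.prems" Cons by (auto simp: path_edges_Cons)
    have IH: "pt rot ang (rev r @ [z, y]) = - pt rot ang (y # z # r)"
      using "3.IH"(2) "3.prems" Cons by (simp add: path_edges_Cons)
    have "pt rot ang (rev (x # y # zs)) = pt rot ang (rev r @ z # y # [x])" using Cons by simp
    also have "\<dots> = - pt rot ang (y # z # r) + turn rot ang z y x"
      using pt_append[of rot ang "rev r" z y "[x]"] IH by simp
    finally show ?thesis using turn_swap(1)[OF e] Cons by simp
  qed simp
qed simp_all

lemma pt_bound:
  assumes "distinct w" "path_edges w \<subseteq> E" shows "\<bar>pt rot ang w\<bar> \<le> int (length w - 2)"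
  using assms
proof (induction w rule: induct_list012)
  case (3 x y zs)
  show ?case
  proof (cases zs)
    case (Cons z r)
    have e: "{x, y} \<in> E" "{y, z} \<in> E" "x \<noteq> z" using "3.prems" Cons by (auto simp: path_edges_Cons)
    have "\<bar>pt rot ang (y # z # r)\<bar> \<le> int (length (y # z # r) - 2)"
      using "3.IH"(2) "3.prems" Cons by (simp add: path_edges_Cons)
    then show ?thesis using turn_swap(2)[OF e] Cons by simp
  qed simp
qed simp_all

text \<open>The cycle runs along one path and returns along the other. Reversal negates the turn of
  the second path, and the two extra terms are the turns at \<open>v\<close> and \<open>u\<close>,
  where the cycle changes from one path to the other.\<close>

theorem two_paths_turn:
  assumes "p \<noteq> []" "q \<noteq> []" "u \<noteq> v"
    and "distinct (u # p @ [v])" "distinct (u # q @ [v])" "set p \<inter> set q = {}"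
    and "path_edges (u # p @ [v]) \<subseteq> E" "path_edges (u # q @ [v]) \<subseteq> E"
  shows "\<bar>pt rot ang (u # p @ [v]) - pt rot ang (u # q @ [v])
    + turn rot ang (last p) v (last q) + turn rot ang (hd q) u (hd p)\<bar> = 4"
proof -
  define c where "c = u # p @ v # rev q"
  obtain hp tp where p: "p = hp # tp" using assms(1) by (cases p) auto
  obtain ip lp where p': "p = ip @ [lp]" using assms(1) by (cases p rule: rev_cases) auto
  obtain hq tq where q: "q = hq # tq" using assms(2) by (cases q) auto
  obtain iq lq where q': "q = iq @ [lq]" using assms(2) by (cases q rule: rev_cases) auto
  have dist: "distinct c" using assms unfolding c_def by auto
  have c0: "c @ [c ! 0, c ! 1] = u # p @ v # rev q @ [u, hp]" by (simp add: c_def p)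
  have cu: "path_edges (c @ [u]) \<subseteq> E"
  proof -
    have "path_edges (c @ [u]) = path_edges (u # p @ [v]) \<union> path_edges (rev (u # q @ [v]))"
      unfolding c_def using path_edges_append[of "u # p" v "rev q @ [u]"] by simp
    then show ?thesis using assms(7,8) unfolding path_edges_rev by simp
  qed
  have "{c ! i, c ! (Suc i mod length c)} \<in> E" if i: "i < length c" for i
  proof (cases "Suc i = length c")
    case True
    then have "c ! (Suc i mod length c) = (c @ [u]) ! Suc i" by (simp add: c_def nth_append)
    then show ?thesis using path_edges_nth[OF cu, of i] i by (simp add: nth_append)
  next
    case False
    then show ?thesis using path_edges_nth[OF cu, of i] i by (simp add: nth_append)
  qed
  then have "\<bar>pt rot ang (c @ [c ! 0, c ! 1])\<bar> = 4"
    using dist by (intro cycle_list_turn) (auto simp: c_def p)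
  moreover have "pt rot ang (c @ [c ! 0, c ! 1])
      = pt rot ang (u # p @ [v]) + turn rot ang lp v lq + pt rot ang (rev (u # q @ [v])) + turn rot ang hq u hp"
  proof -
    have "c @ [c ! 0, c ! 1] = (u # ip) @ lp # v # rev q @ [u, hp]" unfolding c0 by (simp add: p')
    then have "pt rot ang (c @ [c ! 0, c ! 1]) = pt rot ang ((u # ip) @ lp # v # rev q @ [u, hp])"
      by (rule arg_cong)
    also have "\<dots> = pt rot ang (u # p @ [v]) + pt rot ang (lp # v # rev q @ [u, hp])"
      using pt_append[of rot ang "u # ip" lp v "rev q @ [u, hp]"] by (simp add: p')
    also have "pt rot ang (lp # v # rev q @ [u, hp])
        = turn rot ang lp v lq + pt rot ang ((v # rev tq) @ hq # u # [hp])"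
    proof -
      have "rev q = lq # rev iq" by (simp add: q')
      then have "pt rot ang (lp # v # rev q @ [u, hp]) = turn rot ang lp v lq + pt rot ang (v # rev q @ [u, hp])"
        by simp
      then show ?thesis by (simp add: q)
    qed
    also have "pt rot ang ((v # rev tq) @ hq # u # [hp]) = pt rot ang (rev (u # q @ [v])) + turn rot ang hq u hp"
      using pt_append[of rot ang "v # rev tq" hq u "[hp]"] by (simp add: q)
    finally show ?thesis by simp
  qed
  moreover have "pt rot ang (rev (u # q @ [v])) = - pt rot ang (u # q @ [v])"
    by (rule pt_rev) (use assms in auto)
  moreover have "last p = lp" "hd p = hp" "last q = lq" "hd q = hq"
    by (simp add: p', simp add: p, simp add: q', simp add: q)
  ultimately show ?thesis by (simp add: algebra_simps)
qed

text \<open>Four angles of at least 1 with sum 4 are right angles, so the angle between two edges is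
  the number of rotation steps between them. Numbering the edges clockwise from \<open>x0\<close>
  turns the geometry at the vertex into arithmetic modulo 4.\<close>

lemma deg4_positions:
  assumes v: "v \<in> V" and deg: "card (nbrs E v) = 4" and oN: "x0 \<in> nbrs E v"
  obtains pos :: "nat \<Rightarrow> int" where "pos x0 = 0" "inj_on pos (nbrs E v)"
    "\<And>x. x \<in> nbrs E v \<Longrightarrow> pos x \<in> {0..3}"
    "\<And>x y. x \<in> nbrs E v \<Longrightarrow> y \<in> nbrs E v \<Longrightarrow> x \<noteq> y \<Longrightarrow> turn rot ang x v y = (pos y - pos x) mod 4 - 2"
proof -
  let ?N = "nbrs E v" and ?f = "rot v"
  interpret c: cyclic_perm ?N ?f using cyclic[OF v] .
  have ang1: "ang v u = 1" if u: "u \<in> ?N" for u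
  proof -
    have "(\<Sum>w\<in>?N - {u}. 1) \<le> (\<Sum>w\<in>?N - {u}. ang v w)"
      using ang_pos[OF v] by (intro sum_mono) auto
    moreover have "(\<Sum>w\<in>?N - {u}. 1) = (3::nat)" using deg u fin_nbrs[of v] by simp
    moreover have "(\<Sum>w\<in>?N. ang v w) = ang v u + (\<Sum>w\<in>?N - {u}. ang v w)"
      using fin_nbrs u by (rule sum.remove)
    ultimately show ?thesis using ang_sum[OF v] ang_pos[OF v u] by linarith
  qed
  have cw: "cwang rot ang v x y = hit ?f x y" if "x \<in> ?N" "y \<in> ?N" for x y
  proof -
    have "cwang rot ang v x y = (\<Sum>i<hit ?f x y. 1)"
      unfolding cwang_def hit_def using ang1 c.pow_in[OF that(1)] by (intro sum.cong) auto
    then show ?thesis by simp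
  qed
  define idx where "idx = inv_into {..<4} (\<lambda>i. (?f ^^ i) x0)"
  have bij: "inj_on (\<lambda>i. (?f ^^ i) x0) {..<4}" "?N = (\<lambda>i. (?f ^^ i) x0) ` {..<4}"
    using c.pow_inj[OF oN] c.pow_surj[OF oN] deg by simp_all
  have idx: "idx x < 4" "(?f ^^ idx x) x0 = x" if "x \<in> ?N" for x
    using inv_into_into[of x "\<lambda>i. (?f ^^ i) x0" "{..<4}"] f_inv_into_f[of x "\<lambda>i. (?f ^^ i) x0" "{..<4}"]
      that bij(2) by (auto simp: idx_def)
  have o4: "(?f ^^ 4) x0 = x0" using c.pow_card[OF oN] deg by simp
  have hits: "int (hit ?f x y) = (int (idx y) - int (idx x)) mod 4"
    if "x \<in> ?N" "y \<in> ?N" "x \<noteq> y" for x y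
  proof -
    let ?i = "idx x" and ?j = "idx y"
    have ne: "?i \<noteq> ?j" using idx that by metis
    have pw: "(?f ^^ k) x = (?f ^^ (k + ?i)) x0" for k
      using idx(2)[OF that(1)] by (simp add: funpow_add)
    show ?thesis
    proof (cases "?i < ?j")
      case True
      then have "hit ?f x y = ?j - ?i"
        using idx[OF that(1)] idx[OF that(2)] that deg pw[of "?j - ?i"] by (intro c.hit_eqI) auto
      then show ?thesis using True idx(1)[OF that(2)] by simp
    next
      case False
      \<comment> \<open>The sweep passes \<open>x0\<close>, which adds a full turn to the index
        difference.\<close>
      have "(?f ^^ (?j + 4)) x0 = y" using idx(2)[OF that(2)] o4 by (simp add: funpow_add)
      then have "hit ?f x y = ?j + 4 - ?i"
        using False ne idx[OF that(1)] idx[OF that(2)] that deg pw[of "?j + 4 - ?i"] by (intro c.hit_eqI) (auto simp: less_imp_le)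
      moreover have "(int ?j - int ?i) mod 4 = (int ?j - int ?i + 4) mod 4" by simp
      moreover have "\<dots> = int ?j - int ?i + 4"
        using False ne idx(1)[OF that(1)] by (intro mod_pos_pos_trivial) auto
      ultimately show ?thesis using idx(1)[OF that(1)] by simp
    qed
  qed
  show ?thesis
  proof (rule that[of "\<lambda>x. int (idx x)"])
    have "(?f ^^ 0) x0 = x0" by simp
    moreover have "idx ((?f ^^ 0) x0) = 0" unfolding idx_def by (intro inv_into_f_f bij(1)) simp
    ultimately show "int (idx x0) = 0" by simp
    show "inj_on (\<lambda>x. int (idx x)) ?N" using idx(2) by (intro inj_onI) (metis of_nat_eq_iff)
    show "int (idx x) \<in> {0..3}" if "x \<in> ?N" for x using idx(1)[OF that] by simp
    show "turn rot ang x v y = (int (idx y) - int (idx x)) mod 4 - 2"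
      if "x \<in> ?N" "y \<in> ?N" "x \<noteq> y" for x y
      using cw hits that by (simp add: turn_def)
  qed
qed

end

section \<open>Decomposition trees\<close>

text \<open>Connectivity is phrased by cuts, so that disjoint linking edge sets yield distinct edges across a cut.\<close>

definition link :: "nat set set \<Rightarrow> nat \<Rightarrow> nat \<Rightarrow> bool" where
  "link F u v \<longleftrightarrow> (\<forall>S. u \<in> S \<longrightarrow> v \<notin> S \<longrightarrow> (\<exists>x y. x \<in> S \<and> y \<notin> S \<and> {x, y} \<in> F))"

lemma linkD: "link F u v \<Longrightarrow> u \<in> S \<Longrightarrow> v \<notin> S \<Longrightarrow> \<exists>x y. x \<in> S \<and> y \<notin> S \<and> {x, y} \<in> F"
  by (simp add: link_def)

lemma link_refl [simp]: "link F u u"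
  by (simp add: link_def)

lemma link_trans: "link F u v \<Longrightarrow> link F v w \<Longrightarrow> link F u w"
  unfolding link_def by blast

lemma link_sym:
  assumes "link F u v" shows "link F v u"
  unfolding link_def
proof (intro allI impI)
  fix S assume "v \<in> S" "u \<notin> S"
  then obtain x y where "x \<in> - S" "y \<notin> - S" "{x, y} \<in> F" using linkD[OF assms, of "- S"] by auto
  then have "y \<in> S" "x \<notin> S" "{y, x} \<in> F" by (simp_all add: insert_commute)
  then show "\<exists>x y. x \<in> S \<and> y \<notin> S \<and> {x, y} \<in> F" by (intro exI conjI)
qed

lemma link_mono: "link F u v \<Longrightarrow> F \<subseteq> G \<Longrightarrow> link G u v"
  unfolding link_def by (meson subsetD)

lemma link_edge: "link {{u, v}} u v"
  unfolding link_def by (intro allI impI exI[of _ u] exI[of _ v]) simp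

lemma link_path: "p \<noteq> [] \<Longrightarrow> link (path_edges p) (hd p) (last p)"
proof (induction p rule: induct_list012)
  case (3 x y zs)
  have "link (path_edges (x # y # zs)) x y"
    by (rule link_mono[OF link_edge]) (simp add: path_edges_Cons)
  moreover have IH: "link (path_edges (y # zs)) y (last (y # zs))" using "3.IH"(2) by simp
  have "link (path_edges (x # y # zs)) y (last (y # zs))"
    by (rule link_mono[OF IH]) (auto simp: path_edges_Cons)
  ultimately have "link (path_edges (x # y # zs)) x (last (y # zs))" by (rule link_trans)
  then show ?case by simp
qed simp_all

text \<open>The vertices reachable from \<open>u\<close> form a cut; an edge of \<open>F\<close>
  leaving it would extend the reach.\<close>

lemma link_imp_walk:
  assumes "link F u v" "u \<in> W" and W: "\<And>x y. {x, y} \<in> F \<Longrightarrow> x \<in> W"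
  shows "(\<lambda>x y. {x, y} \<in> F \<and> x \<in> W \<and> y \<in> W)\<^sup>*\<^sup>* u v"
proof (rule ccontr)
  let ?r = "\<lambda>x y. {x, y} \<in> F \<and> x \<in> W \<and> y \<in> W"
  assume "\<not> ?r\<^sup>*\<^sup>* u v"
  then obtain x y where xy: "?r\<^sup>*\<^sup>* u x" "\<not> ?r\<^sup>*\<^sup>* u y" "{x, y} \<in> F"
    using linkD[OF assms(1), of "{x. ?r\<^sup>*\<^sup>* u x}"] by auto
  then have "?r x y" using W[of x y] W[of y x] by (auto simp: insert_commute)
  then show False using xy(1,2) by (metis (no_types, lifting) rtranclp.rtrancl_into_rtrancl)
qed

definition tree_ok :: "nat set \<Rightarrow> nat set set \<Rightarrow> dtree \<Rightarrow> bool" where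
  "tree_ok V E T \<longleftrightarrow> (\<forall>t\<in>nodes T. local_ok V E t)"

lemma self_node [simp]: "t \<in> nodes t"
  by (cases t) auto

lemma tree_okD: "tree_ok V E t \<Longrightarrow> local_ok V E t"
  by (simp add: tree_ok_def)

lemma tree_ok_child:
  "tree_ok V E (SN u v ts) \<Longrightarrow> c \<in> set ts \<Longrightarrow> tree_ok V E c"
  "tree_ok V E (PN u v ts) \<Longrightarrow> c \<in> set ts \<Longrightarrow> tree_ok V E c"
  by (auto simp: tree_ok_def)

lemma tree_ok_node: "tree_ok V E t \<Longrightarrow> n \<in> nodes t \<Longrightarrow> tree_ok V E n"
proof (induction t)
  case (QN p)
  then show ?case by simp
next
  case (SN u v ts)
  show ?case
  proof (cases "n = SN u v ts")
    case False
    then obtain c where "c \<in> set ts" "n \<in> nodes c" using SN.prems by auto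
    then show ?thesis using SN.IH SN.prems tree_ok_child by blast
  qed (use SN in simp)
next
  case (PN u v ts)
  show ?case
  proof (cases "n = PN u v ts")
    case False
    then obtain c where "c \<in> set ts" "n \<in> nodes c" using PN.prems by auto
    then show ?thesis using PN.IH PN.prems tree_ok_child by blast
  qed (use PN in simp)
qed

lemma node_vts: "n \<in> nodes t \<Longrightarrow> vts n \<subseteq> vts t"
  by (induction t) auto

lemma S_ok:
  assumes "local_ok V E (SN u v ts)"
  shows "length ts \<ge> 2" "u \<noteq> v" "c \<in> set ts \<Longrightarrow> \<not> is_S c"
    "fst (poles (ts ! 0)) = u" "snd (poles (ts ! (length ts - 1))) = v"
    "Suc i < length ts \<Longrightarrow> snd (poles (ts ! i)) = fst (poles (ts ! Suc i))"
    "i < j \<Longrightarrow> j < length ts \<Longrightarrow>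
      vts (ts ! i) \<inter> vts (ts ! j) = (if j = Suc i then {snd (poles (ts ! i))} else {})"
proof -
  have "length ts \<ge> 2" using assms by (simp add: local_ok_def)
  then have "ts \<noteq> []" by auto
  then show "length ts \<ge> 2" "u \<noteq> v" "c \<in> set ts \<Longrightarrow> \<not> is_S c"
    "fst (poles (ts ! 0)) = u" "snd (poles (ts ! (length ts - 1))) = v"
    "Suc i < length ts \<Longrightarrow> snd (poles (ts ! i)) = fst (poles (ts ! Suc i))"
    "i < j \<Longrightarrow> j < length ts \<Longrightarrow>
      vts (ts ! i) \<inter> vts (ts ! j) = (if j = Suc i then {snd (poles (ts ! i))} else {})"
    using assms by (simp_all add: local_ok_def hd_conv_nth last_conv_nth)
qed

lemma P_ok:
  assumes "local_ok V E (PN u v ts)"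
  shows "length ts \<ge> 2" "u \<noteq> v" "c \<in> set ts \<Longrightarrow> \<not> is_P c" "c \<in> set ts \<Longrightarrow> poles c = (u, v)"
    "i < j \<Longrightarrow> j < length ts \<Longrightarrow> vts (ts ! i) \<inter> vts (ts ! j) = {u, v}"
    "i < j \<Longrightarrow> j < length ts \<Longrightarrow> eds (ts ! i) \<inter> eds (ts ! j) = {}"
  using assms by (simp_all add: local_ok_def)

lemma Q_ok:
  assumes "local_ok V E (QN p)"
  shows "length p \<ge> 2" "distinct p" "p \<noteq> []" "hd p \<noteq> last p" "set p \<subseteq> V" "path_edges p \<subseteq> E"
proof -
  have *: "is_chain V E p" using assms by (simp add: local_ok_def)
  then show "length p \<ge> 2" "distinct p" "set p \<subseteq> V" "path_edges p \<subseteq> E" by (auto simp: is_chain_def)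
  then show "p \<noteq> []" by auto
  show "hd p \<noteq> last p"
    using \<open>length p \<ge> 2\<close> \<open>distinct p\<close> by (cases p) auto
qed

lemma two_children:
  assumes "2 \<le> length ts"
  shows "ts ! 0 \<in> set ts" "ts ! 1 \<in> set ts" "ts ! (length ts - 1) \<in> set ts" "0 < length ts"
  using assms by (auto intro!: nth_mem simp del: length_greater_0_conv)

lemma tree_poles:
  "tree_ok V E t \<Longrightarrow> fst (poles t) \<in> vts t \<and> snd (poles t) \<in> vts t \<and> fst (poles t) \<noteq> snd (poles t)"
proof (induction t)
  case (QN p)
  then show ?case using Q_ok[of V E p] tree_okD by auto
next
  case (SN u v ts)
  note ok = S_ok[OF tree_okD[OF SN.prems]]
  have "ts ! 0 \<in> set ts" "ts ! (length ts - 1) \<in> set ts" using two_children[OF ok(1)] by blast+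
  then show ?case
    using SN.IH[OF _ tree_ok_child(1)[OF SN.prems]] ok(2,4,5) by fastforce
next
  case (PN u v ts)
  note ok = P_ok[OF tree_okD[OF PN.prems]]
  have "ts ! 0 \<in> set ts" using two_children[OF ok(1)] by blast
  then show ?case
    using PN.IH[OF _ tree_ok_child(2)[OF PN.prems]] ok(2,4) by fastforce
qed

lemma tree_edges: "tree_ok V E t \<Longrightarrow> eds t \<subseteq> E \<and> vts t \<subseteq> V \<and> \<Union> (eds t) \<subseteq> vts t"
proof (induction t)
  case (QN p)
  have "\<Union> (path_edges p) \<subseteq> set p" by (auto simp: path_edges_def)
  then show ?case using Q_ok[of V E p] tree_okD[OF QN.prems] by simp
next
  case (SN u v ts)
  have "eds c \<subseteq> E \<and> vts c \<subseteq> V \<and> \<Union> (eds c) \<subseteq> vts c" if "c \<in> set ts" for c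
    using SN.IH[OF that tree_ok_child(1)[OF SN.prems that]] .
  then show ?case by auto blast+
next
  case (PN u v ts)
  have "eds c \<subseteq> E \<and> vts c \<subseteq> V \<and> \<Union> (eds c) \<subseteq> vts c" if "c \<in> set ts" for c
    using PN.IH[OF that tree_ok_child(2)[OF PN.prems that]] .
  then show ?case by auto blast+
qed

text \<open>The links use only the children before, or only those after, the one with index
  \<open>i\<close>. That child is kept free because these links are to run outside it.\<close>

lemma S_links:
  assumes ok: "local_ok V E (SN u v ts)"
    and IH: "\<And>c. c \<in> set ts \<Longrightarrow> link (eds c) (fst (poles c)) (snd (poles c))"
  shows "i < length ts \<Longrightarrow> link (\<Union>j<i. eds (ts ! j)) u (fst (poles (ts ! i)))"
    and "i < length ts \<Longrightarrow> link (\<Union>j\<in>{i<..<length ts}. eds (ts ! j)) (snd (poles (ts ! i))) v"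
proof -
  note S = S_ok[OF ok]
  show "i < length ts \<Longrightarrow> link (\<Union>j<i. eds (ts ! j)) u (fst (poles (ts ! i)))"
  proof (induction i)
    case 0
    then show ?case using S(4) by simp
  next
    case (Suc i)
    have "link (\<Union>j<Suc i. eds (ts ! j)) u (fst (poles (ts ! i)))"
      by (rule link_mono[OF Suc.IH]) (use Suc.prems in simp, rule UN_mono, auto)
    moreover have "link (\<Union>j<Suc i. eds (ts ! j)) (fst (poles (ts ! i))) (snd (poles (ts ! i)))"
      using Suc.prems by (intro link_mono[OF IH]) auto
    ultimately show ?case unfolding S(6)[OF Suc.prems, symmetric] by (rule link_trans)
  qed
  have "link (\<Union>j\<in>{length ts - 1 - k<..<length ts}. eds (ts ! j)) (snd (poles (ts ! (length ts - 1 - k)))) v"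
    if "k < length ts" for k
    using that
  proof (induction k)
    case 0
    then show ?case using S(5) by simp
  next
    case (Suc k)
    let ?i = "length ts - 1 - Suc k"
    have i: "Suc ?i = length ts - 1 - k" "Suc ?i < length ts" using Suc.prems by auto
    let ?U = "\<Union>j\<in>{?i<..<length ts}. eds (ts ! j)"
    have "link ?U (fst (poles (ts ! Suc ?i))) (snd (poles (ts ! Suc ?i)))"
      by (intro link_mono[OF IH] UN_upper) (use i in auto)
    moreover have "link ?U (snd (poles (ts ! Suc ?i))) v"
      unfolding i(1) by (rule link_mono[OF Suc.IH]) (use Suc.prems in simp, rule UN_mono, auto)
    ultimately show ?case unfolding S(6)[OF i(2)] by (rule link_trans)
  qed
  from this[of "length ts - 1 - i"]
  show "i < length ts \<Longrightarrow> link (\<Union>j\<in>{i<..<length ts}. eds (ts ! j)) (snd (poles (ts ! i))) v"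
    by simp
qed

lemma pole_link: "tree_ok V E t \<Longrightarrow> link (eds t) (fst (poles t)) (snd (poles t))"
proof (induction t)
  case (QN p)
  then show ?case using Q_ok[of V E p] tree_okD link_path by auto
next
  case (SN u v ts)
  note S = S_ok[OF tree_okD[OF SN.prems]]
  have IH: "link (eds c) (fst (poles c)) (snd (poles c))" if "c \<in> set ts" for c
    using SN.IH[OF that tree_ok_child(1)[OF SN.prems that]] .
  have in0: "ts ! 0 \<in> set ts" "0 < length ts" using two_children[OF S(1)] by blast+
  have "link (\<Union>j\<in>{0<..<length ts}. eds (ts ! j)) (snd (poles (ts ! 0))) v"
    by (rule S_links(2)[OF tree_okD[OF SN.prems] IH in0(2)])
  then have "link (eds (SN u v ts)) (snd (poles (ts ! 0))) v" by (rule link_mono) (auto intro: bexI[OF _ nth_mem])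
  moreover have l0: "link (eds (ts ! 0)) u (snd (poles (ts ! 0)))" using IH[OF in0(1)] S(4) by simp
  have "link (eds (SN u v ts)) u (snd (poles (ts ! 0)))"
    by (rule link_mono[OF l0]) (use in0(1) in auto)
  ultimately show ?case using link_trans by fastforce
next
  case (PN u v ts)
  note P = P_ok[OF tree_okD[OF PN.prems]]
  have in0: "ts ! 0 \<in> set ts" using two_children[OF P(1)] by blast
  have "link (eds (ts ! 0)) u v"
    using PN.IH[OF in0 tree_ok_child(2)[OF PN.prems in0]] P(4)[OF in0] by simp
  then show ?case using in0 by (auto intro: link_mono)
qed

text \<open>For parallel children this is part of \<open>local_ok\<close>; in a series it follows,
  since two children share at most one vertex while an edge has two.\<close>

lemma S_child_edges_disjoint:
  assumes sg: "simple_graph V E" and ok: "tree_ok V E (SN u v ts)"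
    and ij: "i < length ts" "j < length ts" "i \<noteq> j"
  shows "eds (ts ! i) \<inter> eds (ts ! j) = {}"
proof (rule ccontr)
  note S = S_ok[OF tree_okD[OF ok]]
  assume "eds (ts ! i) \<inter> eds (ts ! j) \<noteq> {}"
  then obtain e where e: "e \<in> eds (ts ! i)" "e \<in> eds (ts ! j)" by blast
  note te = tree_edges[OF tree_ok_child(1)[OF ok nth_mem[OF ij(1)]]]
    tree_edges[OF tree_ok_child(1)[OF ok nth_mem[OF ij(2)]]]
  have "\<exists>a b. e = {a, b} \<and> a \<noteq> b"
    using te(1) e(1) sg unfolding simple_graph_def by (meson subsetD)
  then obtain a b where ab: "e = {a, b}" "a \<noteq> b" by blast
  have sub: "{a, b} \<subseteq> vts (ts ! i) \<inter> vts (ts ! j)" using te e ab(1) by blast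
  have "\<exists>w. vts (ts ! i) \<inter> vts (ts ! j) \<subseteq> {w}"
  proof (cases "i < j")
    case True
    then show ?thesis using S(7)[OF True ij(2)] by (cases "j = Suc i") auto
  next
    case False
    then show ?thesis using S(7)[of j i] ij by (cases "i = Suc j") auto
  qed
  then show False using sub ab(2) by auto
qed

text \<open>The edge set \<open>K\<close> stands for the surroundings of the current tree.
  Descending into a series, it absorbs the siblings, which join the poles of the child to those of
  the series; below a parallel node it stays as it is, because the children have the same
  poles.\<close>

lemma outside_link:
  assumes sg: "simple_graph V E"
  shows "tree_ok V E T \<Longrightarrow> link K (fst (poles T)) (snd (poles T)) \<Longrightarrow> K \<inter> eds T = {} \<Longrightarrow> t \<in> nodes T \<Longrightarrow>
    \<exists>L. link L (fst (poles t)) (snd (poles t)) \<and> L \<inter> eds t = {} \<and> L \<subseteq> K \<union> eds T"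
proof (induction T arbitrary: K)
  case (QN p)
  then show ?case by auto
next
  case (SN u v ts)
  show ?case
  proof (cases "t = SN u v ts")
    case True
    then show ?thesis using SN.prems by blast
  next
    case False
    then obtain c where c: "c \<in> set ts" "t \<in> nodes c" using SN.prems by auto
    then obtain i where i: "i < length ts" "c = ts ! i" by (auto simp: in_set_conv_nth)
    let ?M = "K \<union> (\<Union>j\<in>{..<length ts} - {i}. eds (ts ! j))"
    have okc: "tree_ok V E c" by (rule tree_ok_child(1)[OF SN.prems(1) c(1)])
    note lnk = S_links[OF tree_okD[OF SN.prems(1)] pole_link[OF tree_ok_child(1)[OF SN.prems(1)]] i(1)]
    have "link ?M (fst (poles c)) u"
      unfolding i(2) by (rule link_sym, rule link_mono[OF lnk(1)]) (use i in auto)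
    moreover have "link ?M u v" using SN.prems(2) by (auto intro: link_mono)
    moreover have "link ?M v (snd (poles c))"
      unfolding i(2) by (rule link_sym, rule link_mono[OF lnk(2)]) auto
    ultimately have "link ?M (fst (poles c)) (snd (poles c))" using link_trans by blast
    moreover have "?M \<inter> eds c = {}"
    proof -
      have "K \<inter> eds c = {}" using SN.prems(3) c(1) by auto
      then show ?thesis
        unfolding i(2) using S_child_edges_disjoint[OF sg SN.prems(1) _ i(1)] by fastforce
    qed
    ultimately obtain L where L: "link L (fst (poles t)) (snd (poles t))" "L \<inter> eds t = {}" "L \<subseteq> ?M \<union> eds c"
      using SN.IH[OF c(1) okc _ _ c(2)] by blast
    have sub: "eds (ts ! j) \<subseteq> K \<union> eds (SN u v ts)" if "j < length ts" for j
      using nth_mem[OF that] by auto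
    have "?M \<union> eds c \<subseteq> K \<union> eds (SN u v ts)"
      unfolding i(2) by (intro Un_least UN_least) (rule Un_upper1, (rule sub, simp add: i(1))+)
    with L(3) have "L \<subseteq> K \<union> eds (SN u v ts)" by (rule subset_trans)
    with L(1,2) show ?thesis by (intro exI[of _ L] conjI)
  qed
next
  case (PN u v ts)
  show ?case
  proof (cases "t = PN u v ts")
    case True
    then show ?thesis using PN.prems by blast
  next
    case False
    then obtain c where c: "c \<in> set ts" "t \<in> nodes c" using PN.prems by auto
    have okc: "tree_ok V E c" by (rule tree_ok_child(2)[OF PN.prems(1) c(1)])
    have pc: "poles c = (u, v)" by (rule P_ok(4)[OF tree_okD[OF PN.prems(1)] c(1)])
    have sub: "eds c \<subseteq> eds (PN u v ts)" using c(1) by auto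
    have "\<exists>L. link L (fst (poles t)) (snd (poles t)) \<and> L \<inter> eds t = {} \<and> L \<subseteq> K \<union> eds c"
      using PN.prems(2,3) sub pc by (intro PN.IH[OF c(1) okc _ _ c(2)]) auto
    then show ?thesis using sub by blast
  qed
qed

text \<open>Two children and the surroundings of a P-node link its poles by pairwise disjoint edge
  sets, and a cut between the poles takes an edge from each.\<close>

lemma P_node_cut:
  assumes sg: "simple_graph V E" and rd: "rooted_decomp V E \<rho> T" and t: "PN u v ts \<in> nodes T"
    and S: "(u \<in> S) \<noteq> (v \<in> S)"
  shows "3 \<le> card {e \<in> E. \<exists>x y. e = {x, y} \<and> x \<in> S \<and> y \<notin> S}"
proof -
  have ok: "tree_ok V E T" "is_chain V E \<rho>" and poles: "poles T = (hd \<rho>, last \<rho>)"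
    and eds: "eds T \<union> path_edges \<rho> = E" "eds T \<inter> path_edges \<rho> = {}"
    using rd by (auto simp: rooted_decomp_def tree_ok_def)
  have "\<rho> \<noteq> []" using ok(2) by (auto simp: is_chain_def)
  then have "link (path_edges \<rho>) (fst (poles T)) (snd (poles T))" using link_path poles by simp
  then obtain L where L: "link L u v" "L \<inter> eds (PN u v ts) = {}" "L \<subseteq> path_edges \<rho> \<union> eds T"
    using outside_link[OF sg ok(1) _ _ t, of "path_edges \<rho>"] eds(2) by (auto simp: Int_commute)
  have okt: "tree_ok V E (PN u v ts)" by (rule tree_ok_node[OF ok(1) t])
  note P = P_ok[OF tree_okD[OF okt]]
  have in01: "ts ! 0 \<in> set ts" "ts ! 1 \<in> set ts" using two_children[OF P(1)] by blast+
  have l01: "link (eds (ts ! 0)) u v" "link (eds (ts ! 1)) u v"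
    using pole_link[OF tree_ok_child(2)[OF okt in01(1)]] pole_link[OF tree_ok_child(2)[OF okt in01(2)]]
      P(4)[OF in01(1)] P(4)[OF in01(2)] by simp_all
  have cross: "\<exists>e\<in>F. \<exists>x y. e = {x, y} \<and> x \<in> S \<and> y \<notin> S" if "link F u v" for F
    using S linkD[OF that, of S] linkD[OF link_sym[OF that], of S] by blast
  obtain e0 e1 e2 where e: "e0 \<in> eds (ts ! 0)" "e1 \<in> eds (ts ! 1)" "e2 \<in> L"
    "\<exists>x y. e0 = {x, y} \<and> x \<in> S \<and> y \<notin> S" "\<exists>x y. e1 = {x, y} \<and> x \<in> S \<and> y \<notin> S"
    "\<exists>x y. e2 = {x, y} \<and> x \<in> S \<and> y \<notin> S"
    using cross[OF l01(1)] cross[OF l01(2)] cross[OF L(1)] by blast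
  have sub: "eds (ts ! 0) \<subseteq> eds (PN u v ts)" "eds (ts ! 1) \<subseteq> eds (PN u v ts)" using in01 by auto
  have "eds (ts ! 0) \<inter> eds (ts ! 1) = {}" using P(6)[of 0 1] P(1) by simp
  then have dist: "e0 \<noteq> e1" "e0 \<noteq> e2" "e1 \<noteq> e2" using e(1-3) L(2) sub by blast+
  have "eds (PN u v ts) \<subseteq> E" using tree_edges[OF okt] by blast
  then have inE: "e0 \<in> E" "e1 \<in> E" "e2 \<in> E" using e(1-3) sub L(3) eds(1) by blast+
  have "card {e0, e1, e2} = 3" using dist by simp
  moreover have "{e0, e1, e2} \<subseteq> {e \<in> E. \<exists>x y. e = {x, y} \<and> x \<in> S \<and> y \<notin> S}" using e inE by simp
  moreover have "finite {e \<in> E. \<exists>x y. e = {x, y} \<and> x \<in> S \<and> y \<notin> S}"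
    using simple_graph_finite(2)[OF sg] by simp
  ultimately show ?thesis by (metis (no_types, lifting) card_mono)
qed

text \<open>A child containing both poles must be the first. The last child then shares
  \<open>v\<close> with it, so it comes directly after and begins at \<open>v\<close>, although it
  also ends there.\<close>

lemma S_child_poles:
  assumes ok: "tree_ok V E (SN u v ts)" and c: "c \<in> set ts"
  shows "\<not> (u \<in> vts c \<and> v \<in> vts c)"
proof
  assume uv: "u \<in> vts c \<and> v \<in> vts c"
  note S = S_ok[OF tree_okD[OF ok]]
  obtain i where i: "i < length ts" "c = ts ! i" using c by (auto simp: in_set_conv_nth)
  have n: "length ts - 1 < length ts" "0 < length ts" using two_children[OF S(1)] by auto
  note tp = tree_poles[OF tree_ok_child(1)[OF ok nth_mem]]
  have u0: "u \<in> vts (ts ! 0)" and vl: "v \<in> vts (ts ! (length ts - 1))"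
    using tp[OF n(2)] tp[OF n(1)] S(4,5) by auto
  have i0: "i = 0"
  proof (rule ccontr)
    assume "i \<noteq> 0"
    then have "u \<in> (if i = Suc 0 then {snd (poles (ts ! 0))} else {})"
      using S(7)[of 0 i] i u0 uv by blast
    then have "u = snd (poles (ts ! 0))" by (auto split: if_splits)
    then show False using tp[OF n(2)] S(4) by simp
  qed
  have "0 < length ts - 1" using S(1) by simp
  then have "v \<in> (if length ts - 1 = Suc 0 then {snd (poles (ts ! 0))} else {})"
    using S(7)[of 0 "length ts - 1"] n vl uv i i0 by blast
  then have "v = snd (poles (ts ! 0))" "length ts - 1 = Suc 0" by (auto split: if_splits)
  then have "v = fst (poles (ts ! (length ts - 1)))" using S(6)[of 0] n by simp
  then show False using tp[OF n(1)] S(5) by simp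
qed

text \<open>A P-node strictly below another one hangs below a series with the same poles, hence
  inside a single child of that series.\<close>

lemma P_proper_descendant:
  assumes ok: "tree_ok V E (PN u v ts)" and c: "c \<in> set ts" and n: "n \<in> nodes c" "is_P n"
  shows "\<not> (u \<in> vts n \<and> v \<in> vts n)"
proof (cases c)
  case (QN p)
  then show ?thesis using n by auto
next
  case (SN a b ss)
  have "a = u" "b = v" using P_ok(4)[OF tree_okD[OF ok] c] SN by simp_all
  moreover obtain d where d: "d \<in> set ss" "n \<in> nodes d" using n SN by auto
  moreover have "\<not> (a \<in> vts d \<and> b \<in> vts d)"
    using S_child_poles tree_ok_child(2)[OF ok c] SN d(1) by metis
  ultimately show ?thesis using node_vts[OF d(2)] by blast
next
  case (PN a b ss)
  then show ?thesis using P_ok(3)[OF tree_okD[OF ok] c] by simp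
qed

text \<open>Two P-nodes with the same poles in different children require two common vertices.
  Children of a series share at most one; children of a parallel node share just \<open>u\<close>
  and \<open>v\<close>, which \<open>P_proper_descendant\<close> excludes as poles further
  down.\<close>

lemma P_nodes_unique:
  "tree_ok V E T \<Longrightarrow> t1 \<in> nodes T \<Longrightarrow> t2 \<in> nodes T \<Longrightarrow> is_P t1 \<Longrightarrow> is_P t2 \<Longrightarrow>
    {fst (poles t1), snd (poles t1)} = {fst (poles t2), snd (poles t2)} \<Longrightarrow> t1 = t2"
proof (induction T)
  case (QN p)
  then show ?case by simp
next
  case (SN u v ts)
  obtain c1 c2 where c: "c1 \<in> set ts" "t1 \<in> nodes c1" "c2 \<in> set ts" "t2 \<in> nodes c2"
    using SN.prems by auto
  obtain i j where ij: "i < length ts" "c1 = ts ! i" "j < length ts" "c2 = ts ! j"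
    using c by (auto simp: in_set_conv_nth)
  show ?case
  proof (cases "i = j")
    case True
    then show ?thesis
      using SN.IH[OF c(1) tree_ok_child(1)[OF SN.prems(1) c(1)] c(2)] SN.prems(4-6) c(4) ij(2,4) by blast
  next
    case False
    note S = S_ok[OF tree_okD[OF SN.prems(1)]]
    have "\<exists>w. vts (ts ! i) \<inter> vts (ts ! j) \<subseteq> {w}"
    proof (cases "i < j")
      case True
      then show ?thesis using S(7)[OF True ij(3)] by (cases "j = Suc i") auto
    next
      case False
      then show ?thesis using S(7)[of j i] ij \<open>i \<noteq> j\<close> by (cases "i = Suc j") auto
    qed
    moreover have "{fst (poles t1), snd (poles t1)} \<subseteq> vts (ts ! i) \<inter> vts (ts ! j)"
    proof -
      note ok1 = tree_ok_node[OF SN.prems(1,2)] and ok2 = tree_ok_node[OF SN.prems(1,3)]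
      have "{fst (poles t1), snd (poles t1)} \<subseteq> vts c1" using tree_poles[OF ok1] node_vts[OF c(2)] by auto
      moreover have "{fst (poles t2), snd (poles t2)} \<subseteq> vts c2" using tree_poles[OF ok2] node_vts[OF c(4)] by auto
      ultimately show ?thesis using SN.prems(6) ij by simp
    qed
    moreover have "fst (poles t1) \<noteq> snd (poles t1)" using tree_poles[OF tree_ok_node[OF SN.prems(1,2)]] by blast
    ultimately show ?thesis by auto
  qed
next
  case (PN u v ts)
  have desc: "\<not> (u \<in> vts n \<and> v \<in> vts n)" if "c \<in> set ts" "n \<in> nodes c" "is_P n" for c n
    using P_proper_descendant[OF PN.prems(1)] that by blast
  have pv: "fst (poles t1) \<in> vts t1 \<and> snd (poles t1) \<in> vts t1" "fst (poles t2) \<in> vts t2 \<and> snd (poles t2) \<in> vts t2"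
    "fst (poles t1) \<noteq> snd (poles t1)"
    using tree_poles[OF tree_ok_node[OF PN.prems(1,2)]] tree_poles[OF tree_ok_node[OF PN.prems(1,3)]] by auto
  consider "t1 = PN u v ts" "t2 = PN u v ts"
    | c where "c \<in> set ts" "t2 \<in> nodes c" "t1 = PN u v ts"
    | c where "c \<in> set ts" "t1 \<in> nodes c" "t2 = PN u v ts"
    | c1 c2 where "c1 \<in> set ts" "t1 \<in> nodes c1" "c2 \<in> set ts" "t2 \<in> nodes c2"
    using PN.prems(2,3) by auto
  then show ?case
  proof cases
    case (2 c)
    then have "{u, v} = {fst (poles t2), snd (poles t2)}" using PN.prems(6) by simp
    then show ?thesis using desc[OF 2(1,2) PN.prems(5)] pv(2) by (auto simp: doubleton_eq_iff)
  next
    case (3 c)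
    then have "{u, v} = {fst (poles t1), snd (poles t1)}" using PN.prems(6) by simp
    then show ?thesis using desc[OF 3(1,2) PN.prems(4)] pv(1) by (auto simp: doubleton_eq_iff)
  next
    case (4 c1 c2)
    show ?thesis
    proof (cases "c1 = c2")
      case True
      then show ?thesis
        using PN.IH[OF 4(1) tree_ok_child(2)[OF PN.prems(1) 4(1)] 4(2)] PN.prems(4-6) 4(4) by blast
    next
      case False
      obtain i j where ij: "i < length ts" "c1 = ts ! i" "j < length ts" "c2 = ts ! j" "i \<noteq> j"
        using 4 False by (auto simp: in_set_conv_nth)
      have "vts c1 \<inter> vts c2 = {u, v}"
        using P_ok(5)[OF tree_okD[OF PN.prems(1)], of i j] P_ok(5)[OF tree_okD[OF PN.prems(1)], of j i] ij
        by (cases "i < j") auto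
      moreover have "{fst (poles t1), snd (poles t1)} \<subseteq> vts c1" using pv(1) node_vts[OF 4(2)] by auto
      moreover have "{fst (poles t1), snd (poles t1)} \<subseteq> vts c2"
        unfolding PN.prems(6) using pv(2) node_vts[OF 4(4)] by auto
      ultimately have "{fst (poles t1), snd (poles t1)} \<subseteq> {u, v}" by (metis Int_greatest)
      then have "{fst (poles t1), snd (poles t1)} = {u, v}" using pv(3) by auto
      then show ?thesis using desc[OF 4(1,2) PN.prems(4)] pv(1) by (auto simp: doubleton_eq_iff)
    qed
  qed simp
qed

section \<open>Biconnectivity from a decomposition\<close>

definition avoid :: "nat \<Rightarrow> nat set set \<Rightarrow> nat set set" where
  "avoid x F = {e \<in> F. x \<notin> e}"

lemma avoid_mono: "F \<subseteq> G \<Longrightarrow> avoid x F \<subseteq> avoid x G"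
  by (auto simp: avoid_def)

lemma avoid_tree:
  assumes "tree_ok V E t" "x \<notin> vts t" shows "avoid x (eds t) = eds t"
  using tree_edges[OF assms(1)] assms(2) by (auto simp: avoid_def)

lemma path_edges_sub: "e \<in> path_edges p \<Longrightarrow> e \<subseteq> set p"
  by (auto simp: path_edges_def)

lemma avoid_path: "x \<notin> set p \<Longrightarrow> path_edges p \<subseteq> avoid x (path_edges p)"
  using path_edges_sub by (auto simp: avoid_def)

text \<open>In a series, leave the child through the pole that was reached and go on to the
  corresponding end. If \<open>x\<close> blocks that way, it lies neither in the child itself nor on
  the other side, so the child can be crossed and the other end is reached.\<close>

lemma avoid_to_pole:
  "tree_ok V E t \<Longrightarrow> w \<in> vts t \<Longrightarrow> w \<noteq> x \<Longrightarrow>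
    \<exists>z\<in>{fst (poles t), snd (poles t)}. z \<noteq> x \<and> link (avoid x (eds t)) w z"
proof (induction t)
  case (QN p)
  have dist: "distinct p" "p \<noteq> []" using Q_ok[OF tree_okD[OF QN.prems(1)]] by blast+
  obtain xs ys where p: "p = xs @ w # ys" using QN.prems(2) by (auto simp: in_set_conv_decomp)
  have pe: "path_edges p = path_edges (xs @ [w]) \<union> path_edges (w # ys)" unfolding p by (rule path_edges_append)
  show ?case
  proof (cases "x \<in> set xs")
    case True
    then have x: "x \<notin> set (w # ys)" using dist p by auto
    have "path_edges (w # ys) \<subseteq> avoid x (path_edges p)"
      using avoid_path[OF x] pe by (auto simp: avoid_def)
    then have "link (avoid x (path_edges p)) w (last (w # ys))"
      using link_path[of "w # ys"] link_mono by fastforce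
    moreover have "last (w # ys) = last p" by (simp add: p)
    moreover have "last (w # ys) \<noteq> x" using x last_in_set[of "w # ys"] by auto
    ultimately show ?thesis by auto
  next
    case False
    then have x: "x \<notin> set (xs @ [w])" using QN.prems(3) by simp
    have "path_edges (xs @ [w]) \<subseteq> avoid x (path_edges p)"
      using avoid_path[OF x] pe by (auto simp: avoid_def)
    moreover have "link (path_edges (xs @ [w])) w (hd (xs @ [w]))"
      using link_sym[OF link_path[of "xs @ [w]"]] by simp
    ultimately have "link (avoid x (path_edges p)) w (hd (xs @ [w]))" using link_mono by blast
    moreover have "hd (xs @ [w]) = hd p" by (cases xs) (auto simp: p)
    moreover have "hd (xs @ [w]) \<noteq> x" using x hd_in_set[of "xs @ [w]"] by auto
    ultimately show ?thesis by auto
  qed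
next
  case (SN u v ts)
  note S = S_ok[OF tree_okD[OF SN.prems(1)]]
  let ?F = "avoid x (eds (SN u v ts))"
  have okc: "tree_ok V E (ts ! j)" if "j < length ts" for j
    using tree_ok_child(1)[OF SN.prems(1) nth_mem[OF that]] .
  have subF: "avoid x (eds (ts ! j)) \<subseteq> ?F" if "j < length ts" for j
    using nth_mem[OF that] by (intro avoid_mono) auto
  have sub: "eds (ts ! j) \<subseteq> ?F" if "j < length ts" "x \<notin> vts (ts ! j)" for j
    using subF[OF that(1)] avoid_tree[OF okc[OF that(1)] that(2)] by simp
  have uv: "u \<in> vts (ts ! 0)" "v \<in> vts (ts ! (length ts - 1))"
    using tree_poles[OF okc, of 0] tree_poles[OF okc, of "length ts - 1"] S(4,5) two_children(4)[OF S(1)] by auto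
  have lnk: "link (eds c) (fst (poles c)) (snd (poles c))" if "c \<in> set ts" for c
    using pole_link[OF tree_ok_child(1)[OF SN.prems(1) that]] .
  note SL = S_links[OF tree_okD[OF SN.prems(1)] lnk]
  have left: "u \<noteq> x \<and> link ?F (fst (poles (ts ! i))) u"
    if i: "i < length ts" and x: "\<And>j. j < i \<Longrightarrow> x \<notin> vts (ts ! j)" and ne: "fst (poles (ts ! i)) \<noteq> x" for i
  proof
    show "u \<noteq> x" using x[of 0] uv(1) ne S(4) by (cases i) auto
    show "link ?F (fst (poles (ts ! i))) u"
      by (rule link_sym, rule link_mono[OF SL(1)[OF _ i]], assumption, intro UN_least sub)
        (use i x in auto)
  qed
  have right: "v \<noteq> x \<and> link ?F (snd (poles (ts ! i))) v"
    if i: "i < length ts" and x: "\<And>j. i < j \<Longrightarrow> j < length ts \<Longrightarrow> x \<notin> vts (ts ! j)"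
      and ne: "snd (poles (ts ! i)) \<noteq> x" for i
  proof
    show "v \<noteq> x"
    proof (cases "i = length ts - 1")
      case False
      then have "i < length ts - 1" "length ts - 1 < length ts" using i by linarith+
      from x[OF this] show ?thesis using uv(2) by auto
    qed (use ne S(5) in simp)
    show "link ?F (snd (poles (ts ! i))) v"
      by (rule link_mono[OF SL(2)[OF _ i]], assumption, intro UN_least sub) (use x in auto)
  qed
  obtain c where "c \<in> set ts" "w \<in> vts c" using SN.prems(2) by auto
  then obtain i where i: "i < length ts" "w \<in> vts (ts ! i)" by (auto simp: in_set_conv_nth)
  obtain z where z: "z \<in> {fst (poles (ts ! i)), snd (poles (ts ! i))}" "z \<noteq> x" "link ?F w z"
    using SN.IH[OF nth_mem[OF i(1)] okc[OF i(1)] i(2) SN.prems(3)] link_mono[OF _ subF[OF i(1)]] by blast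
  \<comment> \<open>A vertex occurs in two children of a series only as the pole shared by
    consecutive ones.\<close>
  have once: False if "j < l" "l < length ts" "x \<in> vts (ts ! j)" "x \<in> vts (ts ! l)"
    "\<not> (l = Suc j \<and> x = snd (poles (ts ! j)))" for j l
  proof -
    have "x \<in> (if l = Suc j then {snd (poles (ts ! j))} else {})" using S(7)[OF that(1,2)] that(3,4) by blast
    then show False using that(5) by (auto split: if_splits)
  qed
  show ?case
  proof (cases "z = fst (poles (ts ! i))")
    case True
    show ?thesis
    proof (cases "\<exists>j<i. x \<in> vts (ts ! j)")
      case False
      then have "u \<noteq> x" "link ?F z u" using left[OF i(1)] z(2) True by auto
      then show ?thesis using link_trans[OF z(3)] by auto
    next
      case T: True
      then obtain j where j: "j < i" "x \<in> vts (ts ! j)" by blast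
      have nx: "x \<notin> vts (ts ! l)" if l: "i \<le> l" "l < length ts" for l
      proof
        assume "x \<in> vts (ts ! l)"
        then have "l = Suc j" "x = snd (poles (ts ! j))" using once[of j l] j l by auto
        moreover from this(1) have "i = Suc j" using j l by linarith
        ultimately show False using S(6)[of j] i(1) z(2) True by auto
      qed
      have p: "snd (poles (ts ! i)) \<noteq> x" using nx[of i] tree_poles[OF okc[OF i(1)]] i(1) by auto
      have "link ?F z (snd (poles (ts ! i)))"
        using link_mono[OF lnk[OF nth_mem[OF i(1)]] sub[OF i(1) nx[OF order.refl i(1)]]] True by simp
      moreover have "v \<noteq> x \<and> link ?F (snd (poles (ts ! i))) v" using right[OF i(1) _ p] nx by auto
      ultimately show ?thesis using link_trans z(3) by (metis fst_conv snd_conv poles.simps(2) insertCI)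
    qed
  next
    case False
    then have z2: "z = snd (poles (ts ! i))" using z(1) by simp
    show ?thesis
    proof (cases "\<exists>j>i. j < length ts \<and> x \<in> vts (ts ! j)")
      case False
      then have "v \<noteq> x" "link ?F z v" using right[OF i(1)] z(2) z2 by auto
      then show ?thesis using link_trans[OF z(3)] by auto
    next
      case T: True
      then obtain j where j: "i < j" "j < length ts" "x \<in> vts (ts ! j)" by blast
      have nx: "x \<notin> vts (ts ! l)" if l: "l \<le> i" for l
      proof
        assume "x \<in> vts (ts ! l)"
        then have "j = Suc l" "x = snd (poles (ts ! l))" using once[of l j] j l by auto
        moreover from this(1) have "i = l" using j l by linarith
        ultimately show False using z(2) z2 by auto
      qed
      have p: "fst (poles (ts ! i)) \<noteq> x" using nx[of i] tree_poles[OF okc[OF i(1)]] by auto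
      have "link ?F z (fst (poles (ts ! i)))"
        using link_sym[OF link_mono[OF lnk[OF nth_mem[OF i(1)]] sub[OF i(1) nx[OF order.refl]]]] z2 by simp
      moreover have "u \<noteq> x \<and> link ?F (fst (poles (ts ! i))) u" using left[OF i(1) _ p] nx by auto
      ultimately show ?thesis using link_trans z(3) by (metis fst_conv poles.simps(2) insertCI)
    qed
  qed
next
  case (PN u v ts)
  obtain c where c: "c \<in> set ts" "w \<in> vts c" using PN.prems(2) by auto
  have pc: "poles c = (u, v)" by (rule P_ok(4)[OF tree_okD[OF PN.prems(1)] c(1)])
  have "avoid x (eds c) \<subseteq> avoid x (eds (PN u v ts))" using c(1) by (intro avoid_mono) auto
  then show ?case
    using PN.IH[OF c(1) tree_ok_child(2)[OF PN.prems(1) c(1)] c(2) PN.prems(3)] pc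
    by (auto intro: link_mono)
qed

text \<open>After the deletion of \<open>x\<close>, every other vertex reaches one of the two common
  poles inside \<open>T\<close> or inside the reference chain. If \<open>x\<close> is no pole, it
  lies in only one of these parts, and the other still joins the poles.\<close>

theorem rooted_decomp_biconnected:
  assumes sg: "simple_graph V E" and rd: "rooted_decomp V E \<rho> T" and c3: "3 \<le> card V"
  shows "biconnected V E"
proof -
  have ok: "tree_ok V E T" "tree_ok V E (QN \<rho>)" and poles: "poles T = (hd \<rho>, last \<rho>)"
    and eds: "eds T \<union> path_edges \<rho> = E" and vts: "vts T \<union> set \<rho> = V" "vts T \<inter> set \<rho> = {hd \<rho>, last \<rho>}"
    using rd by (auto simp: rooted_decomp_def tree_ok_def local_ok_def)
  let ?a = "hd \<rho>" and ?b = "last \<rho>"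
  have main: "connected_graph (V - {x}) {e \<in> E. x \<notin> e}" for x
  proof -
    have E': "{e \<in> E. x \<notin> e} = avoid x E" by (simp add: avoid_def)
    have sT: "avoid x (eds T) \<subseteq> avoid x E" and s\<rho>: "avoid x (path_edges \<rho>) \<subseteq> avoid x E"
      using avoid_mono[of "eds T" E x] avoid_mono[of "path_edges \<rho>" E x] eds by auto
    have to_pole: "\<exists>z\<in>{?a, ?b}. z \<noteq> x \<and> link (avoid x E) w z" if w: "w \<in> V - {x}" for w
    proof (cases "w \<in> vts T")
      case True
      then show ?thesis using avoid_to_pole[OF ok(1) True] w poles link_mono[OF _ sT] by fastforce
    next
      case False
      then have "w \<in> vts (QN \<rho>)" using w vts by auto
      then show ?thesis using avoid_to_pole[OF ok(2)] w link_mono[OF _ s\<rho>] by fastforce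
    qed
    have ab: "link (avoid x E) ?a ?b" if "?a \<noteq> x" "?b \<noteq> x"
    proof (cases "x \<in> vts T")
      case True
      have "x \<notin> set \<rho>"
      proof
        assume "x \<in> set \<rho>"
        then have "x \<in> {?a, ?b}" using True vts(2) by (metis IntI)
        then show False using that by auto
      qed
      then have "avoid x (path_edges \<rho>) = path_edges \<rho>" using avoid_tree[OF ok(2), of x] by simp
      then show ?thesis using pole_link[OF ok(2)] link_mono[OF _ s\<rho>] by simp
    next
      case False
      then show ?thesis using pole_link[OF ok(1)] avoid_tree[OF ok(1) False] link_mono[OF _ sT] poles by simp
    qed
    show ?thesis
      unfolding connected_graph_def E'
    proof (intro ballI)
      fix w w' assume w: "w \<in> V - {x}" "w' \<in> V - {x}"
      obtain z z' where z: "z \<in> {?a, ?b}" "z \<noteq> x" "link (avoid x E) w z"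
        "z' \<in> {?a, ?b}" "z' \<noteq> x" "link (avoid x E) w' z'"
        using to_pole[OF w(1)] to_pole[OF w(2)] by blast
      have "link (avoid x E) z z'"
        using z ab link_sym[OF ab] by auto
      then have "link (avoid x E) w w'" using z link_trans link_sym by meson
      then show "(\<lambda>y z. {y, z} \<in> avoid x E \<and> y \<in> V - {x} \<and> z \<in> V - {x})\<^sup>*\<^sup>* w w'"
        using w(1) simple_graph_edgeD[OF sg] by (intro link_imp_walk) (auto simp: avoid_def)
    qed
  qed
  \<comment> \<open>Deleting a vertex outside \<open>V\<close> deletes nothing, so
    \<open>main\<close> also yields connectivity of the whole graph.\<close>
  obtain x0 where x0: "x0 \<notin> V" using simple_graph_finite(1)[OF sg] ex_new_if_finite infinite_UNIV_nat by blast
  have "{e \<in> E. x0 \<notin> e} = E"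
    using sg x0 unfolding simple_graph_def by fastforce
  then have "connected_graph V E" using main[of x0] x0 by simp
  then show ?thesis using main c3 by (simp add: biconnected_def)
qed

section \<open>The spiralling ladder\<close>

text \<open>Vertices have to be natural numbers. The residue modulo 3 encodes the kind of a vertex
  and \<open>prod_encode\<close> its indices, so that \<open>nl\<close> can decode them
  again.\<close>

definition va :: "nat \<Rightarrow> nat" where "va i = 3 * i"
definition vb :: "nat \<Rightarrow> nat" where "vb i = 3 * i + 1"
definition vx :: "nat \<Rightarrow> nat \<Rightarrow> nat" where "vx k j = 3 * prod_encode (k, j) + 2"

lemma v_simps [simp]:
  "va i = va j \<longleftrightarrow> i = j" "vb i = vb j \<longleftrightarrow> i = j" "vx k i = vx l j \<longleftrightarrow> k = l \<and> i = j"
  "va i \<noteq> vb j" "vb j \<noteq> va i" "va i \<noteq> vx k j" "vx k j \<noteq> va i" "vb i \<noteq> vx k j" "vx k j \<noteq> vb i"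
  unfolding va_def vb_def vx_def by (auto simp: prod_encode_eq) presburger+

text \<open>Chains are numbered along the ladder: 0 at level 0, then \<open>2 * i - 1\<close> and
  \<open>2 * i\<close> at each inner level \<open>i\<close>, and finally \<open>2 * M - 1\<close> at
  level \<open>M\<close>.\<close>

definition lv :: "nat \<Rightarrow> nat" where "lv k = (k + 1) div 2"

lemma lv_simps [simp]: "lv (2 * i) = i" "lv (2 * i + 1) = Suc i" "lv (Suc (2 * i)) = Suc i" "lv 0 = 0"
  "0 < i \<Longrightarrow> lv (2 * i - Suc 0) = i"
  by (auto simp: lv_def)

lemma lv_eq: "lv k = i \<longleftrightarrow> k = 2 * i \<or> (0 < i \<and> k = 2 * i - 1)"
  by (auto simp: lv_def)

locale ladder =
  fixes m :: nat
begin

text \<open>With this value the middle level is \<open>m + 1\<close>, with \<open>m\<close> inner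
  levels on either side, and all turns \<open>s k\<close> are odd, in particular nonzero.\<close>

definition M :: nat where "M = 2 * m + 2"

text \<open>\<open>s k\<close> is the turn of the \<open>k\<close>-th chain in the representation constructed below.\<close>

definition s :: "nat \<Rightarrow> int" where "s k = 2 * int (k div 2) + 1 - int M"

text \<open>The least number of inner vertices that permits the turn \<open>s k\<close>, as each of
  them turns by at most 1.\<close>

definition len :: "nat \<Rightarrow> nat" where "len k = nat \<bar>s k\<bar>"

definition pv :: "nat \<Rightarrow> nat \<Rightarrow> nat" where
  "pv k j = (if j = 0 then va (lv k) else if j \<le> len k then vx k j else vb (lv k))"

definition ch :: "nat \<Rightarrow> nat list" where
  "ch k = map (pv k) [0..<len k + 2]"

definition VV :: "nat set" where
  "VV = va ` {..M} \<union> vb ` {..M} \<union> {vx k j | k j. k < 2 * M \<and> 1 \<le> j \<and> j \<le> len k}"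

definition EE :: "nat set set" where
  "EE = {{va i, va (Suc i)} | i. i < M} \<union> {{vb i, vb (Suc i)} | i. i < M}
      \<union> (\<Union>k<2 * M. path_edges (ch k))"

lemma M_ge: "2 \<le> M" by (simp add: M_def)

lemma s_odd: "odd (s k)" by (simp add: s_def M_def)

lemma len_pos [simp]: "0 < len k" "Suc 0 \<le> len k" "len k \<noteq> 0"
proof -
  have "s k \<noteq> 0" using s_odd[of k] by auto
  then show "0 < len k" by (simp add: len_def)
  then show "Suc 0 \<le> len k" "len k \<noteq> 0" by auto
qed

lemma pv_simps [simp]: "pv k 0 = va (lv k)" "pv k (Suc (len k)) = vb (lv k)"
  "1 \<le> j \<Longrightarrow> j \<le> len k \<Longrightarrow> pv k j = vx k j" "pv k (Suc 0) = vx k (Suc 0)" "pv k (len k) = vx k (len k)"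
  by (auto simp: pv_def)

lemma length_ch [simp]: "length (ch k) = len k + 2"
  by (simp add: ch_def)

lemma ch_nth [simp]: "j < len k + 2 \<Longrightarrow> ch k ! j = pv k j"
  unfolding ch_def by (subst nth_map) (auto simp del: upt_Suc)

lemma hd_ch [simp]: "hd (ch k) = va (lv k)" and last_ch [simp]: "last (ch k) = vb (lv k)"
proof -
  have ne: "ch k \<noteq> []" by (metis length_ch list.size(3) add_is_0 zero_neq_numeral)
  show "hd (ch k) = va (lv k)" using ne by (simp add: hd_conv_nth)
  show "last (ch k) = vb (lv k)" using ne by (simp add: last_conv_nth)
qed

lemma ch_ne [simp]: "ch k \<noteq> []"
  by (metis length_ch list.size(3) add_is_0 zero_neq_numeral)

definition xs :: "nat \<Rightarrow> nat list" where
  "xs k = map (vx k) [1..<len k + 1]"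

lemma ch_eq: "ch k = va (lv k) # xs k @ [vb (lv k)]"
proof (rule nth_equalityI)
  show "length (ch k) = length (va (lv k) # xs k @ [vb (lv k)])" by (simp add: xs_def)
  fix j assume "j < length (ch k)"
  then have j: "j < len k + 2" by simp
  show "ch k ! j = (va (lv k) # xs k @ [vb (lv k)]) ! j"
  proof (cases j)
    case (Suc i)
    then have "i < len k \<or> i = len k" using j by linarith
    then show ?thesis
    proof
      assume "i < len k"
      then show ?thesis using Suc by (simp add: xs_def nth_append del: upt_Suc)
    next
      assume "i = len k"
      then show ?thesis using Suc by (simp add: xs_def nth_append del: upt_Suc)
    qed
  qed simp
qed

lemma set_xs: "set (xs k) = {vx k j | j. 1 \<le> j \<and> j \<le> len k}"
  by (auto simp: xs_def)

lemma xs_props: "xs k \<noteq> []" "distinct (xs k)" "length (xs k) = len k"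
  "hd (xs k) = vx k 1" "last (xs k) = vx k (len k)"
proof -
  show "xs k \<noteq> []" by (simp add: xs_def)
  show "distinct (xs k)" by (auto simp: xs_def distinct_map inj_on_def)
  show "length (xs k) = len k" by (simp add: xs_def)
  show "hd (xs k) = vx k 1" by (simp add: xs_def hd_map del: upt_Suc)
  show "last (xs k) = vx k (len k)" by (simp add: xs_def)
qed

lemma set_ch: "set (ch k) = {va (lv k), vb (lv k)} \<union> set (xs k)"
  by (auto simp: ch_eq)

lemma distinct_ch: "distinct (ch k)"
  using xs_props(2) by (auto simp: ch_eq set_xs)

lemma path_edges_ch: "path_edges (ch k) = {{pv k j, pv k (Suc j)} | j. j \<le> len k}"
proof -
  have "path_edges (ch k) = (\<lambda>j. {ch k ! j, ch k ! Suc j}) ` {j. Suc j < length (ch k)}"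
    by (rule path_edges_image)
  also have "\<dots> = (\<lambda>j. {pv k j, pv k (Suc j)}) ` {j. j \<le> len k}"
    by (rule image_cong) auto
  finally show ?thesis by auto
qed

text \<open>An orientation of the edges, rails towards higher levels and chains from
  \<open>va\<close> to \<open>vb\<close>, which replaces equations between two-element sets by
  equations between ordered pairs.\<close>

definition adj :: "nat \<Rightarrow> nat \<Rightarrow> bool" where
  "adj u v \<longleftrightarrow> (\<exists>i<M. u = va i \<and> v = va (Suc i)) \<or> (\<exists>i<M. u = vb i \<and> v = vb (Suc i))
    \<or> (\<exists>k<2 * M. \<exists>j\<le>len k. u = pv k j \<and> v = pv k (Suc j))"

lemma EE_iff_adj: "e \<in> EE \<longleftrightarrow> (\<exists>u v. adj u v \<and> e = {u, v})"
proof -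
  have 1: "e \<in> {{va i, va (Suc i)} | i. i < M} \<longleftrightarrow> (\<exists>u v. (\<exists>i<M. u = va i \<and> v = va (Suc i)) \<and> e = {u, v})"
    by auto
  have 2: "e \<in> {{vb i, vb (Suc i)} | i. i < M} \<longleftrightarrow> (\<exists>u v. (\<exists>i<M. u = vb i \<and> v = vb (Suc i)) \<and> e = {u, v})"
    by auto
  have 3: "e \<in> (\<Union>k<2 * M. path_edges (ch k)) \<longleftrightarrow>
      (\<exists>u v. (\<exists>k<2 * M. \<exists>j\<le>len k. u = pv k j \<and> v = pv k (Suc j)) \<and> e = {u, v})"
    unfolding path_edges_ch by auto
  show ?thesis unfolding EE_def Un_iff 1 2 3 adj_def by (simp only: conj_disj_distribR ex_disj_distrib disj_assoc)
qed

lemma edge_iff: "{u, v} \<in> EE \<longleftrightarrow> adj u v \<or> adj v u"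
  unfolding EE_iff_adj doubleton_eq_iff by auto

lemma lv_less: "k < 2 * M \<Longrightarrow> lv k \<le> M"
  by (auto simp: lv_def)

lemma pv_in: "k < 2 * M \<Longrightarrow> j \<le> Suc (len k) \<Longrightarrow> pv k j \<in> VV"
  using lv_less[of k] by (auto simp: pv_def VV_def)

lemma va_in: "i \<le> M \<Longrightarrow> va i \<in> VV" and vb_in: "i \<le> M \<Longrightarrow> vb i \<in> VV"
  by (auto simp: VV_def)

lemma pv_Suc_neq: "j \<le> len k \<Longrightarrow> pv k j \<noteq> pv k (Suc j)"
  by (auto simp: pv_def)

lemma adj_props: "adj u v \<Longrightarrow> u \<in> VV \<and> v \<in> VV \<and> u \<noteq> v"
  unfolding adj_def using pv_in pv_Suc_neq va_in vb_in by auto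

lemma finite_VV: "finite VV"
proof -
  have "{vx k j | k j. k < 2 * M \<and> 1 \<le> j \<and> j \<le> len k} = (\<lambda>(k, j). vx k j) ` (SIGMA k:{..<2 * M}. {1..len k})"
    by auto
  then show ?thesis by (simp add: VV_def)
qed

lemma simple_ladder: "simple_graph VV EE"
  unfolding simple_graph_def
proof (intro conjI ballI)
  fix e assume "e \<in> EE"
  then obtain u v where "adj u v" "e = {u, v}" unfolding EE_iff_adj by (elim exE conjE)
  then show "\<exists>u v. e = {u, v} \<and> u \<noteq> v \<and> u \<in> VV \<and> v \<in> VV"
    using adj_props[of u v] by (intro exI[of _ u] exI[of _ v]) simp
qed (rule finite_VV)

text \<open>The order matters: it is the clockwise order in the representation built later. At an
  inner level \<open>nB\<close> meets the corresponding paths in the reverse order, since the two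
  poles see them from opposite ends.\<close>

definition nA :: "nat \<Rightarrow> nat list" where
  "nA i = (if i < M then [va (Suc i), vx (2 * i) 1] else []) @ (if 0 < i then [vx (2 * i - 1) 1, va (i - 1)] else [])"

definition nB :: "nat \<Rightarrow> nat list" where
  "nB i = (if 0 < i then [vb (i - 1), vx (2 * i - 1) (len (2 * i - 1))] else [])
     @ (if i < M then [vx (2 * i) (len (2 * i)), vb (Suc i)] else [])"

definition nX :: "nat \<Rightarrow> nat \<Rightarrow> nat list" where
  "nX k j = [pv k (j - 1), pv k (Suc j)]"

lemma pv_eq_va: "pv k j = va i \<longleftrightarrow> j = 0 \<and> lv k = i"
  by (auto simp: pv_def)

lemma pv_eq_vx: "pv k j = vx l i \<longleftrightarrow> 0 < j \<and> j \<le> len k \<and> k = l \<and> j = i"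
  by (auto simp: pv_def)

lemma pv_vb: "j \<le> len k \<Longrightarrow> pv k j \<noteq> vb i" "j \<le> len k \<Longrightarrow> pv k (Suc j) = vb i \<longleftrightarrow> j = len k \<and> lv k = i"
  by (auto simp: pv_def)

lemma nbrs_va: assumes "i \<le> M" shows "nbrs EE (va i) = set (nA i)"
proof (intro set_eqI iffI)
  fix u assume "u \<in> nbrs EE (va i)"
  then have "adj u (va i) \<or> adj (va i) u" by (simp add: nbrs_def edge_iff)
  then consider j where "j < M" "u = va j" "i = Suc j" | "i < M" "u = va (Suc i)"
    | k where "k < 2 * M" "lv k = i" "u = vx k 1"
    unfolding adj_def by (auto simp: pv_eq_va eq_commute[of "va i"])
  then show "u \<in> set (nA i)"
  proof cases
    case (3 k)
    then show ?thesis unfolding lv_eq by (auto simp: nA_def)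
  qed (auto simp: nA_def)
next
  fix u assume "u \<in> set (nA i)"
  then consider "i < M" "u = va (Suc i)" | "i < M" "u = vx (2 * i) 1" | "0 < i" "u = vx (2 * i - 1) 1"
    | "0 < i" "u = va (i - 1)"
    by (auto simp: nA_def split: if_splits)
  then have "adj u (va i) \<or> adj (va i) u"
  proof cases
    case 1
    then show ?thesis by (auto simp: adj_def)
  next
    case 2
    then have "2 * i < 2 * M \<and> 0 \<le> len (2 * i) \<and> va i = pv (2 * i) 0 \<and> u = pv (2 * i) (Suc 0)" by simp
    then show ?thesis unfolding adj_def by blast
  next
    case 3
    then have "2 * i - 1 < 2 * M \<and> 0 \<le> len (2 * i - 1) \<and> va i = pv (2 * i - 1) 0 \<and> u = pv (2 * i - 1) (Suc 0)"
      using assms by simp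
    then show ?thesis unfolding adj_def by blast
  next
    case 4
    then have "i - 1 < M \<and> u = va (i - 1) \<and> va i = va (Suc (i - 1))" using assms by auto
    then show ?thesis unfolding adj_def by blast
  qed
  then show "u \<in> nbrs EE (va i)" by (simp add: nbrs_def edge_iff)
qed

lemma nbrs_vb: assumes "i \<le> M" shows "nbrs EE (vb i) = set (nB i)"
proof (intro set_eqI iffI)
  fix u assume "u \<in> nbrs EE (vb i)"
  then have "adj u (vb i) \<or> adj (vb i) u" by (simp add: nbrs_def edge_iff)
  then consider j where "j < M" "u = vb j" "i = Suc j" | "i < M" "u = vb (Suc i)"
    | k where "k < 2 * M" "lv k = i" "u = vx k (len k)"
    unfolding adj_def by (auto simp: pv_vb eq_commute[of "vb i"])
  then show "u \<in> set (nB i)"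
  proof cases
    case (3 k)
    then show ?thesis unfolding lv_eq by (auto simp: nB_def)
  qed (auto simp: nB_def)
next
  fix u assume "u \<in> set (nB i)"
  then consider "i < M" "u = vb (Suc i)" | "i < M" "u = vx (2 * i) (len (2 * i))"
    | "0 < i" "u = vx (2 * i - 1) (len (2 * i - 1))" | "0 < i" "u = vb (i - 1)"
    by (auto simp: nB_def split: if_splits)
  then have "adj u (vb i) \<or> adj (vb i) u"
  proof cases
    case 1
    then show ?thesis by (auto simp: adj_def)
  next
    case 2
    then have "2 * i < 2 * M \<and> len (2 * i) \<le> len (2 * i) \<and> u = pv (2 * i) (len (2 * i)) \<and> vb i = pv (2 * i) (Suc (len (2 * i)))"
      by simp
    then show ?thesis unfolding adj_def by blast
  next
    case 3
    then have "2 * i - 1 < 2 * M \<and> len (2 * i - 1) \<le> len (2 * i - 1) \<and> u = pv (2 * i - 1) (len (2 * i - 1))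
        \<and> vb i = pv (2 * i - 1) (Suc (len (2 * i - 1)))"
      using assms by simp
    then show ?thesis unfolding adj_def by blast
  next
    case 4
    then have "i - 1 < M \<and> u = vb (i - 1) \<and> vb i = vb (Suc (i - 1))" using assms by auto
    then show ?thesis unfolding adj_def by blast
  qed
  then show "u \<in> nbrs EE (vb i)" by (simp add: nbrs_def edge_iff)
qed

lemma nbrs_vx: assumes "k < 2 * M" "1 \<le> j" "j \<le> len k" shows "nbrs EE (vx k j) = set (nX k j)"
proof (intro set_eqI iffI)
  fix u assume "u \<in> nbrs EE (vx k j)"
  then have "adj u (vx k j) \<or> adj (vx k j) u" by (simp add: nbrs_def edge_iff)
  then show "u \<in> set (nX k j)"
    unfolding adj_def by (auto simp: pv_eq_vx eq_commute[of "vx k j"] nX_def)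
next
  fix u assume "u \<in> set (nX k j)"
  then consider "u = pv k (j - 1)" | "u = pv k (Suc j)" by (auto simp: nX_def)
  then have "adj u (vx k j) \<or> adj (vx k j) u"
  proof cases
    case 1
    then have "k < 2 * M \<and> j - 1 \<le> len k \<and> u = pv k (j - 1) \<and> vx k j = pv k (Suc (j - 1))" using assms by simp
    then show ?thesis unfolding adj_def by blast
  next
    case 2
    then have "k < 2 * M \<and> j \<le> len k \<and> vx k j = pv k j \<and> u = pv k (Suc j)" using assms by simp
    then show ?thesis unfolding adj_def by blast
  qed
  then show "u \<in> nbrs EE (vx k j)" by (simp add: nbrs_def edge_iff)
qed

lemma distinct_nA: "distinct (nA i)" by (auto simp: nA_def)

lemma distinct_nB: "distinct (nB i)" by (auto simp: nB_def)

lemma distinct_nX: "1 \<le> j \<Longrightarrow> j \<le> len k \<Longrightarrow> distinct (nX k j)" by (auto simp: nX_def pv_def)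

lemma deg_va: "i \<le> M \<Longrightarrow> deg EE (va i) = (if 0 < i \<and> i < M then 4 else 2)"
  using nbrs_va distinct_card[OF distinct_nA[of i]] M_ge by (auto simp: deg_def nA_def)

lemma deg_vb: "i \<le> M \<Longrightarrow> deg EE (vb i) = (if 0 < i \<and> i < M then 4 else 2)"
  using nbrs_vb distinct_card[OF distinct_nB[of i]] M_ge by (auto simp: deg_def nB_def)

lemma deg_vx: "k < 2 * M \<Longrightarrow> 1 \<le> j \<Longrightarrow> j \<le> len k \<Longrightarrow> deg EE (vx k j) = 2"
  using nbrs_vx distinct_card[OF distinct_nX[of j k]] by (simp add: deg_def) (simp add: nX_def)

lemma VV_cases:
  assumes "v \<in> VV"
  obtains i where "i \<le> M" "v = va i" | i where "i \<le> M" "v = vb i"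
    | k j where "k < 2 * M" "1 \<le> j" "j \<le> len k" "v = vx k j"
  using assms by (auto simp: VV_def)

end

section \<open>Local conditions at nodes with three children\<close>

lemma pairs_of_three:
  assumes "i < j" "j < length [a, b, c]"
  obtains "i = 0" "j = 1" | "i = 0" "j = 2" | "i = 1" "j = 2"
proof -
  have "j = 0 \<or> j = 1 \<or> j = 2" using assms(2) by auto
  then show ?thesis using assms(1) that by (elim disjE) (auto simp: less_Suc_eq numeral_2_eq_2)
qed

lemma local_ok_SN3:
  assumes "u \<noteq> v" "\<not> is_S a" "\<not> is_S b" "\<not> is_S c"
    "poles a = (u, p)" "poles b = (p, q)" "poles c = (q, v)"
    "vts a \<inter> vts b = {p}" "vts b \<inter> vts c = {q}" "vts a \<inter> vts c = {}"
  shows "local_ok V E (SN u v [a, b, c])"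
proof -
  have 1: "snd (poles ([a, b, c] ! i)) = fst (poles ([a, b, c] ! Suc i))" if "Suc i < length [a, b, c]" for i
    using pairs_of_three[of i "Suc i" a b c] that assms(5-7) by fastforce
  have 2: "vts ([a, b, c] ! i) \<inter> vts ([a, b, c] ! j) = (if j = Suc i then {snd (poles ([a, b, c] ! i))} else {})"
    if "i < j" "j < length [a, b, c]" for i j
    using that by (rule pairs_of_three) (simp_all add: assms(5-10))
  show ?thesis
    unfolding local_ok_def dtree.case
  proof (intro conjI allI impI)
    fix i assume "Suc i < length [a, b, c]"
    then show "snd (poles ([a, b, c] ! i)) = fst (poles ([a, b, c] ! Suc i))" by (rule 1)
  next
    fix i j assume "i < j \<and> j < length [a, b, c]"
    then show "vts ([a, b, c] ! i) \<inter> vts ([a, b, c] ! j)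
        = (if j = Suc i then {snd (poles ([a, b, c] ! i))} else {})"
      by (intro 2) simp_all
  qed (use assms(1-7) in simp_all)
qed

lemma local_ok_PN3:
  assumes "u \<noteq> v" "\<not> is_P a" "\<not> is_P b" "\<not> is_P c"
    "poles a = (u, v)" "poles b = (u, v)" "poles c = (u, v)"
    "vts a \<inter> vts b = {u, v}" "vts b \<inter> vts c = {u, v}" "vts a \<inter> vts c = {u, v}"
    "eds a \<inter> eds b = {}" "eds b \<inter> eds c = {}" "eds a \<inter> eds c = {}"
  shows "local_ok V E (PN u v [a, b, c])"
proof -
  have 2: "vts ([a, b, c] ! i) \<inter> vts ([a, b, c] ! j) = {u, v}" "eds ([a, b, c] ! i) \<inter> eds ([a, b, c] ! j) = {}"
    if "i < j" "j < length [a, b, c]" for i j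
  proof -
    show "vts ([a, b, c] ! i) \<inter> vts ([a, b, c] ! j) = {u, v}"
      using that by (rule pairs_of_three) (simp_all add: assms(8-13))
    show "eds ([a, b, c] ! i) \<inter> eds ([a, b, c] ! j) = {}"
      using that by (rule pairs_of_three) (simp_all add: assms(8-13))
  qed
  show ?thesis
    unfolding local_ok_def dtree.case
  proof (intro conjI allI impI)
    fix i j assume "i < j \<and> j < length [a, b, c]"
    then show "vts ([a, b, c] ! i) \<inter> vts ([a, b, c] ! j) = {u, v}"
      "eds ([a, b, c] ! i) \<inter> eds ([a, b, c] ! j) = {}"
      by (intro 2; simp)+
  qed (use assms(1-7) in simp_all)
qed

context ladder
begin

definition vxs :: "nat set \<Rightarrow> nat set" where
  "vxs K = {vx k j | k j. k \<in> K \<and> 1 \<le> j \<and> j \<le> len k}"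

text \<open>Parts of the ladder are named by a set of levels and a set of chains, so that unions and
  intersections of parts become those of index sets.\<close>

definition side :: "nat set \<Rightarrow> nat set \<Rightarrow> nat set" where
  "side A K = va ` A \<union> vb ` A \<union> vxs K"

text \<open>A pair of rail edges is named by its lower level. Hence the edge set of a wing has an
  index set of its own, with one element less than the set of levels.\<close>

definition sedge :: "nat set \<Rightarrow> nat set \<Rightarrow> nat set set" where
  "sedge B K = (\<lambda>i. {va i, va (Suc i)}) ` B \<union> (\<lambda>i. {vb i, vb (Suc i)}) ` B \<union> (\<Union>k\<in>K. path_edges (ch k))"

lemma side_iff [simp]: "va i \<in> side A K \<longleftrightarrow> i \<in> A" "vb i \<in> side A K \<longleftrightarrow> i \<in> A"
  "vx k j \<in> side A K \<longleftrightarrow> k \<in> K \<and> 1 \<le> j \<and> j \<le> len k"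
  by (auto simp: side_def vxs_def)

lemma side_Un: "side A K \<union> side A' K' = side (A \<union> A') (K \<union> K')"
  by (auto simp: side_def vxs_def)

lemma side_Int: "side A K \<inter> side A' K' = side (A \<inter> A') (K \<inter> K')"
  by (auto simp: side_def vxs_def)

lemma side_single: "side {i} {} = {va i, vb i}"
  by (auto simp: side_def vxs_def)

lemma side_empty: "side {} {} = {}"
  by (auto simp: side_def vxs_def)

lemma set_xs_side: "set (xs k) = side {} {k}"
  by (auto simp: set_xs side_def vxs_def)

lemma set_ch_side: "set (ch k) = side {lv k} {k}"
  by (auto simp: set_ch set_xs side_def vxs_def)

lemma VV_side: "VV = side {..M} {..<2 * M}"
  by (auto simp: VV_def side_def vxs_def)

lemma sedge_Un: "sedge B K \<union> sedge B' K' = sedge (B \<union> B') (K \<union> K')"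
  by (auto simp: sedge_def)

lemma sedge_ch: "path_edges (ch k) = sedge {} {k}"
  by (simp add: sedge_def)

lemma sedge_ladder: "{{va i, va (Suc i)}, {vb i, vb (Suc i)}} = sedge {i} {}"
  by (auto simp: sedge_def)

lemma EE_sedge: "EE = sedge {..<M} {..<2 * M}"
  by (auto simp: EE_def sedge_def)

lemma adj_va_vb: "{va i, vb j} \<notin> EE"
  unfolding edge_iff adj_def by (auto simp: pv_def)

text \<open>A common edge would join the two common vertices, but the rail vertices of one level are
  never adjacent, as every chain has an inner vertex.\<close>

lemma edges_disjoint:
  assumes "tree_ok VV EE a" "tree_ok VV EE b" "vts a \<inter> vts b = {va i, vb i}"
  shows "eds a \<inter> eds b = {}"
proof (rule ccontr)
  assume "eds a \<inter> eds b \<noteq> {}"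
  then obtain e where e: "e \<in> eds a" "e \<in> eds b" by blast
  then have "e \<in> EE" "e \<subseteq> {va i, vb i}"
    using tree_edges[OF assms(1)] tree_edges[OF assms(2)] assms(3) by blast+
  moreover obtain x y where "e = {x, y}" "x \<noteq> y"
    using \<open>e \<in> EE\<close> adj_props unfolding EE_iff_adj by blast
  ultimately have "{va i, vb i} \<in> EE" by (auto simp: insert_commute)
  then show False using adj_va_vb by blast
qed

lemma chain_ch:
  assumes "k < 2 * M" "1 \<le> lv k" "lv k < M" shows "is_chain VV EE (ch k)"
  unfolding is_chain_def
proof (intro conjI allI impI)
  show "set (ch k) \<subseteq> VV" using assms lv_less[of k] unfolding set_ch_side VV_side by (auto simp: side_def vxs_def)
  show "path_edges (ch k) \<subseteq> EE" using assms by (auto simp: EE_def)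
  fix i assume "0 < i \<and> i < length (ch k) - 1"
  then show "deg EE (ch k ! i) = 2" using assms deg_vx[of k i] by simp
qed (use assms deg_va deg_vb distinct_ch in auto)

lemma chain_edge:
  assumes "{u, v} \<in> EE" "deg EE u = 4" "deg EE v = 4" shows "is_chain VV EE [u, v]"
  using assms simple_graph_edgeD[OF simple_ladder assms(1)] by (auto simp: is_chain_def path_edges_Cons)

end

text \<open>A wing is the part of the ladder beyond the chains of level \<open>L n\<close>, on one fixed side of them; \<open>n\<close> counts
  the inner levels in that part. It contains the rail vertices of the levels \<open>A n\<close>, the chains \<open>K n\<close> and
  the rail edges that start at the levels \<open>B n\<close>; the list \<open>zi\<close> is the interior of its extreme chain.\<close>

locale wing = ladder +
  fixes L :: "nat \<Rightarrow> nat" and A K B :: "nat \<Rightarrow> nat set" and zi :: "nat list" and N :: nat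
  assumes L_rng: "n \<le> N \<Longrightarrow> 1 \<le> L n \<and> L n < M"
    and L_step: "n < N \<Longrightarrow> L (Suc n) = Suc (L n) \<or> L n = Suc (L (Suc n))"
    and A_step: "n < N \<Longrightarrow> A (Suc n) = insert (L (Suc n)) (A n)"
    and L_notin: "n < N \<Longrightarrow> L (Suc n) \<notin> A n"
    and L_in: "n \<le> N \<Longrightarrow> L n \<in> A n"
    and K_step: "n < N \<Longrightarrow> K (Suc n) = {2 * L n, 2 * L n - 1} \<union> K n"
    and K_disj: "n \<le> N \<Longrightarrow> {2 * L n, 2 * L n - 1} \<inter> K n = {}"
    and B_step: "n < N \<Longrightarrow> B (Suc n) = insert (min (L n) (L (Suc n))) (B n)"
    and z_chain: "is_chain VV EE (va (L 0) # zi @ [vb (L 0)])"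
    and z_set: "set (va (L 0) # zi @ [vb (L 0)]) = side (A 0) (K 0)"
    and z_edges: "path_edges (va (L 0) # zi @ [vb (L 0)]) = sedge (B 0) (K 0)"
    and zi_ne: "zi \<noteq> []"
begin

definition z :: "nat list" where "z = va (L 0) # zi @ [vb (L 0)]"

text \<open>Counted from the extreme chain. Each step joins the tree built so far with the two
  chains at its poles into a P-node and prolongs it by a rail edge at either end. So the poles of
  \<open>br n\<close> are at level \<open>L n\<close>, while the two chains of this level are not
  yet included.\<close>

fun br :: "nat \<Rightarrow> dtree" where
  "br 0 = QN z"
| "br (Suc n) = SN (va (L (Suc n))) (vb (L (Suc n)))
    [QN [va (L (Suc n)), va (L n)],
     PN (va (L n)) (vb (L n)) [QN (ch (2 * L n)), QN (ch (2 * L n - 1)), br n],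
     QN [vb (L n), vb (L (Suc n))]]"

lemma lvs: "n \<le> N \<Longrightarrow> lv (2 * L n) = L n \<and> lv (2 * L n - 1) = L n \<and> 2 * L n < 2 * M \<and> 2 * L n \<noteq> 2 * L n - 1"
  using L_rng[of n] by (auto simp: lv_def)

lemma chains:
  assumes "n \<le> N" shows "is_chain VV EE (ch (2 * L n))" "is_chain VV EE (ch (2 * L n - 1))"
  using lvs[OF assms] L_rng[OF assms] by (auto intro!: chain_ch)

lemma ladder_edge:
  assumes n: "n < N"
  shows "{va (L (Suc n)), va (L n)} \<in> EE" "{vb (L n), vb (L (Suc n))} \<in> EE"
    "{{va (L (Suc n)), va (L n)}, {vb (L n), vb (L (Suc n))}} = sedge {min (L n) (L (Suc n))} {}"
proof -
  have *: "{{va (L (Suc n)), va (L n)}, {vb (L n), vb (L (Suc n))}} = sedge {min (L n) (L (Suc n))} {}"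
    using L_step[OF n] by (auto simp: sedge_ladder[symmetric] insert_commute)
  moreover have "sedge {min (L n) (L (Suc n))} {} \<subseteq> EE"
    using L_rng[of n] L_rng[of "Suc n"] n by (auto simp: EE_sedge sedge_def)
  ultimately show "{va (L (Suc n)), va (L n)} \<in> EE" "{vb (L n), vb (L (Suc n))} \<in> EE" by blast+
  show "{{va (L (Suc n)), va (L n)}, {vb (L n), vb (L (Suc n))}} = sedge {min (L n) (L (Suc n))} {}" by (rule *)
qed

lemma br_props:
  "n \<le> N \<Longrightarrow> tree_ok VV EE (br n) \<and> poles (br n) = (va (L n), vb (L n)) \<and> \<not> is_P (br n)
    \<and> vts (br n) = side (A n) (K n) \<and> eds (br n) = sedge (B n) (K n) \<and> QN z \<in> nodes (br n)"
proof (induction n)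
  case 0
  then show ?case
    using z_chain z_set z_edges by (auto simp: z_def tree_ok_def local_ok_def)
next
  case (Suc n)
  let ?u = "va (L n)" and ?v = "vb (L n)" and ?u' = "va (L (Suc n))" and ?v' = "vb (L (Suc n))"
  let ?c1 = "QN (ch (2 * L n))" and ?c2 = "QN (ch (2 * L n - 1))"
  let ?P = "PN ?u ?v [?c1, ?c2, br n]"
  have n: "n < N" "n \<le> N" using Suc.prems by auto
  have IH: "tree_ok VV EE (br n)" "poles (br n) = (?u, ?v)" "\<not> is_P (br n)"
    "vts (br n) = side (A n) (K n)" "eds (br n) = sedge (B n) (K n)" "QN z \<in> nodes (br n)"
    using Suc.IH n by auto
  note lvn = lvs[OF n(2)]
  have okc: "tree_ok VV EE ?c1" "tree_ok VV EE ?c2"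
    using chains[OF n(2)] by (auto simp: tree_ok_def local_ok_def)
  have pc: "poles ?c1 = (?u, ?v)" "poles ?c2 = (?u, ?v)" using lvn by auto
  have i12: "vts ?c1 \<inter> vts ?c2 = {?u, ?v}"
    using lvn by (simp add: set_ch_side side_Int side_single)
  have i1: "vts ?c1 \<inter> vts (br n) = {?u, ?v}" and i2: "vts ?c2 \<inter> vts (br n) = {?u, ?v}"
    using lvn K_disj[OF n(2)] L_in[OF n(2)] IH(4) by (simp_all add: set_ch_side side_Int side_single)
  have okP: "local_ok VV EE ?P"
    using IH i12 i1 i2 edges_disjoint[OF okc i12] edges_disjoint[OF okc(1) IH(1) i1] edges_disjoint[OF okc(2) IH(1) i2] pc
    by (intro local_ok_PN3) auto
  have vP: "vts ?P = side (A n) ({2 * L n, 2 * L n - 1} \<union> K n)"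
  proof -
    have "vts ?P = side ({L n} \<union> ({L n} \<union> A n)) ({2 * L n} \<union> ({2 * L n - 1} \<union> K n))"
      unfolding side_Un[symmetric] using lvn IH(4) set_ch_side[of "2 * L n"] set_ch_side[of "2 * L n - 1"] by simp
    then show ?thesis using L_in[OF n(2)] by (simp add: insert_absorb insert_commute)
  qed
  have eP: "eds ?P = sedge (B n) ({2 * L n, 2 * L n - 1} \<union> K n)"
  proof -
    have "eds ?P = sedge ({} \<union> ({} \<union> B n)) ({2 * L n} \<union> ({2 * L n - 1} \<union> K n))"
      unfolding sedge_Un[symmetric] using IH(5) sedge_ch by simp
    then show ?thesis by (simp add: insert_commute)
  qed
  have notin: "?u' \<notin> vts ?P" "?v' \<notin> vts ?P" using L_notin[OF n(1)] unfolding vP by simp_all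
  have inP: "?u \<in> vts ?P" "?v \<in> vts ?P" using L_in[OF n(2)] unfolding vP by simp_all
  have okS: "local_ok VV EE (br (Suc n))"
    unfolding br.simps
  proof (rule local_ok_SN3[where p = ?u and q = ?v])
    show "vts (QN [?u', ?u]) \<inter> vts ?P = {?u}" using notin inP by (simp del: vts.simps(3))
    show "vts ?P \<inter> vts (QN [?v, ?v']) = {?v}" using notin inP by (simp del: vts.simps(3))
  qed auto
  have deg4: "deg EE ?u = 4" "deg EE ?v = 4" "deg EE ?u' = 4" "deg EE ?v' = 4"
    using L_rng[of n] L_rng[of "Suc n"] Suc.prems by (auto simp: deg_va deg_vb)
  have okl: "local_ok VV EE (QN [?u', ?u])" "local_ok VV EE (QN [?v, ?v'])"
    using chain_edge ladder_edge[OF n(1)] deg4 by (auto simp: local_ok_def)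
  have "tree_ok VV EE (br (Suc n))"
    using okS okP okl IH(1) okc by (auto simp: tree_ok_def)
  moreover have "vts (br (Suc n)) = side (A (Suc n)) (K (Suc n))"
  proof -
    have "vts (br (Suc n)) = {?u', ?u} \<union> (vts ?P \<union> {?v, ?v'})" by (simp add: Un_assoc)
    also have "\<dots> = {?u', ?v'} \<union> vts ?P" using inP by blast
    also have "\<dots> = side (A (Suc n)) (K (Suc n))"
      unfolding vP side_single[symmetric] side_Un A_step[OF n(1)] K_step[OF n(1)] by simp
    finally show ?thesis .
  qed
  moreover have "eds (br (Suc n)) = sedge (B (Suc n)) (K (Suc n))"
  proof -
    have "eds (br (Suc n)) = {{?u', ?u}, {?v, ?v'}} \<union> eds ?P" by (auto simp: path_edges_Cons)
    also have "\<dots> = sedge (B (Suc n)) (K (Suc n))"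
      unfolding eP ladder_edge(3)[OF n(1)] sedge_Un B_step[OF n(1)] K_step[OF n(1)] by simp
    finally show ?thesis .
  qed
  ultimately show ?case using IH(6) by simp
qed

text \<open>Interiors of paths between the poles of \<open>br n\<close>; all of them start at \<open>ha n\<close> and end at \<open>hb n\<close>.\<close>

fun ipths :: "nat \<Rightarrow> nat list set" where
  "ipths 0 = {zi}"
| "ipths (Suc n) = (\<lambda>q. va (L n) # q @ [vb (L n)]) ` ({xs (2 * L n), xs (2 * L n - 1)} \<union> ipths n)"

definition ha :: "nat \<Rightarrow> nat" where "ha n = (case n of 0 \<Rightarrow> hd zi | Suc k \<Rightarrow> va (L k))"
definition hb :: "nat \<Rightarrow> nat" where "hb n = (case n of 0 \<Rightarrow> last zi | Suc k \<Rightarrow> vb (L k))"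

lemma xs_path:
  assumes "n \<le> N" "k = 2 * L n \<or> k = 2 * L n - 1"
  shows "va (L n) # xs k @ [vb (L n)] = ch k" "path_edges (ch k) \<subseteq> EE"
    "set (xs k) \<subseteq> side {} {2 * L n, 2 * L n - 1}"
proof -
  show "va (L n) # xs k @ [vb (L n)] = ch k" using lvs[OF assms(1)] assms(2) by (auto simp: ch_eq)
  show "path_edges (ch k) \<subseteq> EE" using chains[OF assms(1)] assms(2) by (auto simp: is_chain_def)
  show "set (xs k) \<subseteq> side {} {2 * L n, 2 * L n - 1}" using assms(2) by (auto simp: set_xs_side side_def vxs_def)
qed

text \<open>The common end vertices are the point: all these paths leave the poles of the wing along
  the same two edges, so the choice of the path does not affect the corners at the poles.\<close>

lemma ipths_props:
  "n \<le> N \<Longrightarrow> q \<in> ipths n \<Longrightarrow> q \<noteq> [] \<and> distinct (va (L n) # q @ [vb (L n)])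
    \<and> set q \<subseteq> side (A n) (K n) \<and> path_edges (va (L n) # q @ [vb (L n)]) \<subseteq> EE \<and> hd q = ha n \<and> last q = hb n"
proof (induction n arbitrary: q)
  case 0
  then show ?case
    using z_chain z_set zi_ne by (auto simp: is_chain_def ha_def hb_def)
next
  case (Suc n)
  let ?u = "va (L n)" and ?v = "vb (L n)" and ?u' = "va (L (Suc n))" and ?v' = "vb (L (Suc n))"
  have n: "n < N" "n \<le> N" using Suc.prems by auto
  obtain q' where q': "q = ?u # q' @ [?v]" "q' \<in> {xs (2 * L n), xs (2 * L n - 1)} \<union> ipths n"
    using Suc.prems(2) by auto
  have *: "distinct (?u # q' @ [?v]) \<and> set (?u # q' @ [?v]) \<subseteq> side (A n) (K (Suc n)) \<and> path_edges (?u # q' @ [?v]) \<subseteq> EE"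
  proof (cases "q' \<in> ipths n")
    case True
    have "side (A n) (K n) \<subseteq> side (A n) (K (Suc n))" using K_step[OF n(1)] by (auto simp: side_def vxs_def)
    then show ?thesis using Suc.IH[OF n(2) True] L_in[OF n(2)] by auto
  next
    case False
    then obtain k where k: "k = 2 * L n \<or> k = 2 * L n - 1" "q' = xs k" using q'(2) by blast
    note xp = xs_path[OF n(2) k(1)]
    have "side {} {2 * L n, 2 * L n - 1} \<subseteq> side (A n) (K (Suc n))" using K_step[OF n(1)] by (auto simp: side_def vxs_def)
    then have "set (?u # q' @ [?v]) \<subseteq> side (A n) (K (Suc n))" using xp(3) k(2) L_in[OF n(2)] by auto
    then show ?thesis using xp(1,2) distinct_ch[of k] k(2) by simp
  qed
  have notin: "?u' \<notin> side (A n) (K (Suc n))" "?v' \<notin> side (A n) (K (Suc n))" using L_notin[OF n(1)] by simp_all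
  have "side (A n) (K (Suc n)) \<subseteq> side (A (Suc n)) (K (Suc n))"
    unfolding A_step[OF n(1)] by (auto simp: side_def vxs_def)
  moreover have "distinct (?u' # q @ [?v'])" using * notin q'(1) by auto
  moreover have "path_edges (?u' # q @ [?v']) \<subseteq> EE"
  proof -
    have "path_edges (?u' # q @ [?v']) = insert {?u', ?u} (path_edges ((?u # q') @ ?v # [?v']))"
      unfolding q'(1) by (simp add: path_edges_Cons)
    also have "\<dots> = insert {?u', ?u} (path_edges (?u # q' @ [?v]) \<union> {{?v, ?v'}})"
      unfolding path_edges_append[of "?u # q'" ?v "[?v']"] by (simp add: path_edges_Cons)
    finally show ?thesis using * ladder_edge[OF n(1)] by simp
  qed
  moreover have "L n \<in> A (Suc n)" using A_step[OF n(1)] L_in[OF n(2)] by simp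
  ultimately show ?case using * q'(1) by (auto simp: ha_def hb_def)
qed

end

section \<open>Decompositions of the ladder for the various reference chains\<close>

context ladder
begin

text \<open>At an inner level four parts are parallel, two chains and two wings. A part that is a
  single chain may serve as reference chain \<open>\<rho>\<close>, and the other three become the
  children of the topmost P-node.\<close>

lemma rooted4:
  assumes ok: "tree_ok VV EE a" "tree_ok VV EE b" "tree_ok VV EE c" "is_chain VV EE \<rho>"
    and P: "\<not> is_P a" "\<not> is_P b" "\<not> is_P c"
    and poles: "poles a = (va i, vb i)" "poles b = (va i, vb i)" "poles c = (va i, vb i)" "poles (QN \<rho>) = (va i, vb i)"
    and int: "vts a \<inter> vts b = {va i, vb i}" "vts b \<inter> vts c = {va i, vb i}" "vts a \<inter> vts c = {va i, vb i}"
      "vts a \<inter> vts (QN \<rho>) = {va i, vb i}" "vts b \<inter> vts (QN \<rho>) = {va i, vb i}" "vts c \<inter> vts (QN \<rho>) = {va i, vb i}"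
    and un: "vts a \<union> vts b \<union> vts c \<union> vts (QN \<rho>) = VV" "eds a \<union> eds b \<union> eds c \<union> eds (QN \<rho>) = EE"
  shows "rooted_decomp VV EE \<rho> (PN (va i) (vb i) [a, b, c])"
proof -
  have ok\<rho>: "tree_ok VV EE (QN \<rho>)" using ok(4) by (simp add: tree_ok_def local_ok_def)
  note ed = edges_disjoint[OF ok(1,2) int(1)] edges_disjoint[OF ok(2,3) int(2)] edges_disjoint[OF ok(1,3) int(3)]
    edges_disjoint[OF ok(1) ok\<rho> int(4)] edges_disjoint[OF ok(2) ok\<rho> int(5)] edges_disjoint[OF ok(3) ok\<rho> int(6)]
  have "local_ok VV EE (PN (va i) (vb i) [a, b, c])"
    using P poles int ed by (intro local_ok_PN3) simp_all
  then have "\<forall>t\<in>nodes (PN (va i) (vb i) [a, b, c]). local_ok VV EE t"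
    using ok by (auto simp: tree_ok_def)
  moreover have "eds (PN (va i) (vb i) [a, b, c]) \<union> path_edges \<rho> = EE"
    using un(2) by (simp add: Un_assoc)
  moreover have "eds (PN (va i) (vb i) [a, b, c]) \<inter> path_edges \<rho> = {}"
    using ed(4-6) by (simp add: Int_Un_distrib2)
  moreover have "vts (PN (va i) (vb i) [a, b, c]) \<union> set \<rho> = VV"
    using un(1) by (simp add: Un_assoc)
  moreover have "vts (PN (va i) (vb i) [a, b, c]) \<inter> set \<rho> = {hd \<rho>, last \<rho>}"
    using int(4-6) poles(4) by (simp add: Int_Un_distrib2)
  ultimately show ?thesis using ok(4) poles(4) by (simp add: rooted_decomp_def)
qed

text \<open>The ends of the rails have degree 2, so the extreme chain continues through them to the
  nearest inner level and forms one maximal chain together with two rail edges.\<close>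

definition zup :: "nat list" where "zup = va (M - 1) # ch (2 * M - 1) @ [vb (M - 1)]"
definition zdn :: "nat list" where "zdn = va 1 # ch 0 @ [vb 1]"

lemma end_chain:
  assumes j: "1 \<le> j" "j < M" and k: "k < 2 * M" "lv k = 0 \<or> lv k = M" "lv k \<noteq> j"
    and e: "{va j, va (lv k)} \<in> EE" "{vb (lv k), vb j} \<in> EE"
  shows "is_chain VV EE (va j # ch k @ [vb j])"
    and "set (va j # ch k @ [vb j]) = side {j, lv k} {k}"
    and "path_edges (va j # ch k @ [vb j]) = {{va j, va (lv k)}, {vb (lv k), vb j}} \<union> sedge {} {k}"
proof -
  let ?z = "va j # ch k @ [vb j]"
  show s: "set ?z = side {j, lv k} {k}"
    using set_ch_side[of k] by (auto simp: side_def)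
  show pe: "path_edges ?z = {{va j, va (lv k)}, {vb (lv k), vb j}} \<union> sedge {} {k}"
  proof -
    have "path_edges ?z = insert {va j, va (lv k)} (path_edges ((va (lv k) # xs k) @ vb (lv k) # [vb j]))"
      unfolding ch_eq by (simp add: path_edges_Cons)
    also have "\<dots> = {{va j, va (lv k)}, {vb (lv k), vb j}} \<union> path_edges (ch k)"
      unfolding path_edges_append[of "va (lv k) # xs k" "vb (lv k)" "[vb j]"] by (auto simp: path_edges_Cons ch_eq)
    finally show ?thesis unfolding sedge_ch .
  qed
  show "is_chain VV EE ?z"
    unfolding is_chain_def
  proof (intro conjI allI impI)
    show "distinct ?z" using distinct_ch[of k] k(3) by (auto simp: set_ch_side)
    show "set ?z \<subseteq> VV"
      unfolding s VV_side using j k lv_less[of k] by (auto simp: side_def vxs_def)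
    show "path_edges ?z \<subseteq> EE"
      unfolding pe using e k(1) by (auto simp: EE_def sedge_ch[symmetric])
    fix i assume i: "0 < i \<and> i < length ?z - 1"
    then obtain i' where i': "i = Suc i'" "i' < length (ch k)" by (cases i) auto
    then have "?z ! i = pv k i'" by (simp add: nth_append)
    moreover have "deg EE (pv k i') = 2"
    proof -
      consider "i' = 0" | "1 \<le> i'" "i' \<le> len k" | "i' = Suc (len k)" using i'(2) by fastforce
      then show ?thesis
        using k deg_va[of "lv k"] deg_vb[of "lv k"] deg_vx[of k i'] by cases auto
    qed
    ultimately show "deg EE (?z ! i) = 2" by simp
  qed (use j deg_va[of j] deg_vb[of j] in auto)
qed

lemma side_IntI: "A \<inter> A' = {i} \<Longrightarrow> K \<inter> K' = {} \<Longrightarrow> side A K \<inter> side A' K' = {va i, vb i}"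
  by (simp add: side_Int side_single)

lemma lv_end: "lv (2 * M - 1) = M" "lv (2 * M - Suc 0) = M"
  using M_ge by (auto simp: lv_def)

lemma ladder_adj: "i < M \<Longrightarrow> {va i, va (Suc i)} \<in> EE" "i < M \<Longrightarrow> {vb i, vb (Suc i)} \<in> EE"
  by (auto simp: EE_def)

lemma zup_chain:
  "is_chain VV EE zup" "set zup = side {M - 1..M} {2 * (M - 1)<..<2 * M}" "path_edges zup = sedge {M - 1..<M} {2 * (M - 1)<..<2 * M}"
proof -
  have M: "1 \<le> M - 1" "M - 1 < M" "Suc (M - 1) = M" using M_ge by auto
  have e: "{va (M - 1), va (lv (2 * M - 1))} \<in> EE" "{vb (lv (2 * M - 1)), vb (M - 1)} \<in> EE"
    using ladder_adj[of "M - 1"] M unfolding lv_end by (auto simp: insert_commute)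
  have k: "2 * M - 1 < 2 * M" "lv (2 * M - 1) = 0 \<or> lv (2 * M - 1) = M" "lv (2 * M - 1) \<noteq> M - 1"
    using M unfolding lv_end by auto
  note ec = end_chain[OF M(1,2) k e]
  have K: "{2 * (M - 1)<..<2 * M} = {2 * M - 1}" and A: "{M - 1..M} = {M - 1, M}" and B: "{M - 1..<M} = {M - 1}"
    using M by auto
  show "is_chain VV EE zup" using ec(1) by (simp add: zup_def)
  show "set zup = side {M - 1..M} {2 * (M - 1)<..<2 * M}" using ec(2) unfolding zup_def lv_end K A .
  have "path_edges zup = {{va (M - 1), va (Suc (M - 1))}, {vb (M - 1), vb (Suc (M - 1))}} \<union> sedge {} {2 * M - 1}"
    using ec(3) unfolding zup_def lv_end M(3) by (simp add: insert_commute)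
  then show "path_edges zup = sedge {M - 1..<M} {2 * (M - 1)<..<2 * M}"
    unfolding sedge_ladder sedge_Un K B by simp
qed

lemma zdn_chain:
  "is_chain VV EE zdn" "set zdn = side {..1} {..<1}" "path_edges zdn = sedge {..<1} {..<1}"
proof -
  have M: "1 \<le> (1::nat)" "1 < M" using M_ge by auto
  have e: "{va 1, va (lv 0)} \<in> EE" "{vb (lv 0), vb 1} \<in> EE"
    using ladder_adj[of 0] M by (auto simp: insert_commute)
  have k: "0 < 2 * M" "lv 0 = 0 \<or> lv 0 = M" "lv 0 \<noteq> 1" using M by auto
  note ec = end_chain[OF M k e]
  have K: "{..<1} = {0::nat}" and A: "{..1} = {1, 0::nat}" by auto
  show "is_chain VV EE zdn" using ec(1) by (simp add: zdn_def)
  show "set zdn = side {..1} {..<1}" using ec(2) unfolding zdn_def K A by simp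
  have "path_edges zdn = {{va 0, va (Suc 0)}, {vb 0, vb (Suc 0)}} \<union> sedge {} {0}"
    using ec(3) unfolding zdn_def by (simp add: insert_commute)
  then show "path_edges zdn = sedge {..<1} {..<1}"
    unfolding sedge_ladder sedge_Un K by simp
qed

text \<open>Here \<open>n\<close> counts downwards from the last inner level. The open interval of
  chain indices leaves out both chains at the level of the poles.\<close>

lemma wing_up:
  "wing m (\<lambda>n. M - 1 - n) (\<lambda>n. {M - 1 - n..M}) (\<lambda>n. {2 * (M - 1 - n)<..<2 * M}) (\<lambda>n. {M - 1 - n..<M})
    (ch (2 * M - 1)) (M - 2)"
proof unfold_locales
  show "is_chain VV EE (va (M - 1 - 0) # ch (2 * M - 1) @ [vb (M - 1 - 0)])"
    "set (va (M - 1 - 0) # ch (2 * M - 1) @ [vb (M - 1 - 0)]) = side {M - 1 - 0..M} {2 * (M - 1 - 0)<..<2 * M}"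
    "path_edges (va (M - 1 - 0) # ch (2 * M - 1) @ [vb (M - 1 - 0)]) = sedge {M - 1 - 0..<M} {2 * (M - 1 - 0)<..<2 * M}"
    using zup_chain by (simp_all add: zup_def)
next
  fix n assume n: "n < M - 2"
  then have a: "M - 1 - n = Suc (M - 1 - Suc n)" "M - 1 - Suc n < M" by auto
  define l where "l = M - 1 - Suc n"
  have l: "M - 1 - n = Suc l" "Suc l < M" using a n by (auto simp: l_def)
  show "M - 1 - Suc n = Suc (M - 1 - n) \<or> M - 1 - n = Suc (M - 1 - Suc n)" using a by blast
  show "{M - 1 - Suc n..M} = insert (M - 1 - Suc n) {M - 1 - n..M}"
    "M - 1 - Suc n \<notin> {M - 1 - n..M}"
    "{2 * (M - 1 - Suc n)<..<2 * M} = {2 * (M - 1 - n), 2 * (M - 1 - n) - 1} \<union> {2 * (M - 1 - n)<..<2 * M}"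
    "{M - 1 - Suc n..<M} = insert (min (M - 1 - n) (M - 1 - Suc n)) {M - 1 - n..<M}"
    using l(2) unfolding l_def[symmetric] l(1) by auto
qed (use M_ge in auto)

lemma wing_dn:
  "wing m Suc (\<lambda>n. {..Suc n}) (\<lambda>n. {..<2 * Suc n - 1}) (\<lambda>n. {..<Suc n}) (ch 0) (M - 2)"
proof unfold_locales
  show "is_chain VV EE (va (Suc 0) # ch 0 @ [vb (Suc 0)])"
    "set (va (Suc 0) # ch 0 @ [vb (Suc 0)]) = side {..Suc 0} {..<2 * Suc 0 - 1}"
    "path_edges (va (Suc 0) # ch 0 @ [vb (Suc 0)]) = sedge {..<Suc 0} {..<2 * Suc 0 - 1}"
    using zdn_chain by (simp_all add: zdn_def)
next
  fix n
  show "{..<2 * Suc (Suc n) - 1} = {2 * Suc n, 2 * Suc n - 1} \<union> {..<2 * Suc n - 1}" by auto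
  show "{..<Suc (Suc n)} = insert (min (Suc n) (Suc (Suc n))) {..<Suc n}" by auto
qed (use M_ge in auto)

lemma up_tree:
  assumes "1 \<le> i" "i < M"
  obtains t where "tree_ok VV EE t" "poles t = (va i, vb i)" "\<not> is_P t" "vts t = side {i..M} {2 * i<..<2 * M}"
    "eds t = sedge {i..<M} {2 * i<..<2 * M}" "QN zup \<in> nodes t"
proof -
  interpret w: wing m "\<lambda>n. M - 1 - n" "\<lambda>n. {M - 1 - n..M}" "\<lambda>n. {2 * (M - 1 - n)<..<2 * M}" "\<lambda>n. {M - 1 - n..<M}"
    "ch (2 * M - 1)" "M - 2" by (rule wing_up)
  have i: "M - 1 - (M - 1 - i) = i" "M - 1 - i \<le> M - 2" using assms by auto
  have "w.z = zup" unfolding w.z_def zup_def by simp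
  then show ?thesis using w.br_props[OF i(2)] that unfolding i(1) by metis
qed

lemma dn_tree:
  assumes "1 \<le> i" "i < M"
  obtains t where "tree_ok VV EE t" "poles t = (va i, vb i)" "\<not> is_P t" "vts t = side {..i} {..<2 * i - 1}"
    "eds t = sedge {..<i} {..<2 * i - 1}" "QN zdn \<in> nodes t"
proof -
  interpret w: wing m Suc "\<lambda>n. {..Suc n}" "\<lambda>n. {..<2 * Suc n - 1}" "\<lambda>n. {..<Suc n}" "ch 0" "M - 2" by (rule wing_dn)
  have i: "Suc (i - 1) = i" "i - 1 \<le> M - 2" using assms by auto
  have "w.z = zdn" unfolding w.z_def zdn_def by simp
  then show ?thesis using w.br_props[OF i(2)] that unfolding i(1) by metis
qed

lemma ch_tree:
  assumes "k < 2 * M" "1 \<le> lv k" "lv k < M"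
  shows "tree_ok VV EE (QN (ch k))" "poles (QN (ch k)) = (va (lv k), vb (lv k))" "\<not> is_P (QN (ch k))"
    "vts (QN (ch k)) = side {lv k} {k}" "eds (QN (ch k)) = sedge {} {k}"
  using chain_ch[OF assms] set_ch_side sedge_ch by (auto simp: tree_ok_def local_ok_def)

text \<open>The twin of the reference chain and the two wings are the children of the top node, and
  each wing ends in an extreme chain.\<close>

lemma root_middle:
  assumes k: "k < 2 * M" "1 \<le> lv k" "lv k < M"
  shows "\<exists>T. rooted_decomp VV EE (ch k) T \<and> QN zup \<in> nodes T \<and> QN zdn \<in> nodes T"
proof -
  define i where "i = lv k"
  have i: "1 \<le> i" "i < M" using k by (auto simp: i_def)
  obtain k' where k': "{k, k'} = {2 * i, 2 * i - 1}" "k \<noteq> k'" "lv k' = i" "k' < 2 * M"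
  proof (cases "k = 2 * i")
    case True
    then show ?thesis using that[of "2 * i - 1"] i by (auto simp: lv_eq)
  next
    case False
    then have "k = 2 * i - 1" using i_def lv_eq by metis
    then show ?thesis using that[of "2 * i"] i by (auto simp: lv_eq insert_commute)
  qed
  obtain u where u: "tree_ok VV EE u" "poles u = (va i, vb i)" "\<not> is_P u" "vts u = side {i..M} {2 * i<..<2 * M}"
    "eds u = sedge {i..<M} {2 * i<..<2 * M}" "QN zup \<in> nodes u" by (rule up_tree[OF i])
  obtain d where d: "tree_ok VV EE d" "poles d = (va i, vb i)" "\<not> is_P d" "vts d = side {..i} {..<2 * i - 1}"
    "eds d = sedge {..<i} {..<2 * i - 1}" "QN zdn \<in> nodes d" by (rule dn_tree[OF i])
  have k'i: "k' < 2 * M" "1 \<le> lv k'" "lv k' < M" using k' i by auto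
  note c = ch_tree[OF k'i, unfolded k'(3)] and r = ch_tree[OF k, folded i_def]
  have kk: "k = 2 * i \<and> k' = 2 * i - 1 \<or> k = 2 * i - 1 \<and> k' = 2 * i" using k'(1) by (auto simp: doubleton_eq_iff)
  have "rooted_decomp VV EE (ch k) (PN (va i) (vb i) [QN (ch k'), u, d])"
  proof (rule rooted4[OF c(1) u(1) d(1) chain_ch[OF k] c(3) u(3) d(3) c(2) u(2) d(2) r(2)])
    show "vts (QN (ch k')) \<inter> vts u = {va i, vb i}" "vts u \<inter> vts d = {va i, vb i}"
      "vts (QN (ch k')) \<inter> vts d = {va i, vb i}" "vts (QN (ch k')) \<inter> vts (QN (ch k)) = {va i, vb i}"
      "vts u \<inter> vts (QN (ch k)) = {va i, vb i}" "vts d \<inter> vts (QN (ch k)) = {va i, vb i}"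
      unfolding c(4) u(4) d(4) r(4) using kk i by (auto intro!: side_IntI)
    show "vts (QN (ch k')) \<union> vts u \<union> vts d \<union> vts (QN (ch k)) = VV"
      unfolding c(4) u(4) d(4) r(4) side_Un VV_side by (rule arg_cong2[where f = side]) (use kk i in auto)
    show "eds (QN (ch k')) \<union> eds u \<union> eds d \<union> eds (QN (ch k)) = EE"
      unfolding c(5) u(5) d(5) r(5) sedge_Un EE_sedge by (rule arg_cong2[where f = sedge]) (use kk i in auto)
  qed
  moreover have "QN zup \<in> nodes (PN (va i) (vb i) [QN (ch k'), u, d])"
    "QN zdn \<in> nodes (PN (va i) (vb i) [QN (ch k'), u, d])" using u(6) d(6) by simp_all
  ultimately show ?thesis by blast
qed

text \<open>With \<open>zup\<close> as root, \<open>zup\<close> itself is no longer a node; its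
  neighbour \<open>ch (2 * (M - 1))\<close> is recorded as a substitute.\<close>

lemma root_up:
  "\<exists>T. rooted_decomp VV EE zup T \<and> QN zdn \<in> nodes T \<and> QN (ch (2 * (M - 1))) \<in> nodes T"
proof -
  define i where "i = M - 1"
  have i: "1 \<le> i" "i < M" using M_ge by (auto simp: i_def)
  obtain d where d: "tree_ok VV EE d" "poles d = (va i, vb i)" "\<not> is_P d" "vts d = side {..i} {..<2 * i - 1}"
    "eds d = sedge {..<i} {..<2 * i - 1}" "QN zdn \<in> nodes d" by (rule dn_tree[OF i])
  have l: "lv (2 * i) = i" "lv (2 * i - 1) = i" using i by auto
  have ki: "2 * i < 2 * M" "1 \<le> lv (2 * i)" "lv (2 * i) < M" "2 * i - 1 < 2 * M" "1 \<le> lv (2 * i - 1)" "lv (2 * i - 1) < M"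
    using i l by auto
  note a = ch_tree[OF ki(1-3), unfolded l] and b = ch_tree[OF ki(4-6), unfolded l]
  note z = zup_chain[folded i_def]
  have pz: "poles (QN zup) = (va i, vb i)" by (simp add: zup_def i_def)
  have vz: "vts (QN zup) = side {i..M} {2 * i<..<2 * M}" and ez: "eds (QN zup) = sedge {i..<M} {2 * i<..<2 * M}"
    using z by simp_all
  have "rooted_decomp VV EE zup (PN (va i) (vb i) [QN (ch (2 * i)), QN (ch (2 * i - 1)), d])"
  proof (rule rooted4[OF a(1) b(1) d(1) z(1) a(3) b(3) d(3) a(2) b(2) d(2) pz])
    show "vts (QN (ch (2 * i))) \<inter> vts (QN (ch (2 * i - 1))) = {va i, vb i}"
      "vts (QN (ch (2 * i - 1))) \<inter> vts d = {va i, vb i}" "vts (QN (ch (2 * i))) \<inter> vts d = {va i, vb i}"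
      "vts (QN (ch (2 * i))) \<inter> vts (QN zup) = {va i, vb i}" "vts (QN (ch (2 * i - 1))) \<inter> vts (QN zup) = {va i, vb i}"
      "vts d \<inter> vts (QN zup) = {va i, vb i}"
      unfolding a(4) b(4) d(4) vz using i by (auto intro!: side_IntI)
    show "vts (QN (ch (2 * i))) \<union> vts (QN (ch (2 * i - 1))) \<union> vts d \<union> vts (QN zup) = VV"
      unfolding a(4) b(4) d(4) vz side_Un VV_side by (rule arg_cong2[where f = side]) (use i in auto)
    show "eds (QN (ch (2 * i))) \<union> eds (QN (ch (2 * i - 1))) \<union> eds d \<union> eds (QN zup) = EE"
      unfolding a(5) b(5) d(5) ez sedge_Un EE_sedge by (rule arg_cong2[where f = sedge]) (use i in auto)
  qed
  moreover have "QN zdn \<in> nodes (PN (va i) (vb i) [QN (ch (2 * i)), QN (ch (2 * i - 1)), d])"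
    "QN (ch (2 * (M - 1))) \<in> nodes (PN (va i) (vb i) [QN (ch (2 * i)), QN (ch (2 * i - 1)), d])"
    using d(6) by (simp_all add: i_def)
  ultimately show ?thesis by blast
qed

lemma root_dn:
  "\<exists>T. rooted_decomp VV EE zdn T \<and> QN zup \<in> nodes T \<and> QN (ch 2) \<in> nodes T"
proof -
  define i where "i = (1::nat)"
  have i: "1 \<le> i" "i < M" using M_ge by (auto simp: i_def)
  obtain d where d: "tree_ok VV EE d" "poles d = (va i, vb i)" "\<not> is_P d" "vts d = side {i..M} {2 * i<..<2 * M}"
    "eds d = sedge {i..<M} {2 * i<..<2 * M}" "QN zup \<in> nodes d" by (rule up_tree[OF i])
  have l: "lv (2 * i) = i" "lv (2 * i - 1) = i" using i by auto
  have ki: "2 * i < 2 * M" "1 \<le> lv (2 * i)" "lv (2 * i) < M" "2 * i - 1 < 2 * M" "1 \<le> lv (2 * i - 1)" "lv (2 * i - 1) < M"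
    using i l by auto
  note a = ch_tree[OF ki(1-3), unfolded l] and b = ch_tree[OF ki(4-6), unfolded l]
  have pz: "poles (QN zdn) = (va i, vb i)" by (simp add: zdn_def i_def)
  have vz: "vts (QN zdn) = side {..i} {..<2 * i - 1}" and ez: "eds (QN zdn) = sedge {..<i} {..<2 * i - 1}"
    using zdn_chain by (simp_all add: i_def)
  have "rooted_decomp VV EE zdn (PN (va i) (vb i) [QN (ch (2 * i)), QN (ch (2 * i - 1)), d])"
  proof (rule rooted4[OF a(1) b(1) d(1) zdn_chain(1) a(3) b(3) d(3) a(2) b(2) d(2) pz])
    show "vts (QN (ch (2 * i))) \<inter> vts (QN (ch (2 * i - 1))) = {va i, vb i}"
      "vts (QN (ch (2 * i - 1))) \<inter> vts d = {va i, vb i}" "vts (QN (ch (2 * i))) \<inter> vts d = {va i, vb i}"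
      "vts (QN (ch (2 * i))) \<inter> vts (QN zdn) = {va i, vb i}" "vts (QN (ch (2 * i - 1))) \<inter> vts (QN zdn) = {va i, vb i}"
      "vts d \<inter> vts (QN zdn) = {va i, vb i}"
      unfolding a(4) b(4) d(4) vz using i by (auto intro!: side_IntI)
    show "vts (QN (ch (2 * i))) \<union> vts (QN (ch (2 * i - 1))) \<union> vts d \<union> vts (QN zdn) = VV"
      unfolding a(4) b(4) d(4) vz side_Un VV_side by (rule arg_cong2[where f = side]) (use i in auto)
    show "eds (QN (ch (2 * i))) \<union> eds (QN (ch (2 * i - 1))) \<union> eds d \<union> eds (QN zdn) = EE"
      unfolding a(5) b(5) d(5) ez sedge_Un EE_sedge by (rule arg_cong2[where f = sedge]) (use i in auto)
  qed
  moreover have "QN zup \<in> nodes (PN (va i) (vb i) [QN (ch (2 * i)), QN (ch (2 * i - 1)), d])"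
    "QN (ch 2) \<in> nodes (PN (va i) (vb i) [QN (ch (2 * i)), QN (ch (2 * i - 1)), d])"
    using d(6) by (simp_all add: i_def)
  ultimately show ?thesis by blast
qed

lemma sp_ladder: "sp_graph VV EE"
proof -
  obtain T where T: "rooted_decomp VV EE zup T" using root_up by blast
  have "{va 0, va 1, vb 0} \<subseteq> VV" using va_in vb_in M_ge by simp
  then have "card {va 0, va 1, vb 0} \<le> card VV" by (rule card_mono[OF finite_VV])
  then have "3 \<le> card VV" by simp
  then show ?thesis
    using rooted_decomp_biconnected[OF simple_ladder T] simple_ladder T by (auto simp: sp_graph_def)
qed

lemma connected_ladder: "connected_graph VV EE"
  using sp_ladder by (simp add: sp_graph_def biconnected_def)

text \<open>Arbitrary decompositions have to be considered, and cuts decide for all of them at once.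
  Each pole needs three incident edges, which leaves the rail vertices of inner levels; and two
  different levels can be separated by removing just two rail edges.\<close>

lemma P_node_poles:
  assumes rd: "rooted_decomp VV EE \<rho> T" and t: "PN u v ts \<in> nodes T"
  shows "\<exists>i. {u, v} = {va i, vb i}"
proof -
  note cut = P_node_cut[OF simple_ladder rd t]
  have ok: "tree_ok VV EE (PN u v ts)"
    using rd t tree_ok_node unfolding rooted_decomp_def tree_ok_def by blast
  have uv: "u \<in> VV" "v \<in> VV" "u \<noteq> v"
    using tree_poles[OF ok] tree_edges[OF ok] by auto
  have deg3: "3 \<le> deg EE w" if w: "w = u \<or> w = v" for w
  proof -
    let ?C = "{e \<in> EE. \<exists>x y. e = {x, y} \<and> x \<in> {w} \<and> y \<notin> {w}}"
    have "3 \<le> card ?C" by (rule cut) (use w uv(3) in auto)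
    also have "?C \<subseteq> (\<lambda>y. {w, y}) ` nbrs EE w" by (auto simp: nbrs_def insert_commute)
    then have "card ?C \<le> card (nbrs EE w)"
      using simple_graph_finite(3)[OF simple_ladder] by (metis (no_types, lifting) surj_card_le)
    finally show ?thesis by (simp add: deg_def)
  qed
  have lev: "\<exists>i. 0 < i \<and> i < M \<and> (w = va i \<or> w = vb i)" if w: "w \<in> VV" "3 \<le> deg EE w" for w
    using w(1)
  proof (cases rule: VV_cases)
    case (1 i)
    then show ?thesis using w(2) deg_va[of i] by (auto split: if_splits)
  next
    case (2 i)
    then show ?thesis using w(2) deg_vb[of i] by (auto split: if_splits)
  next
    case (3 k j)
    then show ?thesis using w(2) deg_vx[of k j] by simp
  qed
  obtain i j where i: "u = va i \<or> u = vb i" "i < M" and j: "v = va j \<or> v = vb j" "j < M"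
    using lev[OF uv(1) deg3] lev[OF uv(2) deg3] by blast
  have "i = j"
  proof (rule ccontr)
    assume "i \<noteq> j"
    define l where "l = min i j"
    \<comment> \<open>Chain \<open>2 * l\<close> is the last one at level \<open>l\<close>, so the
      set contains whole chains and only the two rail edges above level \<open>l\<close> leave
      it.\<close>
    let ?S = "side {..l} {..2 * l}"
    let ?C = "{e \<in> EE. \<exists>x y. e = {x, y} \<and> x \<in> ?S \<and> y \<notin> ?S}"
    have "(u \<in> ?S) \<noteq> (v \<in> ?S)" using i j \<open>i \<noteq> j\<close> by (auto simp: l_def)
    then have "3 \<le> card ?C" by (rule cut)
    moreover have "?C \<subseteq> {{va l, va (Suc l)}, {vb l, vb (Suc l)}}"
    proof
      fix e assume "e \<in> ?C"
      then obtain x y where xy: "e = {x, y}" "x \<in> ?S" "y \<notin> ?S" "adj x y \<or> adj y x"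
        using edge_iff by blast
      have pvS: "pv k t \<in> ?S \<longleftrightarrow> k \<le> 2 * l" if "k < 2 * M" "t \<le> Suc (len k)" for k t
      proof -
        have "lv k \<le> l \<longleftrightarrow> k \<le> 2 * l" by (auto simp: lv_def)
        then show ?thesis using that by (auto simp: pv_def)
      qed
      show "e \<in> {{va l, va (Suc l)}, {vb l, vb (Suc l)}}"
        using xy(4)
      proof
        assume "adj x y"
        then show ?thesis
          unfolding adj_def
        proof (elim disjE exE conjE)
          fix t assume "t < M" "x = va t" "y = va (Suc t)"
          then show ?thesis using xy by (auto simp: le_Suc_eq)
        next
          fix t assume "t < M" "x = vb t" "y = vb (Suc t)"
          then show ?thesis using xy by (auto simp: le_Suc_eq)
        next
          fix k t assume "k < 2 * M" "t \<le> len k" "x = pv k t" "y = pv k (Suc t)"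
          then show ?thesis using xy pvS[of k t] pvS[of k "Suc t"] by auto
        qed
      next
        assume "adj y x"
        then show ?thesis
          unfolding adj_def
        proof (elim disjE exE conjE)
          fix k t assume "k < 2 * M" "t \<le> len k" "y = pv k t" "x = pv k (Suc t)"
          then show ?thesis using xy pvS[of k t] pvS[of k "Suc t"] by auto
        qed (use xy in auto)
      qed
    qed
    then have "card ?C \<le> card {{va l, va (Suc l)}, {vb l, vb (Suc l)}}" by (intro card_mono) auto
    then have "card ?C \<le> 2" by (simp add: card_insert_if split: if_splits)
    ultimately show False by simp
  qed
  then show ?thesis using i j uv(3) by (auto simp: insert_commute)
qed

lemma indep_parallel_ladder: "indep_parallel VV EE"
  unfolding indep_parallel_def
proof (intro allI impI ballI)
  fix \<rho> T t1 t2
  assume rd: "rooted_decomp VV EE \<rho> T" and t: "t1 \<in> nodes T" "t2 \<in> nodes T" and "is_P t1 \<and> is_P t2 \<and> t1 \<noteq> t2"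
  then have P: "is_P t1" "is_P t2" "t1 \<noteq> t2" by auto
  have ok: "tree_ok VV EE T" using rd by (simp add: rooted_decomp_def tree_ok_def)
  have pp: "\<exists>i. {fst (poles t), snd (poles t)} = {va i, vb i}" if "t \<in> nodes T" "is_P t" for t
    using P_node_poles[OF rd] that by (cases t) auto
  show "{fst (poles t1), snd (poles t1)} \<inter> {fst (poles t2), snd (poles t2)} = {}"
  proof (rule ccontr)
    assume ne: "{fst (poles t1), snd (poles t1)} \<inter> {fst (poles t2), snd (poles t2)} \<noteq> {}"
    obtain i j where "{fst (poles t1), snd (poles t1)} = {va i, vb i}" "{fst (poles t2), snd (poles t2)} = {va j, vb j}"
      using pp[OF t(1) P(1)] pp[OF t(2) P(2)] by blast
    then have "{fst (poles t1), snd (poles t1)} = {fst (poles t2), snd (poles t2)}" using ne by auto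
    then show False using P_nodes_unique[OF ok t P(1,2)] P(3) by blast
  qed
qed

end

section \<open>Forced spirality\<close>

lemma perm3:
  fixes a b c :: int
  assumes "a \<in> {0..3}" "b \<in> {0..3}" "c \<in> {0..3}" "a \<noteq> 0" "b \<noteq> 0" "c \<noteq> 0" "a \<noteq> b" "a \<noteq> c" "b \<noteq> c"
  shows "(a, b, c) \<in> {(1, 2, 3), (1, 3, 2), (2, 1, 3), (2, 3, 1), (3, 1, 2), (3, 2, 1)}"
proof -
  have "a = 1 \<or> a = 2 \<or> a = 3" "b = 1 \<or> b = 2 \<or> b = 3" "c = 1 \<or> c = 2 \<or> c = 3" using assms by auto
  then show ?thesis using assms(7-9) by auto
qed

text \<open>In the two lemmas below, the position of an edge at the first (second) pole is its clockwise index
  around that pole, so that \<open>(position b - position a) mod 4 - 2\<close> is the turn from \<open>a\<close> to \<open>b\<close>.\<close>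

lemma step_arith:
  fixes w x y r B :: int
  assumes a: "(pp, pq, pr) \<in> {(1, 2, 3), (1, 3, 2), (2, 1, 3), (2, 3, 1), (3, 1, 2), (3, 2, 1::int)}"
    and b: "(qp, qq, qr) \<in> {(1, 2, 3), (1, 3, 2), (2, 1, 3), (2, 3, 1), (3, 1, 2), (3, 2, 1::int)}"
    and w: "x = w - pp + qp" "y = w - pq + qq" "r = w - pr + qr"
    and c: "\<bar>x - y + ((qq - qp) mod 4 - 2) + ((pp - pq) mod 4 - 2)\<bar> = 4"
      "\<bar>x - r + ((qr - qp) mod 4 - 2) + ((pp - pr) mod 4 - 2)\<bar> = 4"
      "\<bar>y - r + ((qr - qq) mod 4 - 2) + ((pq - pr) mod 4 - 2)\<bar> = 4"
    and B: "\<bar>x\<bar> \<le> B" "\<bar>y\<bar> \<le> B" "B \<le> \<bar>w\<bar>" "0 < B"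
  shows "\<bar>r\<bar> \<ge> B + 2"
proof -
  have d: "x - y = pq - pp + qp - qq" "x - r = pr - pp + qp - qr" "y - r = pr - pq + qq - qr"
    using w by simp_all
  note c' = c[unfolded d]
  \<comment> \<open>Among all pairs of orders at the two poles, the three cycle conditions admit
    only mirrored ones. The three turns are therefore \<open>w + 2\<close>, \<open>w\<close> and
    \<open>w - 2\<close> in some order.\<close>
  have q: "qp = 4 - pp" "qq = 4 - pq" "qr = 4 - pr"
    using a b c' by (elim insertE emptyE Pair_inject; hypsubst; simp)+
  have p: "(pp, pq, pr) \<in> {(1, 2, 3), (1, 3, 2), (2, 1, 3), (2, 3, 1), (3, 1, 2), (3, 2, 1::int)}" by (rule a)
  show ?thesis
    \<comment> \<open>One of these turns has absolute value \<open>\<bar>w\<bar> + 2\<close>, which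
      exceeds \<open>B\<close>; it is neither \<open>x\<close> nor \<open>y\<close>, so it must be
      \<open>r\<close>.\<close>
    using p B unfolding w q by (elim insertE emptyE Pair_inject; hypsubst; simp; arith)
qed

lemma base_arith:
  fixes c d u u' v v' :: int
  assumes a: "(pd, pu, pv) \<in> {(1, 2, 3), (1, 3, 2), (2, 1, 3), (2, 3, 1), (3, 1, 2), (3, 2, 1::int)}"
    and b: "(qd, qu, qv) \<in> {(1, 2, 3), (1, 3, 2), (2, 1, 3), (2, 3, 1), (3, 1, 2), (3, 2, 1::int)}"
    and cd: "\<bar>c\<bar> \<le> 1" "\<bar>d\<bar> \<le> 1" "\<bar>c - d + (qd mod 4 - 2) + ((- pd) mod 4 - 2)\<bar> = 4"
    and cu: "\<And>u. u \<in> U \<Longrightarrow> \<bar>c - u + (qu mod 4 - 2) + ((- pu) mod 4 - 2)\<bar> = 4"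
    and cv: "\<And>v. v \<in> V \<Longrightarrow> \<bar>c - v + (qv mod 4 - 2) + ((- pv) mod 4 - 2)\<bar> = 4"
    and uv: "\<And>u v. u \<in> U \<Longrightarrow> v \<in> V \<Longrightarrow> \<bar>u - v + ((qv - qu) mod 4 - 2) + ((pu - pv) mod 4 - 2)\<bar> = 4"
    and in_UV: "u \<in> U" "u' \<in> U" "v \<in> V" "v' \<in> V"
  shows "3 \<le> \<bar>u\<bar> \<and> 3 \<le> \<bar>v\<bar> \<and> (u = u' \<or> v = v')"
proof -
  have p: "pd = 1 \<or> pd = 2 \<or> pd = 3" and q: "qd = 1 \<or> qd = 2 \<or> qd = 3" using a b by auto
  then have "(- pd) mod 4 = 4 - pd" "qd mod 4 = qd" by auto
  then have "\<bar>c - d + qd - pd\<bar> = 4" using cd(3) by simp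
  \<comment> \<open>The turns differ by at most 2 and so do the positions, so 4 is attained only at
    the extremes: the two chains turn oppositely and are neighbours at both poles.\<close>
  then have *: "(c = 1 \<and> d = -1 \<and> pd = 1 \<and> qd = 3) \<or> (c = -1 \<and> d = 1 \<and> pd = 3 \<and> qd = 1)"
  proof -
    have b: "1 \<le> pd" "pd \<le> 3" "1 \<le> qd" "qd \<le> 3" "- 1 \<le> c" "c \<le> 1" "- 1 \<le> d" "d \<le> 1"
      using p q cd(1,2) by auto
    assume "\<bar>c - d + qd - pd\<bar> = 4"
    then have "c - d + qd - pd = 4 \<or> c - d + qd - pd = - 4" by linarith
    then show ?thesis
    proof
      assume "c - d + qd - pd = 4"
      then have "c = 1" "d = -1" "pd = 1" "qd = 3" using b by linarith+
      then show ?thesis by blast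
    next
      assume "c - d + qd - pd = - 4"
      then have "c = -1" "d = 1" "pd = 3" "qd = 1" using b by linarith+
      then show ?thesis by blast
    qed
  qed
  \<comment> \<open>The sign \<open>e\<close> says on which side of the two chains the wing of
    \<open>U\<close> leaves, so that one formula covers all admissible orders.\<close>
  define e where "e = (if pu = 2 then c else - c)"
  have e: "e = 1 \<or> e = -1" using * by (auto simp: e_def)
  have pos: "(c, pu, pv, qu, qv) \<in> {(1, 2, 3, 1, 2), (1, 2, 3, 2, 1), (1, 3, 2, 1, 2), (1, 3, 2, 2, 1),
      (-1, 1, 2, 2, 3), (-1, 1, 2, 3, 2), (-1, 2, 1, 2, 3), (-1, 2, 1, 3, 2)}"
    using a b * by (elim insertE emptyE Pair_inject; hypsubst; simp)
  have r: "pu \<in> {1..3}" "pv \<in> {1..3}" "qu \<in> {1..3}" "qv \<in> {1..3}" using a b by auto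
  have minus: "(- t) mod 4 = 4 - t" "t mod 4 = t" if "t \<in> {1..3}" for t :: int
  proof -
    have "t = 1 \<or> t = 2 \<or> t = 3" using that by auto
    then show "(- t) mod 4 = 4 - t" "t mod 4 = t" by auto
  qed
  \<comment> \<open>Regularly the four turns are 1, -1, -3 and 3 up to sign. The values
    \<open>5 * e\<close> and \<open>-5 * e\<close> mean that the external face lies between the two
    chains and the path considered; since there is only one such face, they exclude each
    other.\<close>
  have main: "(x = -3 * e \<or> x = 5 * e) \<and> (y = 3 * e \<or> y = -5 * e) \<and> \<not> (x = 5 * e \<and> y = -5 * e)"
    if xy: "x \<in> U" "y \<in> V" for x y
  proof -
    have "x = c + qu - pu - 4 \<or> x = c + qu - pu + 4"
      using cu[OF xy(1)] unfolding minus[OF r(1)] minus[OF r(3)] by linarith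
    moreover have "y = c + qv - pv - 4 \<or> y = c + qv - pv + 4"
      using cv[OF xy(2)] unfolding minus[OF r(2)] minus[OF r(4)] by linarith
    ultimately show ?thesis
      using pos uv[OF xy] unfolding e_def by (elim insertE emptyE disjE Pair_inject; hypsubst; simp)
  qed
  \<comment> \<open>If \<open>U\<close> takes two values, one of them is \<open>5 * e\<close>, and
    \<open>V\<close> is left with \<open>3 * e\<close> alone.\<close>
  show ?thesis
    using main[OF in_UV(1,3)] main[OF in_UV(1,4)] main[OF in_UV(2,3)] main[OF in_UV(2,4)] e by auto
qed

context rectilinear
begin

lemma pt_extend:
  assumes "q \<noteq> []"
  shows "pt rot ang (x # (u # q @ [v]) @ [y]) = turn rot ang x u (hd q) + pt rot ang (u # q @ [v]) + turn rot ang (last q) v y"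
proof -
  obtain h t where q: "q = h # t" using assms by (cases q) auto
  obtain i l where q': "q = i @ [l]" using assms by (cases q rule: rev_cases) auto
  have "pt rot ang (x # (u # q @ [v]) @ [y]) = turn rot ang x u h + pt rot ang (u # q @ [v, y])"
    by (simp add: q)
  also have "pt rot ang (u # q @ [v, y]) = pt rot ang (u # q @ [v]) + turn rot ang l v y"
    using pt_append[of rot ang "u # i" l v "[y]"] by (simp add: q')
  finally show ?thesis using q q' by (metis add.assoc last_snoc list.sel(1))
qed

end

locale wing_rep = wing m L A K B zi N + rectilinear VV EE rot ang d0
  for m L A K B zi N and rot ang :: "nat \<Rightarrow> nat \<Rightarrow> nat" and d0
begin

definition val :: "nat \<Rightarrow> nat list \<Rightarrow> int" where
  "val n q = pt rot ang (va (L n) # q @ [vb (L n)])"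

lemma deg4:
  assumes "n \<le> N"
  shows "card (nbrs EE (va (L n))) = 4" "card (nbrs EE (vb (L n))) = 4" "va (L n) \<in> VV" "vb (L n) \<in> VV"
  using deg_va[of "L n"] deg_vb[of "L n"] L_rng[OF assms] va_in[of "L n"] vb_in[of "L n"]
  by (auto simp: deg_def)

lemma path_end_nbrs:
  assumes "q \<noteq> []" "path_edges (u # q @ [v]) \<subseteq> EE"
  shows "hd q \<in> nbrs EE u" "last q \<in> nbrs EE v"
proof -
  obtain h t where q: "q = h # t" using assms(1) by (cases q) auto
  obtain i l where q': "q = i @ [l]" using assms(1) by (cases q rule: rev_cases) auto
  have "{u, h} \<in> path_edges (u # q @ [v])" by (simp add: q path_edges_Cons)
  then show "hd q \<in> nbrs EE u" using assms(2) by (auto simp: q nbrs_def insert_commute)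
  have "path_edges (u # q @ [v]) = path_edges ((u # i) @ [l]) \<union> path_edges (l # [v])"
    using path_edges_append[of "u # i" l "[v]"] by (simp add: q')
  then have "{l, v} \<in> path_edges (u # q @ [v])" by (simp add: path_edges_Cons)
  then show "last q \<in> nbrs EE v" using assms(2) by (auto simp: q' nbrs_def)
qed

lemma xs_facts:
  assumes "n \<le> N" "k = 2 * L n \<or> k = 2 * L n - 1"
  shows "xs k \<noteq> []" "distinct (va (L n) # xs k @ [vb (L n)])" "path_edges (va (L n) # xs k @ [vb (L n)]) \<subseteq> EE"
    "set (xs k) = side {} {k}" "\<bar>val n (xs k)\<bar> \<le> int (len k)"
proof -
  note x = xs_path[OF assms]
  show "xs k \<noteq> []" by (rule xs_props(1))
  show d: "distinct (va (L n) # xs k @ [vb (L n)])" unfolding x(1) by (rule distinct_ch)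
  show p: "path_edges (va (L n) # xs k @ [vb (L n)]) \<subseteq> EE" unfolding x(1) by (rule x(2))
  show "set (xs k) = side {} {k}" by (rule set_xs_side)
  show "\<bar>val n (xs k)\<bar> \<le> int (len k)" using pt_bound[OF d p] xs_props(3)[of k] by (simp add: val_def)
qed

lemma cycle:
  assumes n: "n \<le> N" and "p \<noteq> []" "q \<noteq> []"
    and "distinct (va (L n) # p @ [vb (L n)])" "distinct (va (L n) # q @ [vb (L n)])" "set p \<inter> set q = {}"
    and "path_edges (va (L n) # p @ [vb (L n)]) \<subseteq> EE" "path_edges (va (L n) # q @ [vb (L n)]) \<subseteq> EE"
  shows "\<bar>val n p - val n q + turn rot ang (last p) (vb (L n)) (last q) + turn rot ang (hd q) (va (L n)) (hd p)\<bar> = 4"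
  unfolding val_def by (rule two_paths_turn) (use assms in auto)

text \<open>Every path through the next larger wing turns by the same \<open>w\<close>. Removing the
  corners at the rails gives the turns of the two chains and of the smaller wing in terms of their
  positions at the poles. The chains are too short to turn by more than \<open>b\<close>, so
  \<open>step_arith\<close> assigns the large turn to the wing.\<close>

lemma step:
  assumes n: "n < N" and w: "\<forall>q\<in>ipths (Suc n). val (Suc n) q = w"
    and B: "len (2 * L n) \<le> b" "len (2 * L n - 1) \<le> b" "int b \<le> \<bar>w\<bar>"
  shows "\<exists>w'. \<bar>w'\<bar> \<ge> int b + 2 \<and> (\<forall>q\<in>ipths n. val n q = w')"
proof -
  have nN: "n \<le> N" "Suc n \<le> N" using n by auto
  let ?a = "va (L n)" and ?b = "vb (L n)" and ?oa = "va (L (Suc n))" and ?ob = "vb (L (Suc n))"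
  let ?p = "xs (2 * L n)" and ?q = "xs (2 * L n - 1)"
  have ne12: "2 * L n \<noteq> 2 * L n - 1" using lvs[OF nN(1)] by simp
  note P = xs_facts[OF nN(1), of "2 * L n", OF disjI1[OF refl]] and Q = xs_facts[OF nN(1), of "2 * L n - 1", OF disjI2[OF refl]]
  note d4 = deg4[OF nN(1)]
  have oa: "?oa \<in> nbrs EE ?a" and ob: "?ob \<in> nbrs EE ?b"
    using ladder_edge[OF n] by (auto simp: nbrs_def insert_commute)
  \<comment> \<open>Positions are counted from the rail edge towards level \<open>L (Suc n)\<close>,
    so the turn between this edge and a path involves the position of the path only.\<close>
  obtain pa where pa: "pa ?oa = 0" "inj_on pa (nbrs EE ?a)" "\<And>x. x \<in> nbrs EE ?a \<Longrightarrow> pa x \<in> {0..3}"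
    "\<And>x y. x \<in> nbrs EE ?a \<Longrightarrow> y \<in> nbrs EE ?a \<Longrightarrow> x \<noteq> y \<Longrightarrow> turn rot ang x ?a y = (pa y - pa x) mod 4 - 2"
    using deg4_positions[OF d4(3,1) oa] by metis
  obtain pb where pb: "pb ?ob = 0" "inj_on pb (nbrs EE ?b)" "\<And>x. x \<in> nbrs EE ?b \<Longrightarrow> pb x \<in> {0..3}"
    "\<And>x y. x \<in> nbrs EE ?b \<Longrightarrow> y \<in> nbrs EE ?b \<Longrightarrow> x \<noteq> y \<Longrightarrow> turn rot ang x ?b y = (pb y - pb x) mod 4 - 2"
    using deg4_positions[OF d4(4,2) ob] by metis
  have ext: "val n q = w - (pa (hd q) - 2) - ((- pb (last q)) mod 4 - 2)"
    if q: "q \<in> {?p, ?q} \<union> ipths n" "q \<noteq> []" "hd q \<in> nbrs EE ?a" "last q \<in> nbrs EE ?b" "hd q \<noteq> ?oa" "last q \<noteq> ?ob" for q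
  proof -
    have "?a # q @ [?b] \<in> ipths (Suc n)" unfolding ipths.simps by (rule imageI[OF q(1)])
    then have "val (Suc n) (?a # q @ [?b]) = w" using w by blast
    then have "turn rot ang ?oa ?a (hd q) + val n q + turn rot ang (last q) ?b ?ob = w"
      using pt_extend[OF q(2), of ?oa ?a ?b ?ob] unfolding val_def by simp
    moreover have "turn rot ang ?oa ?a (hd q) = pa (hd q) mod 4 - 2"
      using pa(4)[OF oa q(3)] q(5) pa(1) by auto
    moreover have "pa (hd q) mod 4 = pa (hd q)" using pa(3)[OF q(3)] by simp
    moreover have "turn rot ang (last q) ?b ?ob = (- pb (last q)) mod 4 - 2"
      using pb(4)[OF q(4) ob] q(6) pb(1) by auto
    ultimately show ?thesis by linarith
  qed
  \<comment> \<open>The second conjunct expresses the turn through the end edges shared by all paths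
    of the wing; this makes it one common value.\<close>
  have main: "\<bar>val n r\<bar> \<ge> int b + 2 \<and> val n r = w - pa (ha n) + pb (hb n)" if r: "r \<in> ipths n" for r
  proof -
    note R = ipths_props[OF nN(1) r]
    have Rset: "set r \<subseteq> side (A n) (K n)" using R by blast
    have Kd: "2 * L n \<notin> K n" "2 * L n - 1 \<notin> K n" using K_disj[OF nN(1)] by auto
    have dis: "set ?p \<inter> set ?q = {}" "set ?p \<inter> set r = {}" "set ?q \<inter> set r = {}"
    proof -
      show "set ?p \<inter> set ?q = {}" unfolding P(4) Q(4) side_Int using ne12 by (simp add: side_empty)
      have "set ?p \<inter> side (A n) (K n) = {}" "set ?q \<inter> side (A n) (K n) = {}"
        unfolding P(4) Q(4) side_Int using Kd by (simp_all add: side_empty)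
      then show "set ?p \<inter> set r = {}" "set ?q \<inter> set r = {}" using Rset by blast+
    qed
    have on: "?oa \<notin> side (A n) (K n)" "?ob \<notin> side (A n) (K n)" using L_notin[OF n] by simp_all
    have ends: "hd x \<in> set x \<and> last x \<in> set x" if "x \<noteq> []" for x :: "nat list" using that by simp
    note ep = ends[OF P(1)] and eq = ends[OF Q(1)] and er = ends[of r]
    have Rne: "r \<noteq> []" using R by blast
    have np: "hd ?p \<in> nbrs EE ?a" "last ?p \<in> nbrs EE ?b" using path_end_nbrs[OF P(1,3)] .
    have nq: "hd ?q \<in> nbrs EE ?a" "last ?q \<in> nbrs EE ?b" using path_end_nbrs[OF Q(1,3)] .
    have nr: "hd r \<in> nbrs EE ?a" "last r \<in> nbrs EE ?b" using path_end_nbrs[OF Rne] R by blast+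
    have opq: "?oa \<notin> set ?p" "?oa \<notin> set ?q" "?ob \<notin> set ?p" "?ob \<notin> set ?q" unfolding P(4) Q(4) by simp_all
    have or: "?oa \<notin> set r" "?ob \<notin> set r" using on Rset by blast+
    have nes: "hd ?p \<noteq> ?oa" "hd ?q \<noteq> ?oa" "hd r \<noteq> ?oa" "last ?p \<noteq> ?ob" "last ?q \<noteq> ?ob" "last r \<noteq> ?ob"
      "hd ?p \<noteq> hd ?q" "hd ?p \<noteq> hd r" "hd ?q \<noteq> hd r" "last ?p \<noteq> last ?q" "last ?p \<noteq> last r" "last ?q \<noteq> last r"
      using ep eq er[OF Rne] opq or dis by (metis disjoint_iff)+
    have pdist: "pa x \<noteq> pa y" if "x \<in> nbrs EE ?a" "y \<in> nbrs EE ?a" "x \<noteq> y" for x y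
      using pa(2) that by (auto simp: inj_on_def)
    have qdist: "pb x \<noteq> pb y" if "x \<in> nbrs EE ?b" "y \<in> nbrs EE ?b" "x \<noteq> y" for x y
      using pb(2) that by (auto simp: inj_on_def)
    have PA: "(pa (hd ?p), pa (hd ?q), pa (hd r)) \<in> {(1, 2, 3), (1, 3, 2), (2, 1, 3), (2, 3, 1), (3, 1, 2), (3, 2, 1)}"
      by (rule perm3) (use pa(1,3) np nq nr oa nes pdist in metis)+
    have PB: "(pb (last ?p), pb (last ?q), pb (last r)) \<in> {(1, 2, 3), (1, 3, 2), (2, 1, 3), (2, 3, 1), (3, 1, 2), (3, 2, 1)}"
      by (rule perm3) (use pb(1,3) np nq nr ob nes qdist in metis)+
    have rng: "pb (last x) \<in> {1, 2, 3}" if "x \<in> {?p, ?q, r}" for x using PB that by auto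
    have negmod: "(- t) mod 4 - 2 = 2 - t" if "t \<in> {1, 2, 3}" for t :: int using that by auto
    have vp: "val n ?p = w - pa (hd ?p) + pb (last ?p)"
      using ext[OF _ P(1) np nes(1,4)] negmod[OF rng[of ?p]] by simp
    have vq: "val n ?q = w - pa (hd ?q) + pb (last ?q)"
      using ext[OF _ Q(1) nq nes(2,5)] negmod[OF rng[of ?q]] by simp
    have vr: "val n r = w - pa (hd r) + pb (last r)"
      using ext[OF _ Rne nr nes(3,6)] r negmod[OF rng[of r]] by simp
    have Rc: "distinct (?a # r @ [?b])" "path_edges (?a # r @ [?b]) \<subseteq> EE" using R by blast+
    have c1: "\<bar>val n ?p - val n ?q + ((pb (last ?q) - pb (last ?p)) mod 4 - 2) + ((pa (hd ?p) - pa (hd ?q)) mod 4 - 2)\<bar> = 4"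
      using cycle[OF nN(1) P(1) Q(1) P(2) Q(2) dis(1) P(3) Q(3)]
      unfolding pa(4)[OF nq(1) np(1) nes(7)[symmetric]] pb(4)[OF np(2) nq(2) nes(10)] .
    have c2: "\<bar>val n ?p - val n r + ((pb (last r) - pb (last ?p)) mod 4 - 2) + ((pa (hd ?p) - pa (hd r)) mod 4 - 2)\<bar> = 4"
      using cycle[OF nN(1) P(1) Rne P(2) Rc(1) dis(2) P(3) Rc(2)]
      unfolding pa(4)[OF nr(1) np(1) nes(8)[symmetric]] pb(4)[OF np(2) nr(2) nes(11)] .
    have c3: "\<bar>val n ?q - val n r + ((pb (last r) - pb (last ?q)) mod 4 - 2) + ((pa (hd ?q) - pa (hd r)) mod 4 - 2)\<bar> = 4"
      using cycle[OF nN(1) Q(1) Rne Q(2) Rc(1) dis(3) Q(3) Rc(2)]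
      unfolding pa(4)[OF nr(1) nq(1) nes(9)[symmetric]] pb(4)[OF nq(2) nr(2) nes(12)] .
    have "0 < b" using B(1) len_pos(1)[of "2 * L n"] by linarith
    then have "\<bar>val n r\<bar> \<ge> int b + 2"
      by (intro step_arith[OF PA PB vp vq vr c1 c2 c3]) (use P(5) Q(5) B in auto)
    moreover have "hd r = ha n" "last r = hb n" using R by auto
    ultimately show ?thesis using vr by simp
  qed
  have "ipths n \<noteq> {}" by (cases n) auto
  then obtain r0 where "r0 \<in> ipths n" by blast
  then show ?thesis using main by (intro exI[of _ "w - pa (ha n) + pb (hb n)"]) metis
qed

text \<open>The induction runs from the middle level at \<open>n = m\<close> to the extreme chain at
  \<open>n = 0\<close>. After \<open>k\<close> steps the turn is at least \<open>2 * k + 3\<close>,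
  exactly the length that \<open>lens\<close> allows the chains of the next level, so
  \<open>step\<close> applies again.\<close>

lemma spiral:
  assumes mN: "m \<le> N" and lens: "\<And>n. n < m \<Longrightarrow> len (2 * L n) \<le> 2 * (m - n) + 1 \<and> len (2 * L n - 1) \<le> 2 * (m - n) + 1"
    and base: "\<bar>w\<bar> \<ge> 3" "\<forall>q\<in>ipths m. val m q = w"
  shows "\<bar>pt rot ang z\<bar> \<ge> int (2 * m + 3)"
proof -
  have "\<exists>w. \<bar>w\<bar> \<ge> int (2 * k + 3) \<and> (\<forall>q\<in>ipths (m - k). val (m - k) q = w)" if "k \<le> m" for k
    using that
  proof (induction k)
    case 0
    then show ?case using base by auto
  next
    case (Suc k)
    then obtain w where w: "\<bar>w\<bar> \<ge> int (2 * k + 3)" "\<forall>q\<in>ipths (m - k). val (m - k) q = w" by auto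
    let ?n = "m - Suc k"
    have n: "?n < N" "Suc ?n = m - k" "?n < m" "m - ?n = Suc k" using Suc.prems mN by auto
    have "\<exists>w'. \<bar>w'\<bar> \<ge> int (2 * k + 3) + 2 \<and> (\<forall>q\<in>ipths ?n. val ?n q = w')"
      using lens[OF n(3)] w unfolding n(4) by (intro step[OF n(1), unfolded n(2)]) auto
    then show ?case by auto
  qed
  from this[of m] show ?thesis by (auto simp: val_def z_def)
qed

text \<open>The cycle through both chains has turning number 4 in absolute value, and its two
  corners at the poles contribute at most 1 each.\<close>

lemma neighbour_bound: "\<bar>pt rot ang z - pt rot ang (ch (2 * L 0))\<bar> \<le> 6"
proof -
  have n: "0 \<le> N" by simp
  note P = xs_facts[OF n, of "2 * L 0", OF disjI1[OF refl]]
  have r: "zi \<in> ipths 0" by simp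
  note R = ipths_props[OF n r]
  have Rne: "zi \<noteq> []" and Rc: "distinct (va (L 0) # zi @ [vb (L 0)])" "path_edges (va (L 0) # zi @ [vb (L 0)]) \<subseteq> EE"
    "set zi \<subseteq> side (A 0) (K 0)"
    using R by blast+
  have "set (xs (2 * L 0)) \<inter> side (A 0) (K 0) = {}"
    unfolding P(4) side_Int using K_disj[OF n] by (simp add: side_empty)
  then have dis: "set (xs (2 * L 0)) \<inter> set zi = {}" using Rc(3) by blast
  have eds: "hd zi \<in> nbrs EE (va (L 0))" "last zi \<in> nbrs EE (vb (L 0))"
    "hd (xs (2 * L 0)) \<in> nbrs EE (va (L 0))" "last (xs (2 * L 0)) \<in> nbrs EE (vb (L 0))"
    using path_end_nbrs[OF Rne Rc(2)] path_end_nbrs[OF P(1,3)] by auto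
  have "hd zi \<noteq> hd (xs (2 * L 0))" "last (xs (2 * L 0)) \<noteq> last zi"
    using dis hd_in_set[OF Rne] hd_in_set[OF P(1)] last_in_set[OF Rne] last_in_set[OF P(1)] by (metis disjoint_iff)+
  then have "\<bar>turn rot ang (last (xs (2 * L 0))) (vb (L 0)) (last zi)\<bar> \<le> 1"
    "\<bar>turn rot ang (hd zi) (va (L 0)) (hd (xs (2 * L 0)))\<bar> \<le> 1"
    using eds by (auto intro!: turn_swap(2) simp: nbrs_def insert_commute)
  moreover have "\<bar>val 0 (xs (2 * L 0)) - val 0 zi + turn rot ang (last (xs (2 * L 0))) (vb (L 0)) (last zi)
      + turn rot ang (hd zi) (va (L 0)) (hd (xs (2 * L 0)))\<bar> = 4"
    by (rule cycle[OF n P(1) Rne P(2) Rc(1) dis P(3) Rc(2)])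
  moreover have "val 0 (xs (2 * L 0)) = pt rot ang (ch (2 * L 0))"
    using xs_path(1)[OF n, of "2 * L 0"] by (simp add: val_def)
  moreover have "val 0 zi = pt rot ang z" by (simp add: val_def z_def)
  ultimately show ?thesis by linarith
qed

end

locale ladder_rep = ladder m + rectilinear VV EE rot ang d0
  for m and rot ang :: "nat \<Rightarrow> nat \<Rightarrow> nat" and d0
begin

lemma s_val: "s k = 2 * int (k div 2) - 2 * int m - 1"
  by (simp add: s_def M_def)

text \<open>At the middle level both chains have a single inner vertex. Hence one of the two wings has the
  same turn along all its paths; which one depends on the position of the external face.\<close>

lemma middle:
  assumes up: "wing m L1 A1 K1 B1 z1 N1" and dn: "wing m L2 A2 K2 B2 z2 N2"
    and n: "n1 \<le> N1" "n2 \<le> N2" and L: "L1 n1 = Suc m" "L2 n2 = Suc m"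
    and dis: "A1 n1 \<inter> A2 n2 = {Suc m}" "K1 n1 \<inter> K2 n2 = {}"
  shows "(\<exists>w. \<bar>w\<bar> \<ge> 3 \<and> (\<forall>q\<in>wing.ipths m L1 z1 n1. pt rot ang (va (Suc m) # q @ [vb (Suc m)]) = w))
    \<or> (\<exists>w. \<bar>w\<bar> \<ge> 3 \<and> (\<forall>q\<in>wing.ipths m L2 z2 n2. pt rot ang (va (Suc m) # q @ [vb (Suc m)]) = w))"
proof -
  interpret u: wing_rep m L1 A1 K1 B1 z1 N1 rot ang d0
    using up rectilinear_axioms by (rule wing_rep.intro)
  interpret d: wing_rep m L2 A2 K2 B2 z2 N2 rot ang d0
    using dn rectilinear_axioms by (rule wing_rep.intro)
  let ?a = "va (Suc m)" and ?b = "vb (Suc m)" and ?p = "xs (2 * Suc m)" and ?q = "xs (2 * Suc m - 1)"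
  define vl where "vl r = pt rot ang (?a # r @ [?b])" for r
  have uval: "u.val n1 r = vl r" for r
    by (simp add: u.val_def vl_def L)
  note P = u.xs_facts[OF n(1), of "2 * L1 n1", OF disjI1[OF refl], unfolded L uval]
  note Q = u.xs_facts[OF n(1), of "2 * L1 n1 - 1", OF disjI2[OF refl], unfolded L uval]
  note d4 = u.deg4[OF n(1), unfolded L]
  have ipu: "r \<noteq> [] \<and> distinct (?a # r @ [?b]) \<and> set r \<subseteq> side (A1 n1) (K1 n1) \<and> path_edges (?a # r @ [?b]) \<subseteq> EE
    \<and> hd r = u.ha n1 \<and> last r = u.hb n1" if "r \<in> u.ipths n1" for r
    using u.ipths_props[OF n(1) that] unfolding L .
  have ipd: "r \<noteq> [] \<and> distinct (?a # r @ [?b]) \<and> set r \<subseteq> side (A2 n2) (K2 n2) \<and> path_edges (?a # r @ [?b]) \<subseteq> EE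
    \<and> hd r = d.ha n2 \<and> last r = d.hb n2" if "r \<in> d.ipths n2" for r
    using d.ipths_props[OF n(2) that] unfolding L .
  have lens: "len (2 * Suc m) = 1" "len (2 * Suc m - 1) = 1"
    by (simp_all add: len_def s_val)
  have cyc: "\<bar>vl p - vl q + turn rot ang (last p) ?b (last q) + turn rot ang (hd q) ?a (hd p)\<bar> = 4"
    if "p \<noteq> []" "q \<noteq> []" "distinct (?a # p @ [?b])" "distinct (?a # q @ [?b])" "set p \<inter> set q = {}"
      "path_edges (?a # p @ [?b]) \<subseteq> EE" "path_edges (?a # q @ [?b]) \<subseteq> EE" for p q
    unfolding vl_def by (rule two_paths_turn) (use that in auto)
  have "u.ipths n1 \<noteq> {}" by (cases n1) auto
  then obtain u0 where u0: "u0 \<in> u.ipths n1" by blast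
  have "d.ipths n2 \<noteq> {}" by (cases n2) auto
  then obtain v0 where v0: "v0 \<in> d.ipths n2" by blast
  let ?hu = "u.ha n1" and ?lu = "u.hb n1" and ?hv = "d.ha n2" and ?lv = "d.hb n2"
  have np: "hd ?p \<in> nbrs EE ?a" "last ?p \<in> nbrs EE ?b" using u.path_end_nbrs[OF P(1,3)] .
  have nq: "hd ?q \<in> nbrs EE ?a" "last ?q \<in> nbrs EE ?b" using u.path_end_nbrs[OF Q(1,3)] .
  have nu: "?hu \<in> nbrs EE ?a" "?lu \<in> nbrs EE ?b" using u.path_end_nbrs[of u0 ?a ?b] ipu[OF u0] by auto
  have nv: "?hv \<in> nbrs EE ?a" "?lv \<in> nbrs EE ?b" using u.path_end_nbrs[of v0 ?a ?b] ipd[OF v0] by auto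
  have pq: "set ?p \<inter> set ?q = {}" unfolding P(4) Q(4) side_Int by (simp add: side_empty)
  have Ku: "2 * Suc m \<notin> K1 n1" "2 * Suc m - 1 \<notin> K1 n1" and Kv: "2 * Suc m \<notin> K2 n2" "2 * Suc m - 1 \<notin> K2 n2"
    using u.K_disj[OF n(1)] d.K_disj[OF n(2)] by (auto simp: L)
  have pu: "set ?p \<inter> set r = {}" "set ?q \<inter> set r = {}" if "r \<in> u.ipths n1" for r
  proof -
    have "set ?p \<inter> side (A1 n1) (K1 n1) = {}" "set ?q \<inter> side (A1 n1) (K1 n1) = {}"
      unfolding P(4) Q(4) side_Int using Ku by (simp_all add: side_empty)
    then show "set ?p \<inter> set r = {}" "set ?q \<inter> set r = {}" using ipu[OF that] by blast+
  qed
  have pv: "set ?p \<inter> set r = {}" "set ?q \<inter> set r = {}" if "r \<in> d.ipths n2" for r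
  proof -
    have "set ?p \<inter> side (A2 n2) (K2 n2) = {}" "set ?q \<inter> side (A2 n2) (K2 n2) = {}"
      unfolding P(4) Q(4) side_Int using Kv by (simp_all add: side_empty)
    then show "set ?p \<inter> set r = {}" "set ?q \<inter> set r = {}" using ipd[OF that] by blast+
  qed
  have uv: "set r \<inter> set t = {}" if "r \<in> u.ipths n1" "t \<in> d.ipths n2" for r t
  proof -
    have "set r \<inter> set t \<subseteq> side (A1 n1) (K1 n1) \<inter> side (A2 n2) (K2 n2)" using ipu[OF that(1)] ipd[OF that(2)] by blast
    also have "\<dots> = {?a, ?b}" unfolding side_Int dis by (rule side_single)
    finally have "set r \<inter> set t \<subseteq> {?a, ?b}" .
    moreover have "?a \<notin> set r" "?b \<notin> set r" using ipu[OF that(1)] by auto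
    ultimately show ?thesis by blast
  qed
  have nes: "hd ?p \<noteq> hd ?q" "hd ?p \<noteq> ?hu" "hd ?p \<noteq> ?hv" "hd ?q \<noteq> ?hu" "hd ?q \<noteq> ?hv" "?hu \<noteq> ?hv"
    "last ?p \<noteq> last ?q" "last ?p \<noteq> ?lu" "last ?p \<noteq> ?lv" "last ?q \<noteq> ?lu" "last ?q \<noteq> ?lv" "?lu \<noteq> ?lv"
  proof -
    have ends: "hd x \<in> set x \<and> last x \<in> set x" if "x \<noteq> []" for x :: "nat list" using that by simp
    have U: "?hu \<in> set u0" "?lu \<in> set u0" using ipu[OF u0] ends[of u0] by auto
    have V: "?hv \<in> set v0" "?lv \<in> set v0" using ipd[OF v0] ends[of v0] by auto
    show "hd ?p \<noteq> hd ?q" "hd ?p \<noteq> ?hu" "hd ?p \<noteq> ?hv" "hd ?q \<noteq> ?hu" "hd ?q \<noteq> ?hv" "?hu \<noteq> ?hv"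
      "last ?p \<noteq> last ?q" "last ?p \<noteq> ?lu" "last ?p \<noteq> ?lv" "last ?q \<noteq> ?lu" "last ?q \<noteq> ?lv" "?lu \<noteq> ?lv"
      using ends[OF P(1)] ends[OF Q(1)] U V pq pu[OF u0] pv[OF v0] uv[OF u0 v0] by (metis disjoint_iff)+
  qed
  \<comment> \<open>Positions are counted from the chain \<open>?p\<close>, to which the other three
    parts are compared.\<close>
  obtain pa where pa: "pa (hd ?p) = 0" "inj_on pa (nbrs EE ?a)" "\<And>x. x \<in> nbrs EE ?a \<Longrightarrow> pa x \<in> {0..3}"
    "\<And>x y. x \<in> nbrs EE ?a \<Longrightarrow> y \<in> nbrs EE ?a \<Longrightarrow> x \<noteq> y \<Longrightarrow> turn rot ang x ?a y = (pa y - pa x) mod 4 - 2"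
    using deg4_positions[OF d4(3,1) np(1)] by metis
  obtain pb where pb: "pb (last ?p) = 0" "inj_on pb (nbrs EE ?b)" "\<And>x. x \<in> nbrs EE ?b \<Longrightarrow> pb x \<in> {0..3}"
    "\<And>x y. x \<in> nbrs EE ?b \<Longrightarrow> y \<in> nbrs EE ?b \<Longrightarrow> x \<noteq> y \<Longrightarrow> turn rot ang x ?b y = (pb y - pb x) mod 4 - 2"
    using deg4_positions[OF d4(4,2) np(2)] by metis
  have pdist: "pa x \<noteq> pa y" if "x \<in> nbrs EE ?a" "y \<in> nbrs EE ?a" "x \<noteq> y" for x y
    using pa(2) that by (auto simp: inj_on_def)
  have qdist: "pb x \<noteq> pb y" if "x \<in> nbrs EE ?b" "y \<in> nbrs EE ?b" "x \<noteq> y" for x y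
    using pb(2) that by (auto simp: inj_on_def)
  have PA: "(pa (hd ?q), pa ?hu, pa ?hv) \<in> {(1, 2, 3), (1, 3, 2), (2, 1, 3), (2, 3, 1), (3, 1, 2), (3, 2, 1)}"
    by (rule perm3) (use pa(1,3) np nq nu nv nes pdist in metis)+
  have PB: "(pb (last ?q), pb ?lu, pb ?lv) \<in> {(1, 2, 3), (1, 3, 2), (2, 1, 3), (2, 3, 1), (3, 1, 2), (3, 2, 1)}"
    by (rule perm3) (use pb(1,3) np nq nu nv nes qdist in metis)+
  have c1: "\<bar>vl ?p - vl ?q + (pb (last ?q) mod 4 - 2) + ((- pa (hd ?q)) mod 4 - 2)\<bar> = 4"
    using cyc[OF P(1) Q(1) P(2) Q(2) pq P(3) Q(3)]
    unfolding pa(4)[OF nq(1) np(1) nes(1)[symmetric]] pb(4)[OF np(2) nq(2) nes(7)] pa(1) pb(1) diff_0 diff_0_right .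
  have cu: "\<bar>vl ?p - x + (pb ?lu mod 4 - 2) + ((- pa ?hu) mod 4 - 2)\<bar> = 4"
    if x: "x \<in> vl ` u.ipths n1" for x
  proof -
    obtain r where r: "r \<in> u.ipths n1" "x = vl r" using x by auto
    have i: "r \<noteq> []" "distinct (?a # r @ [?b])" "path_edges (?a # r @ [?b]) \<subseteq> EE" "hd r = ?hu" "last r = ?lu"
      using ipu[OF r(1)] by blast+
    show "\<bar>vl ?p - x + (pb ?lu mod 4 - 2) + ((- pa ?hu) mod 4 - 2)\<bar> = 4"
      using cyc[OF P(1) i(1) P(2) i(2) pu(1)[OF r(1)] P(3) i(3)]
      unfolding i(4,5) r(2) pa(4)[OF nu(1) np(1) nes(2)[symmetric]] pb(4)[OF np(2) nu(2) nes(8)]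
        pa(1) pb(1) diff_0 diff_0_right .
  qed
  have cv: "\<bar>vl ?p - x + (pb ?lv mod 4 - 2) + ((- pa ?hv) mod 4 - 2)\<bar> = 4"
    if x: "x \<in> vl ` d.ipths n2" for x
  proof -
    obtain r where r: "r \<in> d.ipths n2" "x = vl r" using x by auto
    have i: "r \<noteq> []" "distinct (?a # r @ [?b])" "path_edges (?a # r @ [?b]) \<subseteq> EE" "hd r = ?hv" "last r = ?lv"
      using ipd[OF r(1)] by blast+
    show "\<bar>vl ?p - x + (pb ?lv mod 4 - 2) + ((- pa ?hv) mod 4 - 2)\<bar> = 4"
      using cyc[OF P(1) i(1) P(2) i(2) pv(1)[OF r(1)] P(3) i(3)]
      unfolding i(4,5) r(2) pa(4)[OF nv(1) np(1) nes(3)[symmetric]] pb(4)[OF np(2) nv(2) nes(9)]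
        pa(1) pb(1) diff_0 diff_0_right .
  qed
  have cuv: "\<bar>x - y + ((pb ?lv - pb ?lu) mod 4 - 2) + ((pa ?hu - pa ?hv) mod 4 - 2)\<bar> = 4"
    if xy: "x \<in> vl ` u.ipths n1" "y \<in> vl ` d.ipths n2" for x y
  proof -
    obtain r where r: "r \<in> u.ipths n1" "x = vl r" using xy(1) by auto
    obtain t where t: "t \<in> d.ipths n2" "y = vl t" using xy(2) by auto
    have i: "r \<noteq> []" "distinct (?a # r @ [?b])" "path_edges (?a # r @ [?b]) \<subseteq> EE" "hd r = ?hu" "last r = ?lu"
      using ipu[OF r(1)] by blast+
    have j: "t \<noteq> []" "distinct (?a # t @ [?b])" "path_edges (?a # t @ [?b]) \<subseteq> EE" "hd t = ?hv" "last t = ?lv"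
      using ipd[OF t(1)] by blast+
    show ?thesis
      using cyc[OF i(1) j(1) i(2) j(2) uv[OF r(1) t(1)] i(3) j(3)]
      unfolding i(4,5) j(4,5) r(2) t(2) pa(4)[OF nv(1) nu(1) nes(6)[symmetric]] pb(4)[OF nu(2) nv(2) nes(12)] .
  qed
  have "\<bar>vl ?p\<bar> \<le> 1" "\<bar>vl ?q\<bar> \<le> 1" using P(5) Q(5) lens by auto
  note ba = base_arith[OF PA PB this c1 cu cv cuv, of "vl ` u.ipths n1" "vl ` d.ipths n2"]
  have "3 \<le> \<bar>x\<bar> \<and> 3 \<le> \<bar>y\<bar> \<and> (x = x' \<or> y = y')"
    if "x \<in> vl ` u.ipths n1" "x' \<in> vl ` u.ipths n1" "y \<in> vl ` d.ipths n2" "y' \<in> vl ` d.ipths n2" for x x' y y'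
    using ba that by blast
  \<comment> \<open>If neither wing had constant turn, unequal values from each would violate the
    last disjunct above.\<close>
  then have "(\<forall>r\<in>u.ipths n1. vl r = vl u0) \<and> 3 \<le> \<bar>vl u0\<bar> \<or> (\<forall>r\<in>d.ipths n2. vl r = vl v0) \<and> 3 \<le> \<bar>vl v0\<bar>"
    using u0 v0 by (metis image_eqI)
  then show ?thesis unfolding vl_def by blast
qed

text \<open>At distance \<open>d > 0\<close> from the middle level the two chains have
  \<open>2 * d - 1\<close> and \<open>2 * d + 1\<close> inner vertices, on either side; this is the
  growth tolerated by \<open>spiral\<close>. Whichever wing has constant turn at the middle level
  provides the disjunct.\<close>

theorem forced:
  "(\<bar>pt rot ang zup\<bar> \<ge> int (2 * m + 3) \<and> \<bar>pt rot ang zup - pt rot ang (ch (2 * (M - 1)))\<bar> \<le> 6)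
    \<or> (\<bar>pt rot ang zdn\<bar> \<ge> int (2 * m + 3) \<and> \<bar>pt rot ang zdn - pt rot ang (ch 2)\<bar> \<le> 6)"
proof -
  interpret u: wing_rep m "\<lambda>n. M - 1 - n" "\<lambda>n. {M - 1 - n..M}" "\<lambda>n. {2 * (M - 1 - n)<..<2 * M}" "\<lambda>n. {M - 1 - n..<M}"
    "ch (2 * M - 1)" "M - 2" rot ang d0
    using wing_up rectilinear_axioms by (rule wing_rep.intro)
  interpret d: wing_rep m Suc "\<lambda>n. {..Suc n}" "\<lambda>n. {..<2 * Suc n - 1}" "\<lambda>n. {..<Suc n}" "ch 0" "M - 2" rot ang d0
    using wing_dn rectilinear_axioms by (rule wing_rep.intro)
  have mM: "m \<le> M - 2" "M - 1 - m = Suc m" by (simp_all add: M_def)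
  have zu: "u.z = zup" unfolding u.z_def zup_def by simp
  have zd: "d.z = zdn" unfolding d.z_def zdn_def by simp
  have lu: "len (2 * (M - 1 - n)) \<le> 2 * (m - n) + 1 \<and> len (2 * (M - 1 - n) - 1) \<le> 2 * (m - n) + 1" if "n < m" for n
  proof -
    define l where "l = M - 1 - n"
    have l: "int l = 2 * int m + 1 - int n" "1 \<le> l" using that by (auto simp: l_def M_def)
    have "(2 * l - 1) div 2 = l - 1" using l(2) by (cases l) auto
    then have "s (2 * l) = 2 * int m - 2 * int n + 1" "s (2 * l - 1) = 2 * int m - 2 * int n - 1"
      using l by (auto simp: s_val)
    then show ?thesis unfolding l_def[symmetric] len_def using that by auto
  qed
  have ld: "len (2 * Suc n) \<le> 2 * (m - n) + 1 \<and> len (2 * Suc n - 1) \<le> 2 * (m - n) + 1" if "n < m" for n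
  proof -
    have "(2 * Suc n - 1) div 2 = n" "(2 * Suc n) div 2 = Suc n" by auto
    then have "s (2 * Suc n) = 2 * int n - 2 * int m + 1" "s (2 * Suc n - 1) = 2 * int n - 2 * int m - 1"
      unfolding s_val by auto
    then show ?thesis unfolding len_def using that by auto
  qed
  have "(\<exists>w. \<bar>w\<bar> \<ge> 3 \<and> (\<forall>q\<in>u.ipths m. pt rot ang (va (Suc m) # q @ [vb (Suc m)]) = w))
    \<or> (\<exists>w. \<bar>w\<bar> \<ge> 3 \<and> (\<forall>q\<in>d.ipths m. pt rot ang (va (Suc m) # q @ [vb (Suc m)]) = w))"
    by (rule middle[OF wing_up wing_dn]) (auto simp: M_def)
  then show ?thesis
  proof
    assume "\<exists>w. \<bar>w\<bar> \<ge> 3 \<and> (\<forall>q\<in>u.ipths m. pt rot ang (va (Suc m) # q @ [vb (Suc m)]) = w)"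
    then obtain w where w: "\<bar>w\<bar> \<ge> 3" "\<forall>q\<in>u.ipths m. u.val m q = w" unfolding u.val_def mM(2) by (elim exE conjE)
    have "\<bar>pt rot ang zup\<bar> \<ge> int (2 * m + 3)" using u.spiral[OF mM(1) lu w] zu by simp
    moreover have "\<bar>pt rot ang zup - pt rot ang (ch (2 * (M - 1)))\<bar> \<le> 6"
      using u.neighbour_bound unfolding zu diff_zero .
    ultimately show ?thesis by blast
  next
    assume "\<exists>w. \<bar>w\<bar> \<ge> 3 \<and> (\<forall>q\<in>d.ipths m. pt rot ang (va (Suc m) # q @ [vb (Suc m)]) = w)"
    then obtain w where w: "\<bar>w\<bar> \<ge> 3" "\<forall>q\<in>d.ipths m. d.val m q = w" unfolding d.val_def by (elim exE conjE)
    have "\<bar>pt rot ang zdn\<bar> \<ge> int (2 * m + 3)" using d.spiral[OF mM(1) ld w] zd by simp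
    moreover have "\<bar>pt rot ang zdn - pt rot ang (ch 2)\<bar> \<le> 6"
      using d.neighbour_bound unfolding zd by (simp add: numeral_2_eq_2)
    ultimately show ?thesis by blast
  qed
qed

end

section \<open>A rectilinear representation of the ladder\<close>

text \<open>The cyclic successor in a list without repetitions; applied to clockwise lists of
  neighbours it gives the rotation system.\<close>

definition nxt :: "nat list \<Rightarrow> nat \<Rightarrow> nat" where
  "nxt l x = l ! (Suc (inv_into {..<length l} ((!) l) x) mod length l)"

lemma nxt_nth:
  assumes "distinct l" "i < length l" shows "nxt l (l ! i) = l ! (Suc i mod length l)"
proof -
  have "inv_into {..<length l} ((!) l) (l ! i) = i"
    using assms by (intro inv_into_f_f) (auto simp: inj_on_nth)
  then show ?thesis by (simp add: nxt_def)
qed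

lemma nxt_pow:
  assumes "distinct l" "i < length l" shows "(nxt l ^^ k) (l ! i) = l ! ((i + k) mod length l)"
proof (induction k)
  case (Suc k)
  have "(i + k) mod length l < length l" using assms(2) by (intro mod_less_divisor) linarith
  then show ?case using Suc nxt_nth[OF assms(1)] by (simp add: mod_Suc_eq)
qed (use assms in simp)

lemma nxt_cyclic:
  assumes "distinct l"
  shows "bij_betw (nxt l) (set l) (set l)"
    and "x \<in> set l \<Longrightarrow> y \<in> set l \<Longrightarrow> \<exists>k. (nxt l ^^ k) x = y"
proof -
  have tr: "\<exists>k>0. (nxt l ^^ k) x = y" if xy: "x \<in> set l" "y \<in> set l" for x y
  proof -
    obtain i j where ij: "i < length l" "x = l ! i" "j < length l" "y = l ! j"
      using xy by (auto simp: in_set_conv_nth)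
    have "(nxt l ^^ (length l - i + j)) x = l ! ((i + (length l - i + j)) mod length l)"
      using nxt_pow[OF assms ij(1)] ij(2) by simp
    also have "i + (length l - i + j) = j + length l" using ij(1) by simp
    finally have "(nxt l ^^ (length l - i + j)) x = y" using ij by simp
    then show ?thesis using ij(1) by (intro exI[of _ "length l - i + j"]) simp
  qed
  then show "x \<in> set l \<Longrightarrow> y \<in> set l \<Longrightarrow> \<exists>k. (nxt l ^^ k) x = y" by blast
  have into: "nxt l x \<in> set l" if x: "x \<in> set l" for x
  proof -
    obtain i where i: "i < length l" "x = l ! i" using x by (auto simp: in_set_conv_nth)
    then have "Suc i mod length l < length l" by (intro mod_less_divisor) linarith
    then show ?thesis using i nxt_nth[OF assms i(1)] by simp
  qed
  have powin: "(nxt l ^^ k) x \<in> set l" if "x \<in> set l" for x k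
    using that by (induction k) (auto simp: into)
  have "set l \<subseteq> nxt l ` set l"
  proof
    fix y assume y: "y \<in> set l"
    then obtain k where k: "k > 0" "(nxt l ^^ k) y = y" using tr by blast
    then obtain j where "k = Suc j" by (cases k) auto
    then have "nxt l ((nxt l ^^ j) y) = y" using k by simp
    then show "y \<in> nxt l ` set l" using powin[OF y, of j] by (metis imageI)
  qed
  then have "nxt l ` set l = set l" using into by auto
  then show "bij_betw (nxt l) (set l) (set l)"
    by (simp add: bij_betw_def finite_surj_inj)
qed

lemma nxt2:
  assumes "distinct [a, b]" shows "nxt [a, b] a = b" "nxt [a, b] b = a"
  using nxt_nth[OF assms, of 0] nxt_nth[OF assms, of "Suc 0"] by simp_all

lemma nxt4:
  assumes "distinct [a, b, c, d]"
  shows "nxt [a, b, c, d] a = b" "nxt [a, b, c, d] b = c" "nxt [a, b, c, d] c = d" "nxt [a, b, c, d] d = a"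
proof -
  note n = nxt_nth[OF assms]
  show "nxt [a, b, c, d] a = b" using n[of 0] by simp
  show "nxt [a, b, c, d] b = c" using n[of "Suc 0"] by simp
  show "nxt [a, b, c, d] c = d" using n[of "Suc (Suc 0)"] by simp
  show "nxt [a, b, c, d] d = a" using n[of "Suc (Suc (Suc 0))"] by simp
qed

context ladder
begin

definition nl :: "nat \<Rightarrow> nat list" where
  "nl v = (if v mod 3 = 0 then nA (v div 3) else if v mod 3 = 1 then nB (v div 3)
    else nX (fst (prod_decode (v div 3))) (snd (prod_decode (v div 3))))"

lemma nl_simps [simp]: "nl (va i) = nA i" "nl (vb i) = nB i" "nl (vx k j) = nX k j"
proof -
  show "nl (va i) = nA i" by (simp add: nl_def va_def)
  have "(3 * i + 1) mod 3 = 1" "(3 * i + 1) div 3 = i" by auto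
  then show "nl (vb i) = nB i" by (simp add: nl_def vb_def)
  have "(3 * t + 2) mod 3 = 2" "(3 * t + 2) div 3 = t" for t :: nat by presburger+
  then show "nl (vx k j) = nX k j" unfolding nl_def vx_def by simp
qed

definition rot0 :: "nat \<Rightarrow> nat \<Rightarrow> nat" where
  "rot0 v = nxt (nl v)"

text \<open>The four exceptional pairs are the reflex corners of the external face at the ends of the rails.\<close>

definition ang0 :: "nat \<Rightarrow> nat \<Rightarrow> nat" where
  "ang0 v u = (if \<exists>k j. v = vx k j \<and> 1 \<le> j \<and> j \<le> len k \<and> (u = pv k (j - 1) \<longleftrightarrow> s k > 0) then 3
    else if (v, u) \<in> {(va 0, vx 0 1), (va M, va (M - 1)), (vb 0, vb 1), (vb M, vx (2 * M - 1) (len (2 * M - 1)))}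
    then 3 else 1)"

lemma nl_props:
  assumes "v \<in> VV" shows "distinct (nl v)" "nbrs EE v = set (nl v)"
  using assms by (cases rule: VV_cases; simp add: nbrs_va nbrs_vb nbrs_vx distinct_nA distinct_nB distinct_nX)+

lemma rs0: "rotation_system VV EE rot0"
proof
  fix v assume v: "v \<in> VV"
  note p = nl_props[OF v]
  show "bij_betw (rot0 v) (nbrs EE v) (nbrs EE v)"
    using nxt_cyclic(1)[OF p(1)] unfolding p(2) rot0_def .
  fix x y assume "x \<in> nbrs EE v" "y \<in> nbrs EE v"
  then show "\<exists>k. (rot0 v ^^ k) x = y" using nxt_cyclic(2)[OF p(1)] unfolding p(2) rot0_def by blast
qed (rule simple_ladder)

definition w0 :: "nat \<times> nat \<Rightarrow> int" where
  "w0 d = 2 - int (ang0 (snd d) (fst d))"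

lemma pv_pred_succ: "1 \<le> j \<Longrightarrow> j \<le> len k \<Longrightarrow> pv k (j - 1) \<noteq> pv k (Suc j)"
  using distinct_nX[of j k] by (simp add: nX_def)

text \<open>All inner vertices of chain \<open>k\<close> turn the same way, to the right for
  positive \<open>s k\<close>; being \<open>len k\<close> in number, they make the chain turn by
  \<open>s k\<close>.\<close>

lemma ang0_vx:
  assumes "1 \<le> j" "j \<le> len k"
  shows "ang0 (vx k j) (pv k (j - 1)) = (if s k > 0 then 3 else 1)"
    and "ang0 (vx k j) (pv k (Suc j)) = (if s k > 0 then 1 else 3)"
  using assms pv_pred_succ[OF assms] by (auto simp: ang0_def)

lemma ang0_va: "ang0 (va i) u = (if (i = 0 \<and> u = vx 0 1) \<or> (i = M \<and> u = va (M - 1)) then 3 else 1)"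
  by (auto simp: ang0_def)

lemma ang0_vb: "ang0 (vb i) u = (if (i = 0 \<and> u = vb 1) \<or> (i = M \<and> u = vx (2 * M - 1) (len (2 * M - 1))) then 3 else 1)"
  by (auto simp: ang0_def)

lemma ang0_ok:
  assumes "v \<in> VV"
  shows "(\<forall>u\<in>nbrs EE v. ang0 v u \<in> {1..4}) \<and> (\<Sum>u\<in>nbrs EE v. ang0 v u) = 4"
proof
  show "\<forall>u\<in>nbrs EE v. ang0 v u \<in> {1..4}" by (auto simp: ang0_def)
  have M: "M \<noteq> 0" "0 < M" "Suc (M - 1) = M" using M_ge by auto
  show "(\<Sum>u\<in>nbrs EE v. ang0 v u) = 4"
    using assms
  proof (cases rule: VV_cases)
    case (1 i)
    have "(\<Sum>u\<in>set (nA i). ang0 (va i) u) = sum_list (map (ang0 (va i)) (nA i))"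
      by (rule sum_list_distinct_conv_sum_set[OF distinct_nA, symmetric])
    then show ?thesis using 1 M by (auto simp: nbrs_va nA_def ang0_va)
  next
    case (2 i)
    have "(\<Sum>u\<in>set (nB i). ang0 (vb i) u) = sum_list (map (ang0 (vb i)) (nB i))"
      by (rule sum_list_distinct_conv_sum_set[OF distinct_nB, symmetric])
    then show ?thesis using 2 M by (auto simp: nbrs_vb nB_def ang0_vb)
  next
    case (3 k j)
    have "(\<Sum>u\<in>set (nX k j). ang0 (vx k j) u) = sum_list (map (ang0 (vx k j)) (nX k j))"
      by (rule sum_list_distinct_conv_sum_set[OF distinct_nX[OF 3(2,3)], symmetric])
    then show ?thesis using 3 ang0_vx[OF 3(2,3)] by (simp add: nbrs_vx nX_def)
  qed
qed

lemma nA_mid: "0 < i \<Longrightarrow> i < M \<Longrightarrow> nA i = [va (Suc i), vx (2 * i) 1, vx (2 * i - 1) 1, va (i - 1)]"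
  and nA_0: "nA 0 = [va 1, vx 0 1]"
  and nA_M: "nA M = [vx (2 * M - 1) 1, va (M - 1)]"
  using M_ge by (auto simp: nA_def)

lemma nB_mid: "0 < i \<Longrightarrow> i < M \<Longrightarrow>
    nB i = [vb (i - 1), vx (2 * i - 1) (len (2 * i - 1)), vx (2 * i) (len (2 * i)), vb (Suc i)]"
  and nB_0: "nB 0 = [vx 0 (len 0), vb 1]"
  and nB_M: "nB M = [vb (M - 1), vx (2 * M - 1) (len (2 * M - 1))]"
  using M_ge by (auto simp: nB_def)

lemma rot_A_mid:
  assumes "0 < i" "i < M"
  shows "rot0 (va i) (va (Suc i)) = vx (2 * i) 1" "rot0 (va i) (vx (2 * i) 1) = vx (2 * i - 1) 1"
    "rot0 (va i) (vx (2 * i - 1) 1) = va (i - 1)" "rot0 (va i) (va (i - 1)) = va (Suc i)"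
proof -
  have "distinct (nA i)" by (rule distinct_nA)
  note d = this[unfolded nA_mid[OF assms]]
  show "rot0 (va i) (va (Suc i)) = vx (2 * i) 1" "rot0 (va i) (vx (2 * i) 1) = vx (2 * i - 1) 1"
    "rot0 (va i) (vx (2 * i - 1) 1) = va (i - 1)" "rot0 (va i) (va (i - 1)) = va (Suc i)"
    unfolding rot0_def nl_simps nA_mid[OF assms] using nxt4[OF d] by auto
qed

lemma rot_B_mid:
  assumes "0 < i" "i < M"
  shows "rot0 (vb i) (vb (i - 1)) = vx (2 * i - 1) (len (2 * i - 1))"
    "rot0 (vb i) (vx (2 * i - 1) (len (2 * i - 1))) = vx (2 * i) (len (2 * i))"
    "rot0 (vb i) (vx (2 * i) (len (2 * i))) = vb (Suc i)" "rot0 (vb i) (vb (Suc i)) = vb (i - 1)"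
proof -
  have "distinct (nB i)" by (rule distinct_nB)
  note d = this[unfolded nB_mid[OF assms]]
  show "rot0 (vb i) (vb (i - 1)) = vx (2 * i - 1) (len (2 * i - 1))"
    "rot0 (vb i) (vx (2 * i - 1) (len (2 * i - 1))) = vx (2 * i) (len (2 * i))"
    "rot0 (vb i) (vx (2 * i) (len (2 * i))) = vb (Suc i)" "rot0 (vb i) (vb (Suc i)) = vb (i - 1)"
    unfolding rot0_def nl_simps nB_mid[OF assms] using nxt4[OF d] by auto
qed

lemma rot_ends:
  "rot0 (va 0) (va 1) = vx 0 1" "rot0 (va 0) (vx 0 1) = va 1"
  "rot0 (va M) (vx (2 * M - 1) 1) = va (M - 1)" "rot0 (va M) (va (M - 1)) = vx (2 * M - 1) 1"
  "rot0 (vb 0) (vx 0 (len 0)) = vb 1" "rot0 (vb 0) (vb 1) = vx 0 (len 0)"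
  "rot0 (vb M) (vb (M - 1)) = vx (2 * M - 1) (len (2 * M - 1))"
  "rot0 (vb M) (vx (2 * M - 1) (len (2 * M - 1))) = vb (M - 1)"
  unfolding rot0_def nl_simps nA_0 nA_M nB_0 nB_M by (simp_all add: nxt2)

lemma rot_X:
  assumes "1 \<le> j" "j \<le> len k"
  shows "rot0 (vx k j) (pv k (j - 1)) = pv k (Suc j)" "rot0 (vx k j) (pv k (Suc j)) = pv k (j - 1)"
  using nxt2[OF distinct_nX[OF assms, unfolded nX_def]] by (simp_all add: rot0_def nX_def)

section \<open>The faces of the representation\<close>

definition fwd :: "nat \<Rightarrow> (nat \<times> nat) set" where
  "fwd k = (\<lambda>j. (pv k j, pv k (Suc j))) ` {..len k}"

definition bwd :: "nat \<Rightarrow> (nat \<times> nat) set" where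
  "bwd k = (\<lambda>j. (pv k (Suc j), pv k j)) ` {..len k}"

text \<open>The face to the left of chain \<open>k\<close>, read from \<open>va\<close> to
  \<open>vb\<close>, is bounded on the other side by chain \<open>k + 1\<close>. For even
  \<open>k\<close> these chains belong to different levels, which adds two rail edges. The last face
  closes up with chain 0 and the whole of both rails; it is the external one.\<close>

definition S :: "nat \<Rightarrow> (nat \<times> nat) set" where
  "S k = fwd k \<union> (if k = 2 * M - 1
      then bwd 0 \<union> (\<lambda>i. (va i, va (Suc i))) ` {..<M} \<union> (\<lambda>i. (vb (Suc i), vb i)) ` {..<M}
      else bwd (Suc k) \<union> (if even k then {(vb (k div 2), vb (Suc (k div 2))), (va (Suc (k div 2)), va (k div 2))} else {}))"

abbreviation fs :: "nat \<times> nat \<Rightarrow> nat \<times> nat" where "fs \<equiv> fstep rot0"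

lemma fs_fwd: "j < len k \<Longrightarrow> fs (pv k j, pv k (Suc j)) = (pv k (Suc j), pv k (Suc (Suc j)))"
  using rot_X(1)[of "Suc j" k] by (simp add: fstep_def)

lemma fs_bwd: "j < len k \<Longrightarrow> fs (pv k (Suc (Suc j)), pv k (Suc j)) = (pv k (Suc j), pv k j)"
  using rot_X(2)[of "Suc j" k] by (simp add: fstep_def)

lemma fs_corners:
  "i < M \<Longrightarrow> fs (vx (2 * i) (len (2 * i)), vb i) = (vb i, vb (Suc i))"
  "i < M \<Longrightarrow> fs (vb i, vb (Suc i)) = (vb (Suc i), vx (Suc (2 * i)) (len (Suc (2 * i))))"
  "i < M \<Longrightarrow> fs (vx (Suc (2 * i)) (Suc 0), va (Suc i)) = (va (Suc i), va i)"
  "i < M \<Longrightarrow> fs (va (Suc i), va i) = (va i, vx (2 * i) (Suc 0))"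
  "Suc i < M \<Longrightarrow> fs (vx (Suc (2 * i)) (len (Suc (2 * i))), vb (Suc i)) = (vb (Suc i), vx (2 * Suc i) (len (2 * Suc i)))"
  "Suc i < M \<Longrightarrow> fs (vx (2 * Suc i) (Suc 0), va (Suc i)) = (va (Suc i), vx (Suc (2 * i)) (Suc 0))"
  "fs (vx (2 * M - 1) (len (2 * M - 1)), vb M) = (vb M, vb (M - 1))"
  "Suc i < M \<Longrightarrow> fs (vb (Suc (Suc i)), vb (Suc i)) = (vb (Suc i), vb i)"
  "fs (vb 1, vb 0) = (vb 0, vx 0 (len 0))"
  "fs (vx 0 (Suc 0), va 0) = (va 0, va 1)"
  "Suc i < M \<Longrightarrow> fs (va i, va (Suc i)) = (va (Suc i), va (Suc (Suc i)))"
  "fs (va (M - 1), va M) = (va M, vx (2 * M - 1) (Suc 0))"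
proof -
  note e = rot_ends[unfolded One_nat_def]
  show "fs (vx (2 * i) (len (2 * i)), vb i) = (vb i, vb (Suc i))" if "i < M"
    using e(5) rot_B_mid(3)[of i] that by (cases i) (auto simp: fstep_def)
  show "fs (vb i, vb (Suc i)) = (vb (Suc i), vx (Suc (2 * i)) (len (Suc (2 * i))))" if "i < M"
  proof (cases "Suc i = M")
    case True
    then have "2 * M - Suc 0 = Suc (2 * i)" "M - Suc 0 = i" by auto
    then show ?thesis using e(7) True by (simp add: fstep_def)
  next
    case False
    then show ?thesis using rot_B_mid(1)[of "Suc i"] that by (simp add: fstep_def)
  qed
  show "fs (vx (Suc (2 * i)) (Suc 0), va (Suc i)) = (va (Suc i), va i)" if "i < M"
  proof (cases "Suc i = M")
    case True
    then have "2 * M - Suc 0 = Suc (2 * i)" "M - Suc 0 = i" by auto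
    then show ?thesis using e(3) True by (simp add: fstep_def)
  next
    case False
    then show ?thesis using rot_A_mid(3)[of "Suc i"] that by (simp add: fstep_def)
  qed
  show "fs (va (Suc i), va i) = (va i, vx (2 * i) (Suc 0))" if "i < M"
    using e(1) rot_A_mid(1)[of i] that by (cases i) (auto simp: fstep_def)
  show "fs (vx (Suc (2 * i)) (len (Suc (2 * i))), vb (Suc i)) = (vb (Suc i), vx (2 * Suc i) (len (2 * Suc i)))" if "Suc i < M"
    using rot_B_mid(2)[of "Suc i"] that by (simp add: fstep_def)
  show "fs (vx (2 * Suc i) (Suc 0), va (Suc i)) = (va (Suc i), vx (Suc (2 * i)) (Suc 0))" if "Suc i < M"
    using rot_A_mid(2)[of "Suc i"] that by (simp add: fstep_def)
  show "fs (vx (2 * M - 1) (len (2 * M - 1)), vb M) = (vb M, vb (M - 1))" using e(8) by (simp add: fstep_def)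
  show "fs (vb (Suc (Suc i)), vb (Suc i)) = (vb (Suc i), vb i)" if "Suc i < M"
    using rot_B_mid(4)[of "Suc i"] that by (simp add: fstep_def)
  show "fs (vb 1, vb 0) = (vb 0, vx 0 (len 0))" using e(6) by (simp add: fstep_def)
  show "fs (vx 0 (Suc 0), va 0) = (va 0, va 1)" using e(2) by (simp add: fstep_def)
  show "fs (va i, va (Suc i)) = (va (Suc i), va (Suc (Suc i)))" if "Suc i < M"
    using rot_A_mid(4)[of "Suc i"] that by (simp add: fstep_def)
  show "fs (va (M - 1), va M) = (va M, vx (2 * M - 1) (Suc 0))" using e(4) by (simp add: fstep_def)
qed

lemma fwd_cases:
  assumes "d \<in> fwd k"
  obtains j where "j < len k" "d = (pv k j, pv k (Suc j))" | "d = (vx k (len k), vb (lv k))"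
  using assms by (auto simp: fwd_def le_less)

lemma bwd_cases:
  assumes "d \<in> bwd k"
  obtains j where "j < len k" "d = (pv k (Suc (Suc j)), pv k (Suc j))" | "d = (vx k (Suc 0), va (lv k))"
proof -
  obtain j where "j \<le> len k" "d = (pv k (Suc j), pv k j)" using assms by (auto simp: bwd_def)
  then show ?thesis using that by (cases j) auto
qed

lemma in_fwd: "j \<le> len k \<Longrightarrow> (pv k j, pv k (Suc j)) \<in> fwd k" "(va (lv k), vx k (Suc 0)) \<in> fwd k"
  by (auto simp: fwd_def intro!: image_eqI[where x = 0])

lemma in_bwd: "j \<le> len k \<Longrightarrow> (pv k (Suc j), pv k j) \<in> bwd k" "(vb (lv k), vx k (len k)) \<in> bwd k"
  by (auto simp: bwd_def intro!: image_eqI[where x = "len k"])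

lemma fs_in_fwd: "d \<in> fwd k \<Longrightarrow> d \<noteq> (vx k (len k), vb (lv k)) \<Longrightarrow> fs d \<in> fwd k"
proof (erule fwd_cases)
  fix j assume j: "j < len k" "d = (pv k j, pv k (Suc j))"
  show "fs d \<in> fwd k" unfolding j(2) fs_fwd[OF j(1)] by (rule in_fwd(1)) (use j in simp)
qed simp

lemma fs_in_bwd: "d \<in> bwd k \<Longrightarrow> d \<noteq> (vx k (Suc 0), va (lv k)) \<Longrightarrow> fs d \<in> bwd k"
proof (erule bwd_cases)
  fix j assume j: "j < len k" "d = (pv k (Suc (Suc j)), pv k (Suc j))"
  show "fs d \<in> bwd k" unfolding j(2) fs_bwd[OF j(1)] by (rule in_bwd(1)) (use j in simp)
qed simp

lemma chain_cases:
  assumes "k < 2 * M"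
  obtains i where "i < M" "k = 2 * i" | i where "Suc i < M" "k = Suc (2 * i)" | "k = 2 * M - 1"
proof -
  have "k = 2 * (k div 2) \<or> k = Suc (2 * (k div 2))" by presburger
  then show ?thesis
  proof
    assume k: "k = 2 * (k div 2)"
    show ?thesis by (rule that(1)[OF _ k]) (use assms k in linarith)
  next
    assume k: "k = Suc (2 * (k div 2))"
    show ?thesis
    proof (cases "k = 2 * M - 1")
      case False
      show ?thesis by (rule that(2)[OF _ k]) (use assms k False in linarith)
    qed (rule that(3))
  qed
qed

lemma S_even: "i < M \<Longrightarrow> S (2 * i) = fwd (2 * i) \<union> bwd (Suc (2 * i)) \<union> {(vb i, vb (Suc i)), (va (Suc i), va i)}"
proof -
  assume i: "i < M"
  have "2 * i \<noteq> 2 * M - 1" using i by presburger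
  then show ?thesis unfolding S_def by simp
qed

lemma S_odd: "Suc i < M \<Longrightarrow> S (Suc (2 * i)) = fwd (Suc (2 * i)) \<union> bwd (2 * Suc i)"
proof -
  assume i: "Suc i < M"
  have "Suc (2 * i) \<noteq> 2 * M - 1" using i by presburger
  then show ?thesis unfolding S_def by simp
qed

lemma S_outer: "S (2 * M - 1) = fwd (2 * M - 1) \<union> bwd 0 \<union> (\<lambda>i. (va i, va (Suc i))) ` {..<M} \<union> (\<lambda>i. (vb (Suc i), vb i)) ` {..<M}"
  unfolding S_def by auto

text \<open>Inside a chain the next dart is evident; only the darts arriving at a rail vertex call
  for the corner rules.\<close>

lemma S_closed:
  assumes k: "k < 2 * M" and d: "d \<in> S k" shows "fs d \<in> S k"
  using k
proof (cases rule: chain_cases)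
  case (1 i)
  note Sk = S_even[OF 1(1)]
  have d': "d \<in> fwd (2 * i) \<or> d \<in> bwd (Suc (2 * i)) \<or> d = (vb i, vb (Suc i)) \<or> d = (va (Suc i), va i)"
    using d unfolding 1(2) Sk by blast
  note c = fs_corners(1-4)[OF 1(1)]
  have m: "(va i, vx (2 * i) (Suc 0)) \<in> fwd (2 * i)"
    "(vb (Suc i), vx (Suc (2 * i)) (len (Suc (2 * i)))) \<in> bwd (Suc (2 * i))"
    using in_fwd(2)[of "2 * i"] in_bwd(2)[of "Suc (2 * i)"] by simp_all
  show ?thesis
    unfolding 1(2) Sk
    using d' fs_in_fwd[of d "2 * i", unfolded lv_simps] fs_in_bwd[of d "Suc (2 * i)", unfolded lv_simps] c m
    by (metis Un_iff insert_iff)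
next
  case (2 i)
  note Sk = S_odd[OF 2(1)]
  have d': "d \<in> fwd (Suc (2 * i)) \<or> d \<in> bwd (2 * Suc i)" using d unfolding 2(2) Sk by blast
  have m: "(va (Suc i), vx (Suc (2 * i)) (Suc 0)) \<in> fwd (Suc (2 * i))"
    "(vb (Suc i), vx (2 * Suc i) (len (2 * Suc i))) \<in> bwd (2 * Suc i)"
    using in_fwd(2)[of "Suc (2 * i)"] in_bwd(2)[of "2 * Suc i"] lv_simps(1)[of "Suc i"] by (simp_all del: mult_Suc_right)
  show ?thesis
    unfolding 2(2) Sk
    using d' fs_in_fwd[of d "Suc (2 * i)", unfolded lv_simps] fs_in_bwd[of d "2 * Suc i", unfolded lv_simps(1)]
      fs_corners(5,6)[OF 2(1)] m
    by (metis Un_iff)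
next
  case 3
  have M: "0 < M" using M_ge by simp
  consider "d \<in> fwd (2 * M - 1)" "d \<noteq> (vx (2 * M - 1) (len (2 * M - 1)), vb M)"
    | "d = (vx (2 * M - 1) (len (2 * M - 1)), vb M)"
    | "d \<in> bwd 0" "d \<noteq> (vx 0 (Suc 0), va 0)" | "d = (vx 0 (Suc 0), va 0)"
    | i where "i < M" "d = (va i, va (Suc i))" | i where "i < M" "d = (vb (Suc i), vb i)"
    using d unfolding 3 S_outer by blast
  then show ?thesis
  proof cases
    case 1
    then show ?thesis using fs_in_fwd[of d "2 * M - 1"] unfolding 3 S_outer lv_end by blast
  next
    case 2
    have "(vb M, vb (M - 1)) \<in> (\<lambda>i. (vb (Suc i), vb i)) ` {..<M}"
      using M by (intro image_eqI[where x = "M - 1"]) auto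
    then show ?thesis unfolding 2 fs_corners(7) unfolding 3 S_outer by blast
  next
    case c: 3
    then show ?thesis using fs_in_bwd[of d 0] unfolding 3 S_outer lv_simps by blast
  next
    case 4
    have "(va 0, va 1) \<in> (\<lambda>i. (va i, va (Suc i))) ` {..<M}"
      using M by (intro image_eqI[where x = 0]) auto
    then show ?thesis unfolding 4 fs_corners(10) unfolding 3 S_outer by blast
  next
    case (5 i)
    show ?thesis
    proof (cases "Suc i < M")
      case True
      then have "(va (Suc i), va (Suc (Suc i))) \<in> (\<lambda>i. (va i, va (Suc i))) ` {..<M}" by blast
      then show ?thesis unfolding 5(2) fs_corners(11)[OF True] unfolding 3 S_outer by blast
    next
      case False
      then have i: "i = M - 1" "Suc i = M" using 5(1) by auto
      have "(va M, vx (2 * M - 1) (Suc 0)) \<in> fwd (2 * M - 1)" using in_fwd(2)[of "2 * M - 1"] unfolding lv_end .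
      then show ?thesis unfolding 5(2) i(2) unfolding i(1) fs_corners(12) unfolding 3 S_outer by blast
    qed
  next
    case (6 i)
    show ?thesis
    proof (cases i)
      case 0
      have "(vb 0, vx 0 (len 0)) \<in> bwd 0" using in_bwd(2)[of 0] by simp
      then show ?thesis unfolding 6(2) 0 fs_corners(9)[unfolded One_nat_def] unfolding 3 S_outer by blast
    next
      case (Suc i')
      then have i': "Suc i' < M" using 6(1) by simp
      have "(vb (Suc i'), vb i') \<in> (\<lambda>i. (vb (Suc i), vb i)) ` {..<M}" using i' by simp
      then show ?thesis unfolding 6(2) Suc fs_corners(8)[OF i'] unfolding 3 S_outer by blast
    qed
  qed
qed

text \<open>A dart lying in no face other than \<open>S k\<close>, which serves to tell the faces
  apart.\<close>

definition f0 :: "nat \<Rightarrow> nat \<times> nat" where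
  "f0 k = (va (lv k), vx k (Suc 0))"

lemma dart_iff: "(u, v) \<in> darts EE \<longleftrightarrow> adj u v \<or> adj v u"
  by (simp add: darts_def edge_iff)

lemma chain_darts:
  assumes "k < 2 * M" "j \<le> len k"
  shows "(pv k j, pv k (Suc j)) \<in> darts EE" "(pv k (Suc j), pv k j) \<in> darts EE"
  using assms unfolding dart_iff adj_def by blast+

lemma ladder_darts:
  assumes "i < M"
  shows "(va i, va (Suc i)) \<in> darts EE" "(va (Suc i), va i) \<in> darts EE"
    "(vb i, vb (Suc i)) \<in> darts EE" "(vb (Suc i), vb i) \<in> darts EE"
  using assms unfolding dart_iff adj_def by blast+

abbreviation fc0 :: "nat \<times> nat \<Rightarrow> (nat \<times> nat) set" where "fc0 \<equiv> face_of rot0"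

lemma fc_step: "d \<in> darts EE \<Longrightarrow> fc0 (fs d) = fc0 d"
  by (rule rotation_system.face_step[OF rs0])

lemma fc_fwd: "k < 2 * M \<Longrightarrow> j \<le> len k \<Longrightarrow> fc0 (pv k j, pv k (Suc j)) = fc0 (f0 k)"
proof (induction j)
  case 0
  then show ?case by (simp add: f0_def)
next
  case (Suc j)
  then have "fc0 (fs (pv k j, pv k (Suc j))) = fc0 (pv k j, pv k (Suc j))"
    by (intro fc_step chain_darts) auto
  moreover have "fs (pv k j, pv k (Suc j)) = (pv k (Suc j), pv k (Suc (Suc j)))"
    by (rule fs_fwd) (use Suc.prems in simp)
  moreover have "fc0 (pv k j, pv k (Suc j)) = fc0 (f0 k)" using Suc by simp
  ultimately show ?case by simp
qed

lemma fc_bwd: "k < 2 * M \<Longrightarrow> j \<le> len k \<Longrightarrow> fc0 (pv k (Suc j), pv k j) = fc0 (vx k (Suc 0), va (lv k))"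
proof (induction j)
  case 0
  then show ?case by simp
next
  case (Suc j)
  then have "fc0 (fs (pv k (Suc (Suc j)), pv k (Suc j))) = fc0 (pv k (Suc (Suc j)), pv k (Suc j))"
    by (intro fc_step chain_darts) auto
  moreover have "fs (pv k (Suc (Suc j)), pv k (Suc j)) = (pv k (Suc j), pv k j)"
    by (rule fs_bwd) (use Suc.prems in simp)
  moreover have "fc0 (pv k (Suc j), pv k j) = fc0 (vx k (Suc 0), va (lv k))" using Suc by simp
  ultimately show ?case by simp
qed

lemma fc_ends:
  assumes "k < 2 * M"
  shows "fc0 (vx k (len k), vb (lv k)) = fc0 (f0 k)"
    "fc0 (vb (lv k), vx k (len k)) = fc0 (vx k (Suc 0), va (lv k))"
    "(vx k (len k), vb (lv k)) \<in> darts EE" "(vx k (Suc 0), va (lv k)) \<in> darts EE" "(vb (lv k), vx k (len k)) \<in> darts EE"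
  using fc_fwd[OF assms, of "len k"] fc_bwd[OF assms, of "len k"]
    chain_darts[OF assms, of "len k"] chain_darts[OF assms, of 0] by simp_all

lemma fc_on_fwd: "k < 2 * M \<Longrightarrow> d \<in> fwd k \<Longrightarrow> fc0 d = fc0 (f0 k) \<and> d \<in> darts EE"
  using fc_fwd chain_darts by (auto simp: fwd_def)

lemma fc_on_bwd: "k < 2 * M \<Longrightarrow> d \<in> bwd k \<Longrightarrow> fc0 d = fc0 (vx k (Suc 0), va (lv k)) \<and> d \<in> darts EE"
  using fc_bwd chain_darts by (auto simp: bwd_def)

text \<open>Closure under \<open>fs\<close> would also allow a union of several faces. Linking the
  chains and rail edges through their corners shows that all darts of \<open>S k\<close> belong to
  one orbit.\<close>

lemma fc_on_S:
  assumes k: "k < 2 * M" and d: "d \<in> S k" shows "fc0 d = fc0 (f0 k)"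
  using k
proof (cases rule: chain_cases)
  case (1 i)
  have k2: "2 * i < 2 * M" "Suc (2 * i) < 2 * M" using 1 by auto
  note c = fs_corners(1-4)[OF 1(1)] and ld = ladder_darts[OF 1(1)]
  note e1 = fc_ends[OF k2(1), unfolded lv_simps] and e2 = fc_ends[OF k2(2), unfolded lv_simps]
  have a: "fc0 (vb i, vb (Suc i)) = fc0 (f0 (2 * i))" using fc_step[OF e1(3)] c(1) e1(1) by simp
  have b: "fc0 (vx (Suc (2 * i)) (Suc 0), va (Suc i)) = fc0 (f0 (2 * i))" using fc_step[OF ld(3)] c(2) e2(2) a by simp
  have c': "fc0 (va (Suc i), va i) = fc0 (f0 (2 * i))" using fc_step[OF e2(4)] c(3) b by simp
  show ?thesis
    using d a b c' fc_on_fwd[OF k2(1), of d] fc_on_bwd[OF k2(2), of d]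
    unfolding 1(2) S_even[OF 1(1)] by (auto simp del: v_simps)
next
  case (2 i)
  have k2: "Suc (2 * i) < 2 * M" "2 * Suc i < 2 * M" using 2 by auto
  note e1 = fc_ends[OF k2(1), unfolded lv_simps] and e2 = fc_ends[OF k2(2), unfolded lv_simps(1)]
  have "fc0 (vx (2 * Suc i) (Suc 0), va (Suc i)) = fc0 (f0 (Suc (2 * i)))"
    using fc_step[OF e1(3)] fs_corners(5)[OF 2(1)] e1(1) e2(2) by metis
  then show ?thesis
    using d fc_on_fwd[OF k2(1), of d] fc_on_bwd[OF k2(2), of d, unfolded lv_simps(1)]
    unfolding 2(2) S_odd[OF 2(1)] by (metis Un_iff)
next
  case 3
  have M: "0 < M" using M_ge by simp
  have k2: "2 * M - 1 < 2 * M" "0 < 2 * M" using M by auto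
  note e1 = fc_ends[OF k2(1), unfolded lv_end] and e2 = fc_ends[OF k2(2), unfolded lv_simps]
  let ?f = "fc0 (f0 (2 * M - 1))"
  \<comment> \<open>The external face descends along the rail \<open>vb\<close>, so the induction
    starts at level \<open>M\<close>.\<close>
  have b: "fc0 (vb (Suc (M - 1 - n)), vb (M - 1 - n)) = ?f" if "n \<le> M - 1" for n
    using that
  proof (induction n)
    case 0
    then show ?case using fc_step[OF e1(3)] fs_corners(7) e1(1) M by simp
  next
    case (Suc n)
    define l where "l = M - 1 - Suc n"
    have l: "M - 1 - n = Suc l" "Suc l < M" using Suc.prems by (auto simp: l_def)
    have "fc0 (vb (Suc (Suc l)), vb (Suc l)) = ?f" using Suc.IH Suc.prems unfolding l(1) by simp
    then show ?case
      using fc_step[OF ladder_darts(4)[OF l(2)]] fs_corners(8)[OF l(2)] unfolding l_def[symmetric] by simp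
  qed
  have B: "fc0 (vb (Suc i), vb i) = ?f" if "i < M" for i
  proof -
    have "M - 1 - (M - 1 - i) = i" "M - 1 - i \<le> M - 1" using that by auto
    then show ?thesis using b[of "M - 1 - i"] by metis
  qed
  have g: "fc0 (vx 0 (Suc 0), va 0) = ?f"
    using fc_step[OF ladder_darts(4)[OF M]] fs_corners(9) B[OF M] e2(2) by (simp add: One_nat_def)
  have A: "fc0 (va i, va (Suc i)) = ?f" if "i < M" for i
    using that
  proof (induction i)
    case 0
    then show ?case using fc_step[OF e2(4)] fs_corners(10) g by simp
  next
    case (Suc i)
    then show ?case using fc_step[OF ladder_darts(1)[of i]] fs_corners(11)[OF Suc.prems] by simp
  qed
  show ?thesis
    using d g A B fc_on_fwd[OF k2(1), of d] fc_on_bwd[OF k2(2), of d, unfolded lv_simps]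
    unfolding 3 S_outer by (auto simp del: v_simps)
qed

lemma f0_in: "f0 k \<in> S k"
  using in_fwd(2)[of k] by (simp add: S_def f0_def)

lemma S_face:
  assumes k: "k < 2 * M" shows "fc0 (f0 k) = S k"
proof
  show "fc0 (f0 k) \<subseteq> S k"
  proof
    fix d assume "d \<in> fc0 (f0 k)"
    then obtain n where "d = (fs ^^ n) (f0 k)" by (auto simp: face_of_def)
    then show "d \<in> S k" by (induction n arbitrary: d) (auto simp: f0_in S_closed[OF k])
  qed
  show "S k \<subseteq> fc0 (f0 k)"
  proof
    fix d assume "d \<in> S k"
    then have "fc0 d = fc0 (f0 k)" by (rule fc_on_S[OF k])
    then show "d \<in> fc0 (f0 k)" using rotation_system.face_self[OF rs0, of d] by simp
  qed
qed

lemma f0_dart: "k < 2 * M \<Longrightarrow> f0 k \<in> darts EE"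
  using chain_darts(1)[of k 0] by (simp add: f0_def)

lemma S_cover:
  assumes "d \<in> darts EE" shows "\<exists>k<2 * M. d \<in> S k"
proof -
  obtain u v where d: "d = (u, v)" by (cases d)
  have last: "2 * M - 1 < 2 * M" using M_ge by simp
  have "adj u v \<or> adj v u" using assms d dart_iff by simp
  then consider i where "i < M" "d = (va i, va (Suc i)) \<or> d = (vb (Suc i), vb i)"
    | i where "i < M" "d = (va (Suc i), va i) \<or> d = (vb i, vb (Suc i))"
    | k where "k < 2 * M" "d \<in> fwd k" | k where "k < 2 * M" "d \<in> bwd k"
    unfolding adj_def d fwd_def bwd_def by blast
  then show ?thesis
  proof cases
    case (1 i)
    then have "d \<in> S (2 * M - 1)" unfolding S_outer by blast
    then show ?thesis using last by blast
  next
    case (2 i)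
    then have "d \<in> S (2 * i)" "2 * i < 2 * M" using S_even[OF 2(1)] by auto
    then show ?thesis by blast
  next
    case (3 k)
    then have "d \<in> S k" unfolding S_def by blast
    then show ?thesis using 3(1) by blast
  next
    case (4 k)
    show ?thesis
    proof (cases k)
      case 0
      then have "d \<in> S (2 * M - 1)" using 4 unfolding S_outer by blast
      then show ?thesis using last by blast
    next
      case (Suc k')
      then have "k' \<noteq> 2 * M - 1" "k' < 2 * M" using 4 by auto
      then show ?thesis using 4 Suc by (intro exI[of _ k']) (auto simp: S_def)
    qed
  qed
qed

lemma faces0: "faces EE rot0 = S ` {..<2 * M}"
proof
  show "faces EE rot0 \<subseteq> S ` {..<2 * M}"
  proof
    fix F assume "F \<in> faces EE rot0"
    then obtain d where d: "d \<in> darts EE" "F = fc0 d" by (auto simp: faces_def)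
    obtain k where "k < 2 * M" "d \<in> S k" using S_cover[OF d(1)] by blast
    then have "F = S k" using fc_on_S S_face d(2) by metis
    then show "F \<in> S ` {..<2 * M}" using \<open>k < 2 * M\<close> by simp
  qed
  show "S ` {..<2 * M} \<subseteq> faces EE rot0"
  proof
    fix F assume "F \<in> S ` {..<2 * M}"
    then obtain k where k: "k < 2 * M" "F = fc0 (f0 k)" using S_face by auto
    then show "F \<in> faces EE rot0" unfolding faces_def k(2) by (intro imageI f0_dart)
  qed
qed

lemma f0_not_bwd: "f0 k \<notin> bwd l"
  by (auto simp: f0_def bwd_def pv_eq_va eq_commute[of "va _"])

lemma f0_fwd: "f0 k \<in> fwd l \<Longrightarrow> k = l"
  by (auto simp: f0_def fwd_def pv_eq_vx eq_commute[of "vx k _"])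

lemma f0_S: "f0 k \<in> S l \<Longrightarrow> k = l"
  using f0_fwd f0_not_bwd unfolding S_def by (auto simp: f0_def split: if_splits)

lemma S_inj: "inj_on S {..<2 * M}"
  using f0_in f0_S by (intro inj_onI) metis

lemma card_faces0: "card (faces EE rot0) = 2 * M"
  unfolding faces0 using card_image[OF S_inj] by simp

lemma fwd_bwd_disjoint: "fwd k \<inter> bwd l = {}"
proof -
  have False if "j \<le> len k" "j' \<le> len l" "pv k j = pv l (Suc j')" "pv k (Suc j) = pv l j'" for j j'
  proof (cases j)
    case 0
    then show ?thesis using that(3) pv_eq_va[of l "Suc j'" "lv k"] by simp
  next
    case (Suc i)
    then have "pv l (Suc j') = vx k j" using that(1,3) by simp
    then have "l = k" "Suc j' = j" unfolding pv_eq_vx by auto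
    then show ?thesis using that(1,4) Suc pv_pred_succ[of j k] by auto
  qed
  then show ?thesis by (auto simp: fwd_def bwd_def)
qed

section \<open>Angle sums of the faces and Euler's formula\<close>

lemma fin_fb [simp]: "finite (fwd k)" "finite (bwd k)"
  by (simp_all add: fwd_def bwd_def)

lemma pv_inj: "inj_on (\<lambda>j. (pv k j, pv k (Suc j))) {..len k}" "inj_on (\<lambda>j. (pv k (Suc j), pv k j)) {..len k}"
proof -
  have "i = j" if "i \<le> len k" "j \<le> len k" "pv k i = pv k j" for i j
    using that by (auto simp: pv_def split: if_splits)
  then show "inj_on (\<lambda>j. (pv k j, pv k (Suc j))) {..len k}" "inj_on (\<lambda>j. (pv k (Suc j), pv k j)) {..len k}"
    by (auto simp: inj_on_def)
qed

lemma len_s: "int (len k) * sgn (s k) = s k"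
  by (simp add: len_def abs_mult_sgn)

lemma s_ne: "s k \<noteq> 0"
  using s_odd[of k] by auto

text \<open>For the face on its left, a right turn of the chain is reflex, hence the minus sign. The
  dart arriving at the pole is kept apart, since its corner belongs to a rail vertex.\<close>

lemma sum_fwd: "sum w0 (fwd k) = - s k + w0 (vx k (len k), vb (lv k))"
proof -
  have "sum w0 (fwd k) = (\<Sum>j\<le>len k. w0 (pv k j, pv k (Suc j)))"
    unfolding fwd_def by (simp add: sum.reindex[OF pv_inj(1)] o_def)
  also have "\<dots> = (\<Sum>j<len k. w0 (pv k j, pv k (Suc j))) + w0 (vx k (len k), vb (lv k))"
    by (simp add: lessThan_Suc_atMost[symmetric])
  also have "(\<Sum>j<len k. w0 (pv k j, pv k (Suc j))) = (\<Sum>j<len k. - sgn (s k))"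
  proof (rule sum.cong[OF refl])
    fix j assume "j \<in> {..<len k}"
    then show "w0 (pv k j, pv k (Suc j)) = - sgn (s k)"
      using ang0_vx(1)[of "Suc j" k] s_ne[of k] by (auto simp: w0_def)
  qed
  finally show ?thesis using len_s[of k] by simp
qed

lemma sum_bwd: "sum w0 (bwd k) = s k + w0 (vx k (Suc 0), va (lv k))"
proof -
  have "sum w0 (bwd k) = (\<Sum>j\<le>len k. w0 (pv k (Suc j), pv k j))"
    unfolding bwd_def by (simp add: sum.reindex[OF pv_inj(2)] o_def)
  also have "\<dots> = w0 (vx k (Suc 0), va (lv k)) + (\<Sum>j<len k. w0 (pv k (Suc (Suc j)), pv k (Suc j)))"
    by (simp add: lessThan_Suc_atMost[symmetric] sum.lessThan_Suc_shift del: sum.lessThan_Suc)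
  also have "(\<Sum>j<len k. w0 (pv k (Suc (Suc j)), pv k (Suc j))) = (\<Sum>j<len k. sgn (s k))"
  proof (rule sum.cong[OF refl])
    fix j assume "j \<in> {..<len k}"
    then show "w0 (pv k (Suc (Suc j)), pv k (Suc j)) = sgn (s k)"
      using ang0_vx(2)[of "Suc j" k] s_ne[of k] by (auto simp: w0_def)
  qed
  finally show ?thesis using len_s[of k] by simp
qed

lemma ladder_not_chain:
  "(va i, va j) \<notin> fwd k" "(va i, va j) \<notin> bwd k" "(vb i, vb j) \<notin> fwd k" "(vb i, vb j) \<notin> bwd k"
proof -
  have "pv k (Suc j) \<noteq> va i" "j \<le> len k \<Longrightarrow> pv k j \<noteq> vb i" for i j by (auto simp: pv_eq_va pv_vb)
  note n = this this[symmetric]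
  show "(va i, va j) \<notin> fwd k" "(va i, va j) \<notin> bwd k" "(vb i, vb j) \<notin> fwd k" "(vb i, vb j) \<notin> bwd k"
    using n by (auto simp: fwd_def bwd_def)
qed

text \<open>For even \<open>k\<close> both chains have the same \<open>s\<close> and four right
  angles remain; for odd \<open>k\<close> the second chain turns by 2 more and two right angles
  remain. On the external face the extreme chains give \<open>2 - 2 * M\<close>, the inner rail
  vertices \<open>2 * (M - 1)\<close> and the four reflex corners -4.\<close>

lemma face_sums:
  assumes k: "k < 2 * M" shows "sum w0 (S k) = (if k = 2 * M - 1 then - 4 else 4)"
  using k
proof (cases rule: chain_cases)
  case (1 i)
  have ne: "k \<noteq> 2 * M - 1" using 1 by presburger
  have "sum w0 (S k) = sum w0 (fwd (2 * i)) + sum w0 (bwd (Suc (2 * i))) + (w0 (vb i, vb (Suc i)) + w0 (va (Suc i), va i))"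
    unfolding 1(2) S_even[OF 1(1)] using ladder_not_chain fwd_bwd_disjoint
    by (subst sum.union_disjoint) (auto simp: sum.union_disjoint)
  also have "\<dots> = 4"
    using 1(1) M_ge unfolding sum_fwd sum_bwd by (auto simp: w0_def ang0_va ang0_vb s_def)
  finally show ?thesis using ne by simp
next
  case (2 i)
  have ne: "k \<noteq> 2 * M - 1" using 2 by presburger
  have "sum w0 (S k) = sum w0 (fwd (Suc (2 * i))) + sum w0 (bwd (2 * Suc i))"
    unfolding 2(2) S_odd[OF 2(1)] by (rule sum.union_disjoint) (auto simp: fwd_bwd_disjoint)
  also have "\<dots> = 4"
    using 2(1) unfolding sum_fwd sum_bwd lv_simps by (auto simp: w0_def ang0_va ang0_vb s_def)
  finally show ?thesis using ne by simp
next
  case 3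
  have M: "0 < M" "1 < M" "Suc (M - 1) = M" using M_ge by auto
  let ?A = "(\<lambda>i. (va i, va (Suc i))) ` {..<M}" and ?B = "(\<lambda>i. (vb (Suc i), vb i)) ` {..<M}"
  have "sum w0 (S k) = sum w0 (fwd (2 * M - 1)) + sum w0 (bwd 0) + sum w0 ?A + sum w0 ?B"
    unfolding 3 S_outer using ladder_not_chain fwd_bwd_disjoint
    by (subst sum.union_disjoint; (subst sum.union_disjoint)?; (subst sum.union_disjoint)?; auto)
  moreover have "sum w0 ?A = int M - 2"
  proof -
    have "sum w0 ?A = (\<Sum>i<M. w0 (va i, va (Suc i)))" by (subst sum.reindex) (auto simp: inj_on_def)
    also have "\<dots> = (\<Sum>i<M - 1. w0 (va i, va (Suc i))) + w0 (va (M - 1), va M)"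
      using sum.lessThan_Suc[of "\<lambda>i. w0 (va i, va (Suc i))" "M - 1"] M(3) by simp
    also have "(\<Sum>i<M - 1. w0 (va i, va (Suc i))) = (\<Sum>i<M - 1. 1)"
      by (rule sum.cong) (auto simp: w0_def ang0_va)
    finally show ?thesis using M by (simp add: w0_def ang0_va)
  qed
  moreover have "sum w0 ?B = int M - 2"
  proof -
    have "sum w0 ?B = (\<Sum>i<M. w0 (vb (Suc i), vb i))" by (subst sum.reindex) (auto simp: inj_on_def)
    also have "\<dots> = w0 (vb (Suc 0), vb 0) + (\<Sum>i<M - 1. w0 (vb (Suc (Suc i)), vb (Suc i)))"
      using sum.lessThan_Suc_shift[of "\<lambda>i. w0 (vb (Suc i), vb i)" "M - 1"] M(3) by simp
    also have "(\<Sum>i<M - 1. w0 (vb (Suc (Suc i)), vb (Suc i))) = (\<Sum>i<M - 1. 1)"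
      by (rule sum.cong) (auto simp: w0_def ang0_vb)
    finally show ?thesis using M by (simp add: w0_def ang0_vb)
  qed
  moreover have "sum w0 (fwd (2 * M - 1)) = - (int M - 1) - 1"
  proof -
    have "(2 * M - 1) div 2 = M - 1" using M by linarith
    then have "s (2 * M - 1) = int M - 1" using M by (simp add: s_def)
    then show ?thesis unfolding sum_fwd lv_end by (simp add: w0_def ang0_vb)
  qed
  moreover have "sum w0 (bwd 0) = 1 - int M - 1"
    unfolding sum_bwd lv_simps using M by (simp add: w0_def ang0_va s_def)
  ultimately show ?thesis using 3 by simp
qed

lemma card_VV: "card VV = 2 * (M + 1) + (\<Sum>k<2 * M. len k)"
proof -
  let ?X = "(\<lambda>(k, j). vx k j) ` (SIGMA k:{..<2 * M}. {1..len k})"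
  have "VV = (va ` {..M} \<union> vb ` {..M}) \<union> ?X" by (auto simp: VV_def)
  moreover have "card (va ` {..M}) = M + 1" "card (vb ` {..M}) = M + 1"
    by (subst card_image; auto simp: inj_on_def)+
  moreover have "card ?X = (\<Sum>k<2 * M. len k)"
    by (subst card_image) (auto simp: inj_on_def)
  moreover have "card ((va ` {..M} \<union> vb ` {..M}) \<union> ?X) = card (va ` {..M} \<union> vb ` {..M}) + card ?X"
    by (rule card_Un_disjoint) auto
  moreover have "card (va ` {..M} \<union> vb ` {..M}) = card (va ` {..M}) + card (vb ` {..M})"
    by (rule card_Un_disjoint) auto
  ultimately show ?thesis by simp
qed

text \<open>Every edge of a chain has an inner vertex as an end, and that vertex determines the
  chain.\<close>

lemma pv_edge_inj:
  assumes "j \<le> len k" "j' \<le> len k'" "{pv k j, pv k (Suc j)} = {pv k' j', pv k' (Suc j')}"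
  shows "k = k' \<and> j = j'"
proof -
  consider "pv k j = pv k' j'" "pv k (Suc j) = pv k' (Suc j')" | "pv k j = pv k' (Suc j')" "pv k (Suc j) = pv k' j'"
    using assms(3) by (auto simp: doubleton_eq_iff)
  then show ?thesis
  proof cases
    case 1
    show ?thesis
    proof (cases j)
      case 0
      then have "pv k' (Suc j') = vx k (Suc 0)" using 1(2) by simp
      then show ?thesis unfolding pv_eq_vx using 0 by auto
    next
      case (Suc i)
      then have "pv k' j' = vx k j" using 1(1) assms(1) by simp
      then show ?thesis unfolding pv_eq_vx by auto
    qed
  next
    case 2
    have "(pv k j, pv k (Suc j)) \<in> fwd k \<inter> bwd k'"
      using in_fwd(1)[OF assms(1)] in_bwd(1)[OF assms(2)] 2 by simp
    then show ?thesis using fwd_bwd_disjoint by blast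
  qed
qed

lemma card_EE: "card EE = 2 * M + (\<Sum>k<2 * M. len k + 1)"
proof -
  let ?A = "(\<lambda>i. {va i, va (Suc i)}) ` {..<M}" and ?B = "(\<lambda>i. {vb i, vb (Suc i)}) ` {..<M}"
  let ?X = "(\<lambda>(k, j). {pv k j, pv k (Suc j)}) ` (SIGMA k:{..<2 * M}. {..len k})"
  have "EE = (?A \<union> ?B) \<union> ?X" unfolding EE_def path_edges_ch by auto
  moreover have "card ?A = M" "card ?B = M"
    by (subst card_image; auto simp: inj_on_def doubleton_eq_iff)+
  moreover have "card ?X = (\<Sum>k<2 * M. len k + 1)"
  proof -
    have "inj_on (\<lambda>(k, j). {pv k j, pv k (Suc j)}) (SIGMA k:{..<2 * M}. {..len k})"
      using pv_edge_inj by (auto simp: inj_on_def)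
    then show ?thesis by (simp add: card_image)
  qed
  moreover have "card ((?A \<union> ?B) \<union> ?X) = card (?A \<union> ?B) + card ?X"
  proof (rule card_Un_disjoint)
    have "pv k (Suc j) \<noteq> va i" "j \<le> len k \<Longrightarrow> pv k j \<noteq> vb i" for i j k by (auto simp: pv_eq_va pv_vb)
    note n = this this[symmetric]
    show "(?A \<union> ?B) \<inter> ?X = {}" using n by (auto simp: doubleton_eq_iff)
  qed auto
  moreover have "card (?A \<union> ?B) = card ?A + card ?B"
    by (rule card_Un_disjoint) (auto simp: doubleton_eq_iff)
  ultimately show ?thesis by simp
qed

theorem ladder_rect_rep: "rect_rep VV EE rot0 ang0 (f0 (2 * M - 1))"
  unfolding rect_rep_def
proof (intro conjI ballI)
  have last: "2 * M - 1 < 2 * M" using M_ge by simp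
  fix v assume v: "v \<in> VV"
  show "bij_betw (rot0 v) (nbrs EE v) (nbrs EE v)" by (rule rotation_system.rot_bij[OF rs0 v])
  show "\<exists>k. (rot0 v ^^ k) x = y" if "x \<in> nbrs EE v" "y \<in> nbrs EE v" for x y
    by (rule rotation_system.rot_trans[OF rs0 v that])
  show "ang0 v u \<in> {1..4}" if "u \<in> nbrs EE v" for u using ang0_ok[OF v] that by blast
  show "(\<Sum>u\<in>nbrs EE v. ang0 v u) = 4" using ang0_ok[OF v] by blast
next
  have last: "2 * M - 1 < 2 * M" using M_ge by simp
  show "f0 (2 * M - 1) \<in> darts EE" by (rule f0_dart[OF last])
  \<comment> \<open>A chain has one edge more than inner vertices; this surplus over the
    \<open>2 * M\<close> chains balances the \<open>2 * M\<close> faces, and two rails have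
    \<open>2 * M\<close> edges but \<open>2 * M + 2\<close> vertices.\<close>
  show "card (faces EE rot0) + card VV = card EE + 2"
    unfolding card_faces0 card_VV card_EE sum.distrib by simp
  fix F assume "F \<in> faces EE rot0"
  then obtain k where k: "k < 2 * M" "F = S k" unfolding faces0 by blast
  have "F = fc0 (f0 (2 * M - 1)) \<longleftrightarrow> k = 2 * M - 1"
    unfolding S_face[OF last] k(2) using S_inj k(1) last by (auto simp: inj_on_def)
  moreover have "(\<Sum>(u, v)\<in>F. 2 - int (ang0 v u)) = sum w0 F"
    by (rule sum.cong) (auto simp: w0_def)
  ultimately show "(\<Sum>(u, v)\<in>F. 2 - int (ang0 v u)) = (if F = fc0 (f0 (2 * M - 1)) then - 4 else 4)"
    using face_sums[OF k(1)] k(2) by simp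
qed

end

section \<open>Chains: spirality and incidence with the external face\<close>

lemma in_nbrs_first:
  assumes "distinct (u # y # r)" shows "in_nbrs (path_edges (u # y # r)) u = {y}"
proof -
  have "{u, x} \<notin> path_edges (y # r)" for x
    using path_edges_sub[of "{u, x}" "y # r"] assms by auto
  then show ?thesis by (auto simp: in_nbrs_def path_edges_Cons doubleton_eq_iff)
qed

lemma chain_in_nbrs:
  assumes "distinct p" "2 \<le> length p"
  shows "card (in_nbrs (path_edges p) (hd p)) = 1" "card (in_nbrs (path_edges p) (last p)) = 1"
proof -
  have *: "card (in_nbrs (path_edges q) (hd q)) = 1" if q: "distinct q" "2 \<le> length q" for q
  proof -
    obtain u y r where "q = u # y # r" using q(2) by (cases q; cases "tl q") auto
    then show ?thesis using in_nbrs_first[of u y r] q(1) by simp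
  qed
  show "card (in_nbrs (path_edges p) (hd p)) = 1" by (rule *[OF assms])
  show "card (in_nbrs (path_edges p) (last p)) = 1"
    using *[of "rev p"] assms by (simp add: path_edges_rev hd_rev)
qed

text \<open>The first vertex of a chain has a single neighbour in it, so the path has no choice;
  having left that vertex it cannot return, and the rest is a path in the shorter chain.\<close>

lemma simple_path_unique:
  "distinct p \<Longrightarrow> 2 \<le> length p \<Longrightarrow> simple_path_in (path_edges p) (hd p) (last p) P \<Longrightarrow> P = p"
proof (induction p arbitrary: P)
  case (Cons u p)
  obtain y r where p: "p = y # r" using Cons.prems(2) by (cases p) auto
  have sp: "2 \<le> length P" "distinct P" "hd P = u" "last P = last p" "path_edges P \<subseteq> path_edges (u # y # r)"
    using Cons.prems(3) p by (auto simp: simple_path_in_def)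
  obtain x P' where P: "P = u # x # P'" using sp(1,3) by (cases P; cases "tl P") auto
  have "{u, x} \<in> path_edges (u # y # r)" using sp(5) P by (auto simp: path_edges_Cons)
  then have "x \<in> in_nbrs (path_edges (u # y # r)) u" by (simp add: in_nbrs_def)
  then have x: "x = y" using in_nbrs_first[of u y r] Cons.prems(1) p by simp
  show ?case
  proof (cases r)
    case Nil
    then have "last (x # P') = x" using sp(4) P p x by simp
    then have "P' = []" using sp(2) P by (cases P' rule: rev_cases) auto
    then show ?thesis using P p x Nil by simp
  next
    case (Cons a r')
    have "path_edges (x # P') \<subseteq> path_edges (y # r)"
    proof
      fix e assume e: "e \<in> path_edges (x # P')"
      then have "u \<notin> e" using path_edges_sub[OF e] sp(2) P by auto
      moreover have "e \<in> path_edges (u # y # r)" using e sp(5) P by (auto simp: path_edges_Cons)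
      ultimately show "e \<in> path_edges (y # r)" by (auto simp: path_edges_Cons)
    qed
    moreover have "P' \<noteq> []"
    proof
      assume "P' = []"
      then have "last (y # r) = y" using sp(4) P p x by simp
      then show False using Cons.prems(1) p Cons by (cases r' rule: rev_cases) auto
    qed
    then have "2 \<le> length (x # P')" by (cases P') auto
    ultimately have "simple_path_in (path_edges p) (hd p) (last p) (x # P')"
      using sp(2,4) P p x by (auto simp: simple_path_in_def)
    then have "x # P' = p" using Cons.prems(1) p Cons by (intro Cons.IH) auto
    then show ?thesis using P by simp
  qed
qed simp

text \<open>Inner degree one at both poles makes all aliases \<open>None\<close>, and
  \<open>SOME\<close> has the chain itself as its only candidate.\<close>

lemma spirality_chain:
  assumes "is_chain V E p" shows "spirality E rot ang (QN p) = real_of_int (pt rot ang p)"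
proof -
  have p: "distinct p" "2 \<le> length p" using assms by (auto simp: is_chain_def)
  have "simple_path_in (path_edges p) (hd p) (last p) p" using p by (simp add: simple_path_in_def)
  then have "(SOME P. simple_path_in (path_edges p) (hd p) (last p) P) = p"
    using simple_path_unique[OF p] by (intro some_equality)
  then show ?thesis
    using chain_in_nbrs[OF p]
    by (simp add: spirality_def Let_def alias_first_def alias_second_def spine_val_eq_pt)
qed

context rotation_system
begin

text \<open>A fixed point of the rotation would be an orbit of its own, against
  transitivity.\<close>

lemma deg2_rot:
  assumes v: "v \<in> V" and n: "nbrs E v = {x, y}" "x \<noteq> y" shows "rot v x = y"
proof (rule ccontr)
  assume "rot v x \<noteq> y"
  then have fix_x: "rot v x = x" using rot_in[of x v] n by auto
  obtain k where "(rot v ^^ k) x = y" using rot_trans[OF v, of x y] n by auto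
  moreover have "(rot v ^^ k) x = x" using fix_x by (induction k) auto
  ultimately show False using n by simp
qed

lemma rot_neq:
  assumes v: "v \<in> V" and n: "x \<in> nbrs E v" "y \<in> nbrs E v" "x \<noteq> y" shows "rot v x \<noteq> x"
proof
  assume fix_x: "rot v x = x"
  obtain k where "(rot v ^^ k) x = y" using rot_trans[OF v n(1,2)] by auto
  moreover have "(rot v ^^ k) x = x" using fix_x by (induction k) auto
  ultimately show False using n by simp
qed

lemma chain_rot:
  assumes p: "is_chain V E p" and i: "Suc (Suc i) < length p"
  shows "rot (p ! Suc i) (p ! i) = p ! Suc (Suc i)" "rot (p ! Suc i) (p ! Suc (Suc i)) = p ! i"
    "p ! i \<in> nbrs E (p ! Suc i)" "p ! Suc (Suc i) \<in> nbrs E (p ! Suc i)"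
proof -
  have pe: "path_edges p \<subseteq> E" "distinct p" using p by (auto simp: is_chain_def)
  have v: "p ! Suc i \<in> V" using p i by (auto simp: is_chain_def)
  show n: "p ! i \<in> nbrs E (p ! Suc i)" "p ! Suc (Suc i) \<in> nbrs E (p ! Suc i)"
    using path_edges_nth[OF pe(1), of i] path_edges_nth[OF pe(1), of "Suc i"] i
    by (auto simp: nbrs_def insert_commute)
  have ne: "p ! i \<noteq> p ! Suc (Suc i)" using pe(2) i by (simp add: nth_eq_iff_index_eq)
  have "0 < Suc i \<and> Suc i < length p - 1" using i by simp
  then have "card (nbrs E (p ! Suc i)) = 2" using p unfolding is_chain_def deg_def by blast
  then have "{p ! i, p ! Suc (Suc i)} = nbrs E (p ! Suc i)"
    using n ne fin_nbrs by (intro card_subset_eq) auto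
  then show "rot (p ! Suc i) (p ! i) = p ! Suc (Suc i)" "rot (p ! Suc i) (p ! Suc (Suc i)) = p ! i"
    using deg2_rot[OF v] ne by (metis, metis insert_commute)
qed

text \<open>At a vertex of degree 2 a face can only go on along the chain. Thus one edge of a chain
  on the external face brings the whole chain there.\<close>

lemma chain_face:
  assumes p: "is_chain V E p"
  shows "Suc i < length p \<Longrightarrow> fc (p ! i, p ! Suc i) = fc (p ! 0, p ! 1)"
    and "Suc i < length p \<Longrightarrow> fc (p ! Suc i, p ! i) = fc (p ! 1, p ! 0)"
proof -
  show "Suc i < length p \<Longrightarrow> fc (p ! i, p ! Suc i) = fc (p ! 0, p ! 1)"
  proof (induction i)
    case (Suc i)
    then show ?case using face_corner[OF chain_rot(3)[OF p Suc.prems]] chain_rot(1)[OF p Suc.prems] by simp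
  qed simp
  show "Suc i < length p \<Longrightarrow> fc (p ! Suc i, p ! i) = fc (p ! 1, p ! 0)"
  proof (induction i)
    case (Suc i)
    then show ?case using face_corner[OF chain_rot(4)[OF p Suc.prems]] chain_rot(2)[OF p Suc.prems] by simp
  qed simp
qed

lemma chain_outer:
  assumes p: "is_chain V E p" and e: "{x, y} \<in> path_edges p" and f: "fc (x, y) = fc d0"
  shows "chain_on_outer_face rot d0 p"
proof -
  obtain i where i: "Suc i < length p" "{x, y} = {p ! i, p ! Suc i}" using e by (auto simp: path_edges_def)
  consider "x = p ! i" "y = p ! Suc i" | "x = p ! Suc i" "y = p ! i" using i(2) by (auto simp: doubleton_eq_iff)
  then show ?thesis
  proof cases
    case 1
    have "(p ! j, p ! Suc j) \<in> fc d0" if "Suc j < length p" for j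
      using chain_face(1)[OF p that] chain_face(1)[OF p i(1)] 1 f face_self[of "(p ! j, p ! Suc j)"] by simp
    then show ?thesis unfolding chain_on_outer_face_def path_edges_def by blast
  next
    case 2
    have "(p ! Suc j, p ! j) \<in> fc d0" if "Suc j < length p" for j
      using chain_face(2)[OF p that] chain_face(2)[OF p i(1)] 2 f face_self[of "(p ! Suc j, p ! j)"] by simp
    then show ?thesis
      unfolding chain_on_outer_face_def path_edges_def by (auto simp: insert_commute)
  qed
qed

end

context ladder_rep
begin

text \<open>The chains for which decompositions were constructed. A rail edge between two inner
  levels is a chain too, but \<open>outer_root\<close> always finds one of the present kind on the
  external face.\<close>

definition roots :: "nat list set" where
  "roots = {ch k | k. k < 2 * M \<and> 1 \<le> lv k \<and> lv k < M} \<union> {zup, zdn}"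

lemma roots_chain: "p \<in> roots \<Longrightarrow> is_chain VV EE p"
  using chain_ch zup_chain(1) zdn_chain(1) by (auto simp: roots_def)

lemma chain_in_root:
  assumes k: "k < 2 * M" shows "\<exists>p\<in>roots. path_edges (ch k) \<subseteq> path_edges p"
proof (cases "1 \<le> lv k \<and> lv k < M")
  case True
  then show ?thesis using k by (auto simp: roots_def)
next
  case False
  then have "k = 0 \<or> k = 2 * M - 1" using k by (auto simp: lv_def)
  then show ?thesis
  proof
    assume "k = 0"
    then have "path_edges (ch k) \<subseteq> path_edges zdn" unfolding zdn_chain(3) by (auto simp: sedge_def)
    then show ?thesis by (auto simp: roots_def)
  next
    assume "k = 2 * M - 1"
    then have "path_edges (ch k) \<subseteq> path_edges zup"
      unfolding zup_chain(3) using M_ge by (auto simp: sedge_def)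
    then show ?thesis by (auto simp: roots_def)
  qed
qed

definition root_dart :: "(nat \<times> nat) set \<Rightarrow> bool" where
  "root_dart F \<longleftrightarrow> (\<exists>p\<in>roots. \<exists>x y. {x, y} \<in> path_edges p \<and> fc (x, y) = F)"

text \<open>A face that runs along a rail of the ladder turns into a chain sooner or later.\<close>

lemma walk_rail:
  assumes nb: "\<And>i. 0 < i \<Longrightarrow> i < M \<Longrightarrow> f i \<in> VV \<and> nbrs EE (f i) = {f (Suc i), f (i - 1), h (2 * i), h (2 * i - 1)}"
    and inj: "\<And>i j. f i = f j \<longleftrightarrow> i = j"
    and h: "\<And>i k. 0 < i \<Longrightarrow> i < M \<Longrightarrow> k = 2 * i \<or> k = 2 * i - 1 \<Longrightarrow> {f i, h k} \<in> path_edges (ch k)"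
    and ends: "{f (M - 1), f M} \<in> path_edges zup" "{f 0, f 1} \<in> path_edges zdn"
  shows "i < M \<Longrightarrow> root_dart (fc (f i, f (Suc i)))" and "i < M \<Longrightarrow> root_dart (fc (f (Suc i), f i))"
proof -
  have rd: "root_dart (fc (f i, h k))" if "0 < i" "i < M" "k = 2 * i \<or> k = 2 * i - 1" for i k
  proof -
    have "k < 2 * M" using that by auto
    then obtain p where "p \<in> roots" "path_edges (ch k) \<subseteq> path_edges p" using chain_in_root by blast
    then show ?thesis using h[OF that] unfolding root_dart_def by blast
  qed
  have zr: "zup \<in> roots" "zdn \<in> roots" by (auto simp: roots_def)
  \<comment> \<open>A face going up a rail enters a chain at the latest at the top, where the last
    rail edge is part of \<open>zup\<close>; so the induction starts there. Going down,
    \<open>zdn\<close> plays this role.\<close>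
  have "root_dart (fc (f (M - 1 - n), f (Suc (M - 1 - n))))" if "n \<le> M - 1" for n
    using that
  proof (induction n)
    case 0
    have "Suc (M - 1) = M" using M_ge by simp
    then show ?case using ends(1) zr unfolding root_dart_def by auto
  next
    case (Suc n)
    define l where "l = M - 1 - Suc n"
    have l: "M - 1 - n = Suc l" "Suc l < M" using Suc.prems by (auto simp: l_def)
    have nl: "f (Suc l) \<in> VV" "nbrs EE (f (Suc l)) = {f (Suc (Suc l)), f l, h (2 * Suc l), h (2 * Suc l - 1)}"
      using nb[of "Suc l"] l(2) by auto
    have u: "f l \<in> nbrs EE (f (Suc l))" unfolding nl(2) by simp
    let ?w = "rot (f (Suc l)) (f l)"
    have "?w \<noteq> f l" using rot_neq[OF nl(1) u, of "f (Suc (Suc l))"] inj[of l "Suc (Suc l)"] nl(2) by auto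
    then have "?w = f (Suc (Suc l)) \<or> ?w = h (2 * Suc l) \<or> ?w = h (2 * Suc l - 1)"
      using rot_in[OF u] nl(2) by auto
    moreover have "fc (f (Suc l), ?w) = fc (f l, f (Suc l))" by (rule face_corner[OF u])
    moreover have "root_dart (fc (f (Suc l), f (Suc (Suc l))))" using Suc.IH Suc.prems unfolding l(1) by simp
    ultimately have "root_dart (fc (f l, f (Suc l)))" using rd[of "Suc l"] l(2) by (metis zero_less_Suc)
    then show ?case unfolding l_def .
  qed
  note up = this
  show "root_dart (fc (f i, f (Suc i)))" if "i < M"
  proof -
    have "M - 1 - (M - 1 - i) = i" "M - 1 - i \<le> M - 1" using that by auto
    then show ?thesis using up[of "M - 1 - i"] by metis
  qed
  show "i < M \<Longrightarrow> root_dart (fc (f (Suc i), f i))"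
  proof (induction i)
    case 0
    have "{f (Suc 0), f 0} \<in> path_edges zdn" using ends(2) by (simp add: insert_commute)
    then show ?case using zr unfolding root_dart_def by blast
  next
    case (Suc l)
    then have l: "Suc l < M" by simp
    have nl: "f (Suc l) \<in> VV" "nbrs EE (f (Suc l)) = {f (Suc (Suc l)), f l, h (2 * Suc l), h (2 * Suc l - 1)}"
      using nb[of "Suc l"] l by auto
    have u: "f (Suc (Suc l)) \<in> nbrs EE (f (Suc l))" unfolding nl(2) by simp
    let ?w = "rot (f (Suc l)) (f (Suc (Suc l)))"
    have "?w \<noteq> f (Suc (Suc l))" using rot_neq[OF nl(1) u, of "f l"] inj[of "Suc (Suc l)" l] nl(2) by auto
    then have "?w = f l \<or> ?w = h (2 * Suc l) \<or> ?w = h (2 * Suc l - 1)"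
      using rot_in[OF u] nl(2) by auto
    moreover have "fc (f (Suc l), ?w) = fc (f (Suc (Suc l)), f (Suc l))" by (rule face_corner[OF u])
    moreover have "root_dart (fc (f (Suc l), f l))" using Suc by simp
    ultimately show ?case using rd[of "Suc l"] l by (metis zero_less_Suc)
  qed
qed

lemma root_edge_ends:
  "{va (M - 1), va M} \<in> path_edges zup" "{va 0, va 1} \<in> path_edges zdn"
  "{vb (M - 1), vb M} \<in> path_edges zup" "{vb 0, vb 1} \<in> path_edges zdn"
proof -
  have M: "Suc (M - 1) = M" and m: "M - 1 \<in> {M - 1..<M}" using M_ge by auto
  have "{va (M - 1), va (Suc (M - 1))} \<in> path_edges zup"
    unfolding zup_chain(3) sedge_def by (rule UnI1, rule UnI1, rule image_eqI[OF _ m], rule refl)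
  then show "{va (M - 1), va M} \<in> path_edges zup" unfolding M .
  have "{vb (M - 1), vb (Suc (M - 1))} \<in> path_edges zup"
    unfolding zup_chain(3) sedge_def by (rule UnI1, rule UnI2, rule image_eqI[OF _ m], rule refl)
  then show "{vb (M - 1), vb M} \<in> path_edges zup" unfolding M .
  show "{va 0, va 1} \<in> path_edges zdn" "{vb 0, vb 1} \<in> path_edges zdn"
    unfolding zdn_chain(3) sedge_def by auto
qed

text \<open>A dart of the external face lies on a chain or on a rail, and in the second case
  \<open>walk_rail\<close> follows the face until it meets a chain of \<open>roots\<close>.\<close>

lemma outer_root: "\<exists>p\<in>roots. chain_on_outer_face rot d0 p"
proof -
  obtain u v where d0: "d0 = (u, v)" by (cases d0)
  have "d0 \<in> darts EE" using rep by (simp add: rect_rep_def)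
  then have "adj u v \<or> adj v u" using dart_iff d0 by simp
  have walkA: "root_dart (fc (va i, va (Suc i)))" "root_dart (fc (va (Suc i), va i))" if "i < M" for i
  proof -
    have nb: "va i \<in> VV \<and> nbrs EE (va i) = {va (Suc i), va (i - 1), vx (2 * i) 1, vx (2 * i - 1) 1}" if "0 < i" "i < M" for i
      using that nbrs_va[of i] nA_mid[OF that] va_in[of i] by auto
    have h: "{va i, vx k 1} \<in> path_edges (ch k)" if "0 < i" "i < M" "k = 2 * i \<or> k = 2 * i - 1" for i k
      unfolding path_edges_ch using that by (intro CollectI exI[of _ 0]) auto
    show "root_dart (fc (va i, va (Suc i)))" "root_dart (fc (va (Suc i), va i))"
      using walk_rail[of va "\<lambda>k. vx k 1", OF nb _ h root_edge_ends(1,2) that] by auto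
  qed
  have walkB: "root_dart (fc (vb i, vb (Suc i)))" "root_dart (fc (vb (Suc i), vb i))" if "i < M" for i
  proof -
    have nb: "vb i \<in> VV \<and> nbrs EE (vb i) = {vb (Suc i), vb (i - 1), vx (2 * i) (len (2 * i)), vx (2 * i - 1) (len (2 * i - 1))}"
      if "0 < i" "i < M" for i
      using that nbrs_vb[of i] nB_mid[OF that] vb_in[of i] by auto
    have h: "{vb i, vx k (len k)} \<in> path_edges (ch k)" if "0 < i" "i < M" "k = 2 * i \<or> k = 2 * i - 1" for i k
      unfolding path_edges_ch using that by (intro CollectI exI[of _ "len k"]) (auto simp: insert_commute)
    show "root_dart (fc (vb i, vb (Suc i)))" "root_dart (fc (vb (Suc i), vb i))"
      using walk_rail[of vb "\<lambda>k. vx k (len k)", OF nb _ h root_edge_ends(3,4) that] by auto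
  qed
  have chain: "root_dart (fc (x, y))" if "{x, y} \<in> path_edges (ch k)" "k < 2 * M" for x y k
    using chain_in_root[OF that(2)] that(1) unfolding root_dart_def by blast
  have "root_dart (fc d0)"
    using \<open>adj u v \<or> adj v u\<close>
  proof
    assume "adj u v"
    then show ?thesis
      unfolding adj_def d0
    proof (elim disjE exE conjE)
      fix k j assume k: "k < 2 * M" "j \<le> len k" "u = pv k j" "v = pv k (Suc j)"
      show "root_dart (fc (u, v))" by (rule chain[OF _ k(1)]) (use k in \<open>auto simp: path_edges_ch\<close>)
    qed (simp_all add: walkA walkB)
  next
    assume "adj v u"
    then show ?thesis
      unfolding adj_def d0
    proof (elim disjE exE conjE)
      fix k j assume k: "k < 2 * M" "j \<le> len k" "v = pv k j" "u = pv k (Suc j)"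
      show "root_dart (fc (u, v))"
        by (rule chain[OF _ k(1)]) (use k in \<open>auto simp: path_edges_ch insert_commute\<close>)
    qed (simp_all add: walkA walkB)
  qed
  then obtain p x y where p: "p \<in> roots" "{x, y} \<in> path_edges p" "fc (x, y) = fc d0"
    unfolding root_dart_def by blast
  have "chain_on_outer_face rot d0 p" by (rule chain_outer[OF roots_chain[OF p(1)] p(2,3)])
  then show ?thesis using p(1) by blast
qed

text \<open>The external face dictates the reference chain. If this is the very chain with the large
  turn, its neighbour is used instead; losing at most 6 from \<open>2 * m + 3\<close> explains the
  bound.\<close>

theorem large_spirality:
  "\<exists>\<rho> T \<nu>. rooted_decomp VV EE \<rho> T \<and> chain_on_outer_face rot d0 \<rho> \<and> \<nu> \<in> nodes T
    \<and> \<bar>spirality EE rot ang \<nu>\<bar> \<ge> 2 * real m - 3"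
proof -
  obtain \<rho> where \<rho>: "\<rho> \<in> roots" "chain_on_outer_face rot d0 \<rho>" using outer_root by blast
  have M: "1 \<le> M - 1" "M - 1 < M" "(2::nat) < 2 * M" "1 \<le> lv 2" "lv 2 < M" using M_ge by (auto simp: lv_def)
  have big: "\<bar>spirality EE rot ang (QN p)\<bar> \<ge> 2 * real m - 3"
    if "is_chain VV EE p" "\<bar>pt rot ang p\<bar> \<ge> 2 * int m - 3" for p
  proof -
    have "real_of_int (2 * int m - 3) \<le> real_of_int \<bar>pt rot ang p\<bar>" using that(2) by (simp only: of_int_le_iff)
    moreover have "real_of_int (2 * int m - 3) = 2 * real m - 3" by simp
    ultimately show ?thesis unfolding spirality_chain[OF that(1)] of_int_abs by linarith
  qed
  have c1: "is_chain VV EE (ch (2 * (M - 1)))" using M by (intro chain_ch) auto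
  have c2: "is_chain VV EE (ch 2)" using M by (intro chain_ch) auto
  have mid: "\<exists>T. rooted_decomp VV EE \<rho> T \<and> QN zup \<in> nodes T \<and> QN zdn \<in> nodes T"
    if "\<rho> \<noteq> zup" "\<rho> \<noteq> zdn"
    using \<rho>(1) that root_middle by (auto simp: roots_def)
  have "\<exists>T p. rooted_decomp VV EE \<rho> T \<and> is_chain VV EE p \<and> QN p \<in> nodes T \<and> \<bar>pt rot ang p\<bar> \<ge> 2 * int m - 3"
    using forced
  proof
    assume f: "int (2 * m + 3) \<le> \<bar>pt rot ang zup\<bar> \<and> \<bar>pt rot ang zup - pt rot ang (ch (2 * (M - 1)))\<bar> \<le> 6"
    then have b: "\<bar>pt rot ang zup\<bar> \<ge> 2 * int m - 3" "\<bar>pt rot ang (ch (2 * (M - 1)))\<bar> \<ge> 2 * int m - 3" by auto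
    show ?thesis
    proof (cases "\<rho> = zup")
      case True
      then show ?thesis using root_up c1 b(2) by blast
    next
      case False
      then show ?thesis using mid root_dn zup_chain(1) b(1) by blast
    qed
  next
    assume f: "int (2 * m + 3) \<le> \<bar>pt rot ang zdn\<bar> \<and> \<bar>pt rot ang zdn - pt rot ang (ch 2)\<bar> \<le> 6"
    then have b: "\<bar>pt rot ang zdn\<bar> \<ge> 2 * int m - 3" "\<bar>pt rot ang (ch 2)\<bar> \<ge> 2 * int m - 3" by auto
    show ?thesis
    proof (cases "\<rho> = zdn")
      case True
      then show ?thesis using root_dn c2 b(2) by blast
    next
      case False
      then show ?thesis using mid root_up zdn_chain(1) b(1) by blast
    qed
  qed
  then show ?thesis using \<rho>(2) big by blast
qed

end

section \<open>The size of the ladder and the final estimate\<close>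

context ladder
begin

lemma len_le: "k < 2 * M \<Longrightarrow> len k \<le> M"
proof -
  assume "k < 2 * M"
  then have "k div 2 < M" by simp
  then show ?thesis by (auto simp: len_def s_def)
qed

text \<open>The lower bound provides infinitely many sizes; the upper one expresses the quadratic
  size by a square, which suits the logarithm.\<close>

lemma card_VV_bounds:
  assumes "3 \<le> m" shows "m \<le> card VV" "card VV \<le> (6 * m)\<^sup>2"
proof -
  show "m \<le> card VV" unfolding card_VV M_def by simp
  have "(\<Sum>k<2 * M. len k) \<le> (\<Sum>k<2 * M. M)" by (rule sum_mono) (simp add: len_le)
  then have "card VV \<le> 2 * (M + 1) + 2 * M * M" unfolding card_VV by simp
  also have "\<dots> = 8 * (m * m) + 20 * m + 14" by (simp add: M_def algebra_simps)
  also have "\<dots> \<le> (6 * m)\<^sup>2"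
  proof -
    have "3 * m \<le> m * m" using assms by simp
    moreover have "(6 * m)\<^sup>2 = 36 * (m * m)" by (simp add: power2_eq_square)
    ultimately show ?thesis using assms by linarith
  qed
  finally show "card VV \<le> (6 * m)\<^sup>2" .
qed

text \<open>By \<open>ln x \<le> x - 1\<close>, the logarithm of the size is at most
  \<open>2 * ln (6 * m) \<le> 12 * m\<close>. The factor 1/12 then asks for
  \<open>m \<le> 2 * m - 3\<close>, which is where \<open>3 \<le> m\<close> comes from.\<close>

lemma ln_card_VV:
  assumes "3 \<le> m" shows "1 / 12 * ln (real (card VV)) \<le> 2 * real m - 3"
proof -
  note b = card_VV_bounds[OF assms]
  have "0 < card VV" using b(1) assms by simp
  moreover have "real (card VV) \<le> real ((6 * m)\<^sup>2)" using b(2) by (simp only: of_nat_le_iff)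
  ultimately have "ln (real (card VV)) \<le> ln (real (6 * m) ^ 2)" using assms by (subst ln_le_cancel_iff) auto
  also have "\<dots> = 2 * ln (real (6 * m))" by (subst ln_realpow) (use assms in simp_all)
  also have "\<dots> \<le> 2 * (real (6 * m) - 1)" using assms ln_le_minus_one[of "real (6 * m)"] by simp
  finally have "ln (real (card VV)) \<le> 12 * real m" by simp
  then show ?thesis using assms by simp
qed

end

theorem theorem2:
  shows "\<exists>c > (0::real). infinite {n::nat. \<exists>V E.
     card V = n \<and> sp_graph V E \<and> indep_parallel V E \<and>
     (\<exists>rot ang d0. rect_rep V E rot ang d0) \<and>
     (\<forall>rot ang d0. rect_rep V E rot ang d0 \<longrightarrow>
        (\<exists>\<rho> T \<nu>. rooted_decomp V E \<rho> T \<and> chain_on_outer_face rot d0 \<rho> \<and>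
           \<nu> \<in> nodes T \<and> \<bar>spirality E rot ang \<nu>\<bar> \<ge> c * ln (real n)))}"
    (is "\<exists>c > 0. infinite (?A c)")
proof (intro exI conjI)
  show "(0::real) < 1 / 12" by simp
  have in_A: "card (ladder.VV m) \<in> ?A (1 / 12)" if m: "3 \<le> m" for m
  proof -
    interpret ladder m .
    have "\<exists>\<rho> T \<nu>. rooted_decomp VV EE \<rho> T \<and> chain_on_outer_face rot d0 \<rho> \<and>
        \<nu> \<in> nodes T \<and> \<bar>spirality EE rot ang \<nu>\<bar> \<ge> 1 / 12 * ln (real (card VV))"
      if "rect_rep VV EE rot ang d0" for rot ang d0
    proof -
      interpret ladder_rep m rot ang d0
        by (intro ladder_rep.intro rectilinear.intro simple_ladder connected_ladder that)
      show ?thesis using large_spirality ln_card_VV[OF m] order_trans by blast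
    qed
    then show ?thesis
      using sp_ladder indep_parallel_ladder ladder_rect_rep by blast
  qed
  show "infinite (?A (1 / 12))"
  proof
    assume "finite (?A (1 / 12))"
    then obtain b where b: "\<forall>n\<in>?A (1 / 12). n \<le> b" unfolding finite_nat_set_iff_bounded_le by blast
    \<comment> \<open>The ladder with parameter \<open>b + 3\<close> has more than \<open>b\<close>
      vertices, and the shift by 3 makes the parameter admissible.\<close>
    have "card (ladder.VV (b + 3)) \<le> b" using in_A[of "b + 3"] b by simp
    moreover have "b + 3 \<le> card (ladder.VV (b + 3))" using ladder.card_VV_bounds(1)[of "b + 3"] by simp
    ultimately show False by simp
  qed
qed

end
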